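(* Let $n$ be a positive integer. Let $D_{n^2}$ be the Weyl algebra over $\mathbb{C}$ in the entries $t_{ij}$ of an $n\times n$ matrix $\Theta=(t_{ij})$ with derivations $\partial_{ij}=\partial/\partial t_{ij}$, and let $J'\subset J\subset D_{n^2}$ be the left ideals $$J'=\langle\, g_{ij}\ (1\le i\le j\le n),\ P_{ij}\ (1\le i<j\le n)\,\rangle,\qquad J=\langle\, d\,\rangle+J',$$ where $d=1-\det\big((\partial_{ij})\big)$, $\;g_{ij}=\delta_{ij}-\sum_{k=1}^n\partial_{ik}\partial_{jk}$, and $P_{ij}=\sum_{k=1}^n\big(t_{ik}\partial_{jk}-t_{jk}\partial_{ik}\big)$. Let $K$ be the left ideal of the Weyl algebra $D_{\binom{n+1}{2}}$ in the variables $y_{kl}$, $1\le k\le l\le n$ (with the convention $y_{kl}=y_{lk}$, $\partial_{kl}=\partial_{lk}=\partial/\partial y_{kl}$), generated by the operators $$h_{ij}=2^{\delta_{ij}}\,n\cdot\partial_{ij}-\delta_{ij}+\sum_{k,l=1}^n 2^{\delta_{ki}+\delta_{lj}}\,y_{kl}\cdot\partial_{ik}\partial_{jl}\qquad(1\le i\le j\le n).$$ Let $y_{ij}(\Theta)$ denote the entries of the symmetric matrix $Y=\Theta^{\mathrm t}\cdot\Theta$. Then a holomorphic function is a solution to $J'$ if and only if it is of the form $\Theta\mapsto\phi(y_{ij}(\Theta))$, where $\phi$ is a solution to $K$. In particular, $$\operatorname{rank}(K)=2\cdot\operatorname{rank}(J).$$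
   Context: For a left ideal $L$ in a Weyl algebra $D_N=\mathbb{C}[x_1,\dots,x_N]\langle\partial_1,\dots,\partial_N\rangle$, let $R_N=\mathbb{C}(x_1,\dots,x_N)\langle\partial_1,\dots,\partial_N\rangle$ be the rational Weyl algebra. The holonomic rank of $L$ is $\operatorname{rank}(L)=\dim_{\mathbb{C}(x_1,\dots,x_N)}(R_N/R_NL)$; for holonomic $L$ it equals the $\mathbb{C}$-dimension of the space of holomorphic solutions of $L$ on a small ball disjoint from the singular locus of $L$. A function $f$ is a solution to $L$ if $P\bullet f=0$ for all $P\in L$, where $\bullet$ denotes the action of differential operators on functions. $\delta_{ij}$ is the Kronecker delta. The ideal $J$ is the annihilator in $D_{n^2}$ of the normalizing constant $c(\Theta)=\int_{\mathrm{SO}(n)}\exp(\operatorname{tr}(\Theta^{\mathrm t}Y))\,\mu(dY)$ of the Fisher distribution on $\mathrm{SO}(n)$, with $\mu$ the Haar probability measure; $J'$ is its analogue for the orthogonal group $\mathrm{O}(n)$.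
   Formalization: The "only if" part is stated for functions on open sets of invertible Θ, with φ existing locally around each point; as worded it fails, e.g. n=1, f=exp(t), which is not a single-valued holomorphic function of y=t² near t=0 or on all t≠0. *)

theory Defs
  imports
    "HOL-Analysis.Analysis"
    "HOL-Computational_Algebra.Fraction_Field"
    "HOL-Library.Poly_Mapping"
    "HOL-Library.Uprod"
    "HOL-Library.Extended_Nat"
begin

subsection \<open>Multi-indices, polynomials and rational functions\<close>

text \<open>
  Multi-indices over a finite type \<^typ>\<open>'v\<close> of variables. Besides addition they carry a
  (lexicographic) linear order, whose only purpose is that the library then turns
  polynomials into an integral domain.
\<close>

typedef 'v mindex = "UNIV :: ('v \<Rightarrow> nat) set"
  morphisms expo MIndex ..

setup_lifting type_definition_mindex

instantiation mindex :: (type) cancel_comm_monoid_add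
begin

lift_definition zero_mindex :: "'v mindex" is "\<lambda>_. 0" .
lift_definition plus_mindex :: "'v mindex \<Rightarrow> 'v mindex \<Rightarrow> 'v mindex" is "\<lambda>a b v. a v + b v" .
lift_definition minus_mindex :: "'v mindex \<Rightarrow> 'v mindex \<Rightarrow> 'v mindex" is "\<lambda>a b v. a v - b v" .

instance
  by standard (transfer; auto simp: fun_eq_iff)+

end

instantiation mindex :: (finite) linorder
begin

definition less_mindex :: "'v::finite mindex \<Rightarrow> 'v mindex \<Rightarrow> bool" where
  "less_mindex a b \<longleftrightarrow>
     (\<exists>v. expo a v < expo b v \<and> (\<forall>w. to_nat w < to_nat v \<longrightarrow> expo a w = expo b w))"

definition less_eq_mindex :: "'v::finite mindex \<Rightarrow> 'v mindex \<Rightarrow> bool" where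
  "less_eq_mindex a b \<longleftrightarrow> a < b \<or> a = b"

instance
proof (rule linorder.intro_of_class, rule linorder_strictI, rule order_strictI)
  fix a b c :: "'v::finite mindex"
  show "a \<le> b \<longleftrightarrow> a < b \<or> a = b"
    by (rule less_eq_mindex_def)
  show "\<not> a < a"
    by (simp add: less_mindex_def)
  show not_sym: "\<not> b < a" if "a < b"
    using that unfolding less_mindex_def
    by (metis inj_eq inj_to_nat less_asym less_imp_neq linorder_neqE_nat)
  show "a < c" if "a < b" "b < c"
  proof -
    obtain v where v: "expo a v < expo b v" "\<forall>w. to_nat w < to_nat v \<longrightarrow> expo a w = expo b w"
      using \<open>a < b\<close> by (auto simp: less_mindex_def)
    obtain u where u: "expo b u < expo c u" "\<forall>w. to_nat w < to_nat u \<longrightarrow> expo b w = expo c w"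
      using \<open>b < c\<close> by (auto simp: less_mindex_def)
    show ?thesis
    proof (cases "to_nat v \<le> to_nat u")
      case True
      then have "expo a v < expo c v"
        using u v by (cases "v = u") (auto simp: le_less)
      then show ?thesis
        unfolding less_mindex_def using True u v by (intro exI[of _ v]) auto
    next
      case False
      then show ?thesis
        unfolding less_mindex_def using u v by (intro exI[of _ u]) auto
    qed
  qed
  show "a < b \<or> a = b \<or> b < a"
  proof (cases "a = b")
    case False
    then have "\<exists>v. expo a v \<noteq> expo b v"
      by (metis expo_inject ext)
    then obtain v where v: "expo a v \<noteq> expo b v"
      and min: "\<And>w. expo a w \<noteq> expo b w \<Longrightarrow> to_nat v \<le> to_nat w"
      using ex_has_least_nat[of "\<lambda>v. expo a v \<noteq> expo b v" _ to_nat] by auto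
    then have "\<forall>w. to_nat w < to_nat v \<longrightarrow> expo a w = expo b w"
      by (meson not_less)
    then show ?thesis
      using v unfolding less_mindex_def by (metis linorder_neqE_nat)
  qed simp
qed

end

instance mindex :: (finite) ordered_cancel_comm_monoid_add
proof
  fix a b c :: "'v::finite mindex"
  assume "a \<le> b"
  moreover have "c + a < c + b" if "a < b"
    using that by (auto simp: less_mindex_def plus_mindex.rep_eq)
  ultimately show "c + a \<le> c + b"
    by (auto simp: le_less)
qed

lift_definition unit_index :: "'v \<Rightarrow> 'v mindex" is "\<lambda>v w. of_bool (w = v)" .

type_synonym 'v mpoly = "'v mindex \<Rightarrow>\<^sub>0 complex"
type_synonym 'v ratfun = "'v mpoly fract"

definition mvar :: "'v \<Rightarrow> 'v mpoly" where
  "mvar v = Poly_Mapping.single (unit_index v) 1"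

definition mpeval :: "'v::finite mpoly \<Rightarrow> complex ^ 'v \<Rightarrow> complex" where
  "mpeval p x = (\<Sum>m\<in>Poly_Mapping.keys p. Poly_Mapping.lookup p m * (\<Prod>v\<in>UNIV. x $ v ^ expo m v))"

definition mpderiv :: "'v \<Rightarrow> 'v mpoly \<Rightarrow> 'v mpoly" where
  "mpderiv v p = (\<Sum>m\<in>Poly_Mapping.keys p.
     Poly_Mapping.single (m - unit_index v) (of_nat (expo m v) * Poly_Mapping.lookup p m))"

lemma poly_mapping_sum_single:
  "p = (\<Sum>m\<in>Poly_Mapping.keys p. Poly_Mapping.single m (Poly_Mapping.lookup p m))"
  by (rule poly_mapping_eqI)
    (auto simp: lookup_sum lookup_single when_def in_keys_iff)

lemma poly_mapping_add_induct [case_names zero single add]: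
  assumes "P 0" "\<And>m c. P (Poly_Mapping.single m c)"
    and "\<And>p q. P p \<Longrightarrow> P q \<Longrightarrow> P (p + q)"
  shows "P (p :: 'a \<Rightarrow>\<^sub>0 'b::comm_monoid_add)"
proof -
  have "P (\<Sum>m\<in>A. Poly_Mapping.single m (Poly_Mapping.lookup p m))" if "finite A" for A
    using that by induction (use assms in auto)
  then show ?thesis
    by (subst poly_mapping_sum_single) simp
qed

lemma mpderiv_add: "mpderiv v (p + q) = mpderiv v p + mpderiv v q"
  unfolding mpderiv_def
  by (rule setsum_keys_plus_distrib) (simp_all add: single_add distrib_left)

lemma mpderiv_0 [simp]: "mpderiv v 0 = 0"
  by (simp add: mpderiv_def)

lemma mpderiv_single:
  "mpderiv v (Poly_Mapping.single m c) = Poly_Mapping.single (m - unit_index v) (of_nat (expo m v) * c)"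
  by (simp add: mpderiv_def)

lemma mpderiv_uminus: "mpderiv v (- p) = - mpderiv v p"
  using mpderiv_add[of v p "- p"] by (simp add: eq_neg_iff_add_eq_0 add.commute)

lemma mindex_shift: "0 < expo m v \<Longrightarrow> m - unit_index v + k = m + k - unit_index v"
  by transfer (auto simp: fun_eq_iff)

lemma mpderiv_mult: "mpderiv v (p * q) = mpderiv v p * q + p * mpderiv v q"
proof (induction p rule: poly_mapping_add_induct)
  case (single m c)
  show ?case
  proof (induction q rule: poly_mapping_add_induct)
    case (single k d)
    have "expo (m + k) v = expo m v + expo k v"
      by transfer simp
    moreover have "m - unit_index v + k = m + k - unit_index v" if "0 < expo m v"
      using that by (rule mindex_shift)
    moreover have "m + (k - unit_index v) = m + k - unit_index v" if "0 < expo k v"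
      using mindex_shift[OF that, of m] by (simp add: add.commute)
    ultimately show ?case
      by (cases "expo m v = 0"; cases "expo k v = 0")
        (auto simp: mult_single mpderiv_single algebra_simps simp flip: single_add)
  qed (simp_all add: mpderiv_add algebra_simps)
qed (simp_all add: mpderiv_add algebra_simps)

lemma mpderiv_commute: "mpderiv v (mpderiv w p) = mpderiv w (mpderiv v p)"
proof (induction p rule: poly_mapping_add_induct)
  case (single m c)
  have "m - unit_index w - unit_index v = m - unit_index v - unit_index w"
    by transfer (auto simp: fun_eq_iff)
  moreover have "expo (m - unit_index w) v = expo m v - of_bool (v = w)" for v w
    by transfer auto
  ultimately show ?case
    by (cases "v = w") (auto simp: mpderiv_single mult_ac)
qed (simp_all add: mpderiv_add)

lemma quotient_rule_aux:
  fixes a b c d :: "'a::comm_ring_1"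
  assumes "a * d = c * b" "a' * d + a * d' = c' * b + c * b'"
  shows "(a' * b - a * b') * (d * d) = (c' * d - c * d') * (b * b)"
proof -
  have "(a' * b - a * b') * (d * d) = (a' * d + a * d') * (b * d) - (a * d) * (b * d' + b' * d)"
    by (simp add: algebra_simps)
  also have "\<dots> = (c' * b + c * b') * (b * d) - (c * b) * (b * d' + b' * d)"
    by (simp only: assms)
  also have "\<dots> = (c' * d - c * d') * (b * b)"
    by (simp add: algebra_simps)
  finally show ?thesis .
qed

lift_definition rderiv :: "'v::finite \<Rightarrow> 'v ratfun \<Rightarrow> 'v ratfun" is
  "\<lambda>v (a, b). (mpderiv v a * b - a * mpderiv v b, b * b)"
proof -
  fix v :: 'v and r s :: "'v mpoly \<times> 'v mpoly"
  assume rel: "fractrel r s"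
  obtain a b where r: "r = (a, b)" by (cases r)
  obtain c d where s: "s = (c, d)" by (cases s)
  have nz: "b \<noteq> 0" "d \<noteq> 0" and eq: "a * d = c * b"
    using rel by (simp_all add: r s)
  have eq': "mpderiv v a * d + a * mpderiv v d = mpderiv v c * b + c * mpderiv v b"
    using arg_cong[OF eq, of "mpderiv v"] by (simp add: mpderiv_mult)
  have "(mpderiv v a * b - a * mpderiv v b) * (d * d) = (mpderiv v c * d - c * mpderiv v d) * (b * b)"
    using eq eq' by (rule quotient_rule_aux)
  then show "fractrel ((\<lambda>(a, b). (mpderiv v a * b - a * mpderiv v b, b * b)) r)
          ((\<lambda>(a, b). (mpderiv v a * b - a * mpderiv v b, b * b)) s)"
    using nz by (simp add: r s)
qed

lemma rderiv_Fract:
  "b \<noteq> 0 \<Longrightarrow> rderiv v (Fract a b) = Fract (mpderiv v a * b - a * mpderiv v b) (b * b)"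
  by (simp add: rderiv.abs_eq Fract.abs_eq eq_onp_def)

lemma rderiv_add: "rderiv v (r + s) = rderiv v r + rderiv v s"
proof (cases r; cases s)
  fix a b c d assume rs: "r = Fract a b" "b \<noteq> 0" "s = Fract c d" "d \<noteq> 0"
  then show ?thesis
    by (simp add: rderiv_Fract eq_fract mpderiv_add mpderiv_mult algebra_simps)
qed

lemma rderiv_mult: "rderiv v (r * s) = rderiv v r * s + r * rderiv v s"
proof (cases r; cases s)
  fix a b c d assume rs: "r = Fract a b" "b \<noteq> 0" "s = Fract c d" "d \<noteq> 0"
  then show ?thesis
    by (simp add: rderiv_Fract eq_fract mpderiv_add mpderiv_mult algebra_simps)
qed

lemma rderiv_0 [simp]: "rderiv v 0 = 0"
  using rderiv_add[of v 0 0] by (metis add.right_neutral add_left_cancel)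

lemma rderiv_1 [simp]: "rderiv v 1 = 0"
  using rderiv_mult[of v 1 1] by (metis mult_1 mult_1_right add.right_neutral add_left_cancel)

lemma rderiv_poly: "rderiv v (Fract p 1) = Fract (mpderiv v p) 1"
proof -
  have "mpderiv v (1 :: 'a mpoly) = 0"
    by (simp add: mpderiv_def zero_mindex.rep_eq)
  then show ?thesis
    by (simp add: rderiv_Fract)
qed

lemma rderiv_commute: "rderiv v (rderiv w r) = rderiv w (rderiv v r)"
proof (cases r)
  case (Fract a b)
  have "b \<noteq> 0" by fact
  let ?A = "Fract a 1" and ?B = "Fract b 1"
  have A: "?A = r * ?B"
    using Fract by (simp add: eq_fract)
  have comm: "rderiv v (rderiv w ?A) = rderiv w (rderiv v ?A)"
    "rderiv v (rderiv w ?B) = rderiv w (rderiv v ?B)"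
    by (simp_all add: rderiv_poly mpderiv_commute[of v w])
  have "rderiv v (rderiv w r) * ?B = rderiv w (rderiv v r) * ?B"
    using comm(1) unfolding A by (simp add: rderiv_mult rderiv_add comm(2))
  moreover have "?B \<noteq> 0"
    using \<open>b \<noteq> 0\<close> by (simp add: Zero_fract_def eq_fract)
  ultimately show ?thesis
    by simp
qed

subsection \<open>The rational Weyl algebra and the Weyl algebra\<close>

text \<open>
  \<open>mixed F m\<close> applies each \<open>F v\<close> exactly \<open>expo m v\<close> times. It is only used for
  commuting operators, so that the chosen enumeration of the variables does not matter.
\<close>

definition var_list :: "'v::finite list" where
  "var_list = (SOME vs. distinct vs \<and> set vs = UNIV)"

definition mixed :: "('v::finite \<Rightarrow> 'a \<Rightarrow> 'a) \<Rightarrow> 'v mindex \<Rightarrow> 'a \<Rightarrow> 'a" where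
  "mixed F m = foldr (\<lambda>v. F v ^^ expo m v) var_list"

lemma var_list: "distinct (var_list :: 'v::finite list)" "set (var_list :: 'v list) = UNIV"
proof -
  have "\<exists>vs :: 'v list. distinct vs \<and> set vs = UNIV"
    using finite_distinct_list[of "UNIV :: 'v set"] by auto
  then show "distinct (var_list :: 'v::finite list)" "set (var_list :: 'v list) = UNIV"
    unfolding var_list_def by (metis (mono_tags, lifting) someI_ex)+
qed

lemma mixed_0 [simp]: "mixed F 0 x = x"
proof -
  have "foldr (\<lambda>v. F v ^^ expo 0 v) vs x = x" for vs
    by (induction vs) (simp_all add: zero_mindex.rep_eq)
  then show ?thesis
    by (simp add: mixed_def)
qed

lemma mixed_unit:
  assumes comm: "\<And>v w x. F v (F w x) = F w (F v x)"
  shows "mixed F (m + unit_index v) x = F v (mixed F m x)"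
proof -
  have pow: "(F w ^^ k) (F v x) = F v ((F w ^^ k) x)" for w k x
    by (induction k) (simp_all add: comm)
  have eq: "foldr (\<lambda>w. F w ^^ expo (m + unit_index v) w) vs x = foldr (\<lambda>w. F w ^^ expo m w) vs x"
    if "v \<notin> set vs" for vs
    using that by (induction vs) (auto simp: plus_mindex.rep_eq unit_index.rep_eq)
  have "foldr (\<lambda>w. F w ^^ expo (m + unit_index v) w) vs x = F v (foldr (\<lambda>w. F w ^^ expo m w) vs x)"
    if "v \<in> set vs" "distinct vs" for vs
    using that
  proof (induction vs)
    case (Cons u us)
    show ?case
    proof (cases "u = v")
      case True
      with Cons.prems eq[of us] show ?thesis
        by (simp add: plus_mindex.rep_eq unit_index.rep_eq)
    next
      case False
      with Cons show ?thesis
        by (simp add: plus_mindex.rep_eq unit_index.rep_eq pow)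
    qed
  qed simp
  then show ?thesis
    by (simp add: mixed_def var_list)
qed

lemma mindex_induct [case_names 0 unit]:
  fixes m :: "'v::finite mindex"
  assumes "P 0" and step: "\<And>m v. P m \<Longrightarrow> P (m + unit_index v)"
  shows "P m"
proof (induction "\<Sum>v\<in>UNIV. expo m v" arbitrary: m)
  case 0
  then have "m = 0"
    by (auto simp: zero_mindex.rep_eq simp flip: expo_inject)
  with \<open>P 0\<close> show ?case by simp
next
  case (Suc k)
  then have "\<exists>v. expo m v \<noteq> 0"
    by (metis (no_types, lifting) nat.distinct(1) sum.neutral)
  then obtain v where v: "0 < expo m v"
    by auto
  define m' where "m' = m - unit_index v"
  have m: "m = m' + unit_index v"
    using v unfolding m'_def
    by (auto simp: fun_eq_iff plus_mindex.rep_eq minus_mindex.rep_eq unit_index.rep_eq simp flip: expo_inject)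
  have "(\<Sum>w\<in>UNIV. expo m w) = (\<Sum>w\<in>UNIV. expo m' w) + (\<Sum>w\<in>UNIV. of_bool (w = v))"
    unfolding m by (simp only: plus_mindex.rep_eq unit_index.rep_eq sum.distrib)
  also have "(\<Sum>w\<in>UNIV. of_bool (w = v)) = (1 :: nat)"
    by (simp add: of_bool_def)
  finally have "k = (\<Sum>w\<in>UNIV. expo m' w)"
    using Suc.hyps(2) by simp
  then have "P m'"
    by (rule Suc.hyps(1))
  then show ?case
    unfolding m by (rule step)
qed

text \<open>
  An element of the rational Weyl algebra $R$ is represented by its normal form $\sum_m r_m \partial^m$, and
  \<open>dstep v\<close> is left multiplication by $\partial_v$:
  $\partial_v \cdot r\,\partial^m = (\partial r/\partial x_v)\,\partial^m + r\,\partial_v\partial^m$.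
\<close>

type_synonym 'v normal_form = "'v mindex \<Rightarrow>\<^sub>0 'v ratfun"

definition dstep :: "'v::finite \<Rightarrow> 'v normal_form \<Rightarrow> 'v normal_form" where
  "dstep v q = (\<Sum>m\<in>Poly_Mapping.keys q.
     Poly_Mapping.single m (rderiv v (Poly_Mapping.lookup q m)) +
     Poly_Mapping.single (m + unit_index v) (Poly_Mapping.lookup q m))"

definition dmult :: "'v::finite normal_form \<Rightarrow> 'v normal_form \<Rightarrow> 'v normal_form" where
  "dmult p q = (\<Sum>m\<in>Poly_Mapping.keys p.
     Poly_Mapping.map ((*) (Poly_Mapping.lookup p m)) (mixed dstep m q))"

lemma dstep_add: "dstep v (p + q) = dstep v p + dstep v q"
  unfolding dstep_def
  by (rule setsum_keys_plus_distrib) (simp_all add: single_add rderiv_add algebra_simps)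

lemma dstep_0 [simp]: "dstep v 0 = 0"
  by (simp add: dstep_def)

lemma dstep_single:
  "dstep v (Poly_Mapping.single m c) =
     Poly_Mapping.single m (rderiv v c) + Poly_Mapping.single (m + unit_index v) c"
  by (simp add: dstep_def)

lemma dstep_commute: "dstep v (dstep w p) = dstep w (dstep v p)"
  by (induction p rule: poly_mapping_add_induct)
    (simp_all add: dstep_add dstep_single rderiv_commute[of v w] algebra_simps)

lemma dstep_scale:
  "dstep v (Poly_Mapping.map ((*) c) q) =
     Poly_Mapping.map ((*) (rderiv v c)) q + Poly_Mapping.map ((*) c) (dstep v q)"
  unfolding mult_map_scale_conv_mult
  by (induction q rule: poly_mapping_add_induct)
    (simp_all add: dstep_add dstep_single mult_single rderiv_mult single_add algebra_simps)

lemmas mixed_dstep_unit = mixed_unit[of dstep, OF dstep_commute]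

lemma mixed_dstep_add: "mixed dstep m (p + q) = mixed dstep m p + mixed dstep m q"
  by (induction m rule: mindex_induct) (simp_all add: mixed_dstep_unit dstep_add)

lemma mixed_dstep_1: "mixed dstep m 1 = Poly_Mapping.single m 1"
proof (induction m rule: mindex_induct)
  case (unit m v)
  then show ?case
    by (simp add: mixed_dstep_unit dstep_single)
qed simp

lemma dmult_add_left: "dmult (p + q) r = dmult p r + dmult q r"
  unfolding dmult_def mult_map_scale_conv_mult
  by (rule setsum_keys_plus_distrib) (simp_all add: single_add algebra_simps)

lemma dmult_add_right: "dmult p (q + r) = dmult p q + dmult p r"
  unfolding dmult_def mult_map_scale_conv_mult
  by (simp add: mixed_dstep_add algebra_simps sum.distrib)

lemma dmult_0_left [simp]: "dmult 0 q = 0"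
  by (simp add: dmult_def)

lemma dmult_single:
  "dmult (Poly_Mapping.single m c) q = Poly_Mapping.map ((*) c) (mixed dstep m q)"
  by (cases "c = 0") (simp_all add: dmult_def mult_map_scale_conv_mult)

lemma dmult_scale:
  "dmult (Poly_Mapping.map ((*) c) p) q = Poly_Mapping.map ((*) c) (dmult p q)"
  unfolding mult_map_scale_conv_mult
  by (induction p rule: poly_mapping_add_induct)
    (simp_all add: dmult_add_left dmult_single mult_single mult_map_scale_conv_mult
      algebra_simps flip: mult.assoc)

lemma dmult_dstep: "dmult (dstep v p) q = dstep v (dmult p q)"
  by (induction p rule: poly_mapping_add_induct)
    (simp_all add: dmult_add_left dmult_single dstep_add dstep_single dstep_scale mixed_dstep_unit)

lemma dmult_mixed: "dmult (mixed dstep m p) q = mixed dstep m (dmult p q)"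
  by (induction m rule: mindex_induct) (simp_all add: mixed_dstep_unit dmult_dstep)

lemma dmult_assoc: "dmult (dmult p q) r = dmult p (dmult q r)"
  by (induction p rule: poly_mapping_add_induct)
    (simp_all add: dmult_add_left dmult_single dmult_scale dmult_mixed)

lemma dmult_1_left: "dmult 1 q = q"
  using dmult_single[of 0 1 q] by (simp add: mult_map_scale_conv_mult)

lemma dmult_1_right: "dmult p 1 = p"
  by (induction p rule: poly_mapping_add_induct)
    (simp_all add: dmult_add_left dmult_single mixed_dstep_1)

typedef 'v ratweyl = "UNIV :: 'v::finite normal_form set"
  morphisms dcoeffs DiffOp ..

setup_lifting type_definition_ratweyl

instantiation ratweyl :: (finite) ring_1
begin

lift_definition zero_ratweyl :: "'a ratweyl" is 0 .
lift_definition one_ratweyl :: "'a ratweyl" is 1 .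
lift_definition plus_ratweyl :: "'a ratweyl \<Rightarrow> 'a ratweyl \<Rightarrow> 'a ratweyl" is "(+)" .
lift_definition minus_ratweyl :: "'a ratweyl \<Rightarrow> 'a ratweyl \<Rightarrow> 'a ratweyl" is "(-)" .
lift_definition uminus_ratweyl :: "'a ratweyl \<Rightarrow> 'a ratweyl" is uminus .
lift_definition times_ratweyl :: "'a ratweyl \<Rightarrow> 'a ratweyl \<Rightarrow> 'a ratweyl" is dmult .

instance
  by standard
    (transfer; simp add: dmult_assoc dmult_1_left dmult_1_right dmult_add_left dmult_add_right)+

end

definition rcoef :: "'v::finite ratfun \<Rightarrow> 'v ratweyl" where
  "rcoef r = DiffOp (Poly_Mapping.single 0 r)"

definition xvar :: "'v::finite \<Rightarrow> 'v ratweyl" where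
  "xvar v = rcoef (Fract (mvar v) 1)"

definition dvar :: "'v::finite \<Rightarrow> 'v ratweyl" where
  "dvar v = DiffOp (Poly_Mapping.single (unit_index v) 1)"

lemma dvar_rcoef: "dvar v * rcoef r = rcoef r * dvar v + rcoef (rderiv v r)"
proof -
  have "mixed dstep (unit_index v) q = dstep v q" for q
    using mixed_dstep_unit[of 0 v q] by simp
  then show ?thesis
    unfolding dvar_def rcoef_def
    by (simp add: times_ratweyl.abs_eq plus_ratweyl.abs_eq eq_onp_def dmult_single dstep_single
        mult_map_scale_conv_mult mult_single add.commute)
qed

text \<open>
  The polynomial $p(\partial)$ with constant coefficients. As the $\partial_v$ commute, this is
  the ring homomorphism with $x_v \mapsto \partial_v$; it makes sense of determinants in the
  $\partial_v$.
\<close>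

definition poly_in_dvar :: "'v::finite mpoly \<Rightarrow> 'v ratweyl" where
  "poly_in_dvar p = DiffOp (Poly_Mapping.map (\<lambda>c. Fract (Poly_Mapping.single 0 c) 1) p)"

lemma poly_in_dvar_mvar: "poly_in_dvar (mvar v) = dvar v"
  by (simp add: poly_in_dvar_def mvar_def dvar_def One_fract_def Zero_fract_def)

lemma poly_in_dvar_0 [simp]: "poly_in_dvar 0 = 0"
proof -
  have "Poly_Mapping.map f (0 :: 'a mpoly) = 0" for f :: "complex \<Rightarrow> 'a ratfun"
    by (simp add: map_eq_zero_iff)
  then show ?thesis
    by (simp add: poly_in_dvar_def zero_ratweyl_def)
qed

lemma poly_in_dvar_add: "poly_in_dvar (p + q) = poly_in_dvar p + poly_in_dvar q"
proof -
  have "Poly_Mapping.map (\<lambda>c. Fract (Poly_Mapping.single 0 c) 1) (p + q) =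
      Poly_Mapping.map (\<lambda>c. Fract (Poly_Mapping.single 0 c) 1 :: 'a ratfun) p +
      Poly_Mapping.map (\<lambda>c. Fract (Poly_Mapping.single 0 c) 1) q"
    by (rule poly_mapping_eqI)
      (auto simp: lookup_add map.rep_eq when_def single_add Zero_fract_def,
       metis single_add single_zero)
  then show ?thesis
    by (simp add: poly_in_dvar_def plus_ratweyl.abs_eq)
qed

lemma poly_in_dvar_mult: "poly_in_dvar (p * q) = poly_in_dvar p * poly_in_dvar q"
proof (induction p rule: poly_mapping_add_induct)
  case (single m c)
  show ?case
  proof (induction q rule: poly_mapping_add_induct)
    case (single k d)
    have rc: "rderiv v (Fract (Poly_Mapping.single 0 c) 1) = 0" for v and c :: complex
      by (simp add: rderiv_poly mpderiv_single zero_mindex.rep_eq Zero_fract_def)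
    have "mixed dstep m (Poly_Mapping.single k (Fract (Poly_Mapping.single 0 d) 1)) =
        Poly_Mapping.single (m + k) (Fract (Poly_Mapping.single 0 d) 1)"
      by (induction m rule: mindex_induct)
        (simp_all add: mixed_dstep_unit dstep_single rc ac_simps)
    then show ?case
      by (simp add: poly_in_dvar_def times_ratweyl.abs_eq dmult_single mult_single
          mult_map_scale_conv_mult Zero_fract_def)
  qed (simp_all add: poly_in_dvar_add algebra_simps)
qed (simp_all add: poly_in_dvar_add algebra_simps)

text \<open>The Weyl algebra as the subring of operators with polynomial coefficients.\<close>

definition weyl_algebra :: "'v::finite ratweyl set" where
  "weyl_algebra = {P. \<forall>m. Poly_Mapping.lookup (dcoeffs P) m \<in> range (\<lambda>p. Fract p 1)}"

text \<open>
  The left ideal generated by \<open>S\<close>, with multipliers from \<open>A\<close>. Taking \<open>A = UNIV\<close> yields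
  the left ideal $R S$ of the rational Weyl algebra.
\<close>

definition left_span :: "'v::finite ratweyl set \<Rightarrow> 'v ratweyl set \<Rightarrow> 'v ratweyl set" where
  "left_span A S = {\<Sum>s\<in>F. a s * s |F a. finite F \<and> F \<subseteq> S \<and> a ` F \<subseteq> A}"

abbreviation weyl_ideal :: "'v::finite ratweyl set \<Rightarrow> 'v ratweyl set" where
  "weyl_ideal S \<equiv> left_span weyl_algebra S"

subsection \<open>Holonomic rank\<close>

text \<open>The residue classes of the members of \<open>B\<close> are distinct and form a basis of $R/I$ over the rational functions.\<close>

definition quotient_basis :: "'v::finite ratweyl set \<Rightarrow> 'v ratweyl set \<Rightarrow> bool" where
  "quotient_basis I B \<longleftrightarrow>
     (\<forall>c. (\<Sum>b\<in>B. rcoef (c b) * b) \<in> I \<longrightarrow> (\<forall>b\<in>B. c b = 0)) \<and>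
     (\<forall>P. \<exists>c. P - (\<Sum>b\<in>B. rcoef (c b) * b) \<in> I)"

text \<open>
  All finite bases have the same size, so the infimum is the dimension of $R/RL$; it is
  \<open>\<infinity>\<close> (the infimum of the empty set) if there is no finite basis.
\<close>

definition holonomic_rank :: "'v::finite ratweyl set \<Rightarrow> enat" where
  "holonomic_rank L =
     (INF B \<in> {B. finite B \<and> quotient_basis (left_span UNIV L) B}. enat (card B))"

subsection \<open>Action on holomorphic functions\<close>

text \<open>
  Complex differentiability in several variables (complex-linear derivative), for open \<open>U\<close>.
\<close>

definition mv_holomorphic_on :: "(complex ^ 'v::finite \<Rightarrow> complex) \<Rightarrow> (complex ^ 'v) set \<Rightarrow> bool" where
  "mv_holomorphic_on f U \<longleftrightarrow>
     (\<forall>x\<in>U. \<exists>a :: complex ^ 'v. (f has_derivative (\<lambda>h. \<Sum>v\<in>UNIV. a $ v * h $ v)) (at x))"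

definition cpderiv :: "'v::finite \<Rightarrow> (complex ^ 'v \<Rightarrow> complex) \<Rightarrow> complex ^ 'v \<Rightarrow> complex" where
  "cpderiv v f x = deriv (\<lambda>z. f (x + axis v z)) 0"

text \<open>Meaningful for \<^prop>\<open>P \<in> weyl_algebra\<close> only, where the coefficients are polynomials.\<close>

definition diffop_apply ::
  "'v::finite ratweyl \<Rightarrow> (complex ^ 'v \<Rightarrow> complex) \<Rightarrow> complex ^ 'v \<Rightarrow> complex" where
  "diffop_apply P f x =
     (\<Sum>m\<in>Poly_Mapping.keys (dcoeffs P).
        mpeval (THE p. Poly_Mapping.lookup (dcoeffs P) m = Fract p 1) x * mixed cpderiv m f x)"

lemma mpoly_of_Fract: "(THE p. Fract q 1 = Fract p 1) = q" for q :: "'v::finite mpoly"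
  by (rule the_equality) (simp_all add: eq_fract)

lemma diffop_apply_xvar: "diffop_apply (xvar v) f x = x $ v * f x"
proof -
  have "(\<Prod>w\<in>UNIV. x $ w ^ of_bool (w = v)) = (\<Prod>w\<in>UNIV. if w = v then x $ w else 1)"
    by (intro prod.cong) auto
  moreover have "Fract (mvar v) 1 \<noteq> (0 :: 'a ratfun)"
    by (simp add: Zero_fract_def eq_fract mvar_def) (metis lookup_single_eq lookup_zero zero_neq_one)
  ultimately show ?thesis
    by (simp add: diffop_apply_def xvar_def rcoef_def DiffOp_inverse mpoly_of_Fract mpeval_def
        mvar_def unit_index.rep_eq)
qed

lemma diffop_apply_dvar: "diffop_apply (dvar v) f x = cpderiv v f x"
proof -
  have "foldr (\<lambda>w. cpderiv w ^^ of_bool (w = v)) vs f = (if v \<in> set vs then cpderiv v f else f)"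
    if "distinct vs" for vs
    using that by (induction vs) auto
  then have "mixed cpderiv (unit_index v) f = cpderiv v f"
    by (simp add: mixed_def unit_index.rep_eq var_list)
  moreover have "(THE p. 1 = Fract p 1) = (1 :: 'a mpoly)"
    unfolding One_fract_def by (rule mpoly_of_Fract)
  ultimately show ?thesis
    by (simp add: diffop_apply_def dvar_def DiffOp_inverse mpeval_def zero_mindex.rep_eq)
qed

definition solution_on ::
  "'v::finite ratweyl set \<Rightarrow> (complex ^ 'v) set \<Rightarrow> (complex ^ 'v \<Rightarrow> complex) \<Rightarrow> bool" where
  "solution_on L U f \<longleftrightarrow> (\<forall>P\<in>L. \<forall>x\<in>U. diffop_apply P f x = 0)"

subsection \<open>The ideals\<close>

text \<open>
  The variables $t_{ij}$ are indexed by pairs. The variables $y_{kl}$ are indexed by unordered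
  pairs, which builds in the convention $y_{kl} = y_{lk}$.
\<close>

instance uprod :: (finite) finite
  by standard simp

definition g_op :: "'n::{finite,linorder} \<Rightarrow> 'n \<Rightarrow> ('n \<times> 'n) ratweyl" where
  "g_op i j = of_bool (i = j) - (\<Sum>k\<in>UNIV. dvar (i, k) * dvar (j, k))"

definition P_op :: "'n::{finite,linorder} \<Rightarrow> 'n \<Rightarrow> ('n \<times> 'n) ratweyl" where
  "P_op i j = (\<Sum>k\<in>UNIV. xvar (i, k) * dvar (j, k) - xvar (j, k) * dvar (i, k))"

definition d_op :: "('n::{finite,linorder} \<times> 'n) ratweyl" where
  "d_op = 1 - poly_in_dvar (det (\<chi> i j. mvar (i, j)))"

definition ideal_J' :: "('n::{finite,linorder} \<times> 'n) ratweyl set" where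
  "ideal_J' = weyl_ideal ({g_op i j |i j. i \<le> j} \<union> {P_op i j |i j. i < j})"

definition ideal_J :: "('n::{finite,linorder} \<times> 'n) ratweyl set" where
  "ideal_J = {a + b |a b. a \<in> weyl_ideal {d_op} \<and> b \<in> ideal_J'}"

definition h_op :: "'n::{finite,linorder} \<Rightarrow> 'n \<Rightarrow> 'n uprod ratweyl" where
  "h_op i j =
     2 ^ of_bool (i = j) * of_nat CARD('n) * dvar (Upair i j) - of_bool (i = j) +
     (\<Sum>k\<in>UNIV. \<Sum>l\<in>UNIV. 2 ^ (of_bool (k = i) + of_bool (l = j)) *
        xvar (Upair k l) * dvar (Upair i k) * dvar (Upair j l))"

definition ideal_K :: "'n::{finite,linorder} uprod ratweyl set" where
  "ideal_K = weyl_ideal {h_op i j |i j. i \<le> j}"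

definition matrix_of :: "complex ^ ('n::finite \<times> 'n) \<Rightarrow> complex ^ 'n ^ 'n" where
  "matrix_of \<Theta> = (\<chi> i j. \<Theta> $ (i, j))"

definition gram :: "complex ^ ('n::{finite,linorder} \<times> 'n) \<Rightarrow> complex ^ 'n uprod" where
  "gram \<Theta> = (\<chi> u. (transpose (matrix_of \<Theta>) ** matrix_of \<Theta>)
     $ Min (set_uprod u) $ Max (set_uprod u))"

lemma gram_Upair: "gram \<Theta> $ Upair i j = (transpose (matrix_of \<Theta>) ** matrix_of \<Theta>) $ i $ j"
  by (auto simp: gram_def matrix_matrix_mult_def transpose_def min_def max_def mult.commute)

end

theory Submission
  imports Defs "HOL-Complex_Analysis.Cauchy_Integral_Formula"
begin

text \<open>
  Rank: write $y = \Theta^{\mathrm t}\Theta$. The operators $P_{ij}$ span the vector fields killing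
  all $y_{kl}$, so modulo them the rational Weyl algebra in $\Theta$ becomes the transfer module
  $\mathbb{C}(\Theta) \otimes_{\mathbb{C}(y)} R_y$. There $\delta_{ij} - \sum_k \partial_{ki}\partial_{kj}$ acts as
  $-h_{ij}$, and these operators generate the same ideal as the $g_{ij}$, because $AA^{\mathrm t} = 1$
  implies $A^{\mathrm t}A = 1$ over every commutative ring. Extending scalars, $J'$ and $K$ have the same
  rank. Moreover $D = \det(\partial_{ij})$ commutes with the generators of $J'$ and satisfies
  $D^2 \equiv 1$. Right multiplication by $D$ thus splits $R/RJ'$ into two eigenspaces. One of them is $R/RJ$,
  and changing the sign of one row of $\Theta$ exchanges them.

  Solutions: $J'$ contains the $P_{ij}$, so its solutions are constant along the fibres of
  $\Theta \mapsto \Theta^{\mathrm t}\Theta$, in a chart in which these fibres are convex; the chain rule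
  then turns the equations for $f$ into those for $\phi$.
\<close>

subsection \<open>Dimension of a quotient\<close>

text \<open>RJ' is only a left ideal, so right multiplication by an operator descends to R/RJ' only
  if it preserves RJ'; for D this is why its commutation with the \<open>P_op\<close> must be
  proved. Quotients are never formed: bases, eigenspaces and isomorphisms are all expressed by
  membership in an ideal. Comparing R/RJ' with the transfer module takes lifts of
  \<partial>/\<partial>y_u to \<Theta>-space. They exist because \<Theta> is invertible over the
  rational functions, but commute only modulo fields that kill y. Columns (\<open>g'_op\<close>)
  replace rows (\<open>g_op\<close>) because a sum of t_ki t_kj over the first index is an entry of
  the Gram matrix. The ranks live over different fields, C(y) and C(\<Theta>); C(y)-linear
  functionals on C(\<Theta>) transport linear independence. On the analytic side, partial
  derivatives of holomorphic functions must be holomorphic and commute; both come from Cauchy's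
  integral in one variable. In the chart around T, the antisymmetric matrix T^t X - X^t T is the
  coordinate along the fibre, and transposition, being an isometry, keeps a ball around a symmetric
  matrix stable, so it contains the segment from a matrix to its transpose.\<close>

lemma rcoef_0 [simp]: "rcoef 0 = 0"
  by (simp add: rcoef_def zero_ratweyl_def)

lemma rcoef_1 [simp]: "rcoef 1 = 1"
  by (simp add: rcoef_def one_ratweyl_def)

lemma rcoef_add: "rcoef (a + b) = rcoef a + rcoef b"
  by (simp add: rcoef_def plus_ratweyl.abs_eq single_add)

lemma rcoef_mult: "rcoef (a * b) = rcoef a * rcoef b"
  by (simp add: rcoef_def times_ratweyl.abs_eq dmult_single mult_map_scale_conv_mult mult_single)

lemma rcoef_uminus: "rcoef (- a) = - rcoef a"
  using rcoef_add[of a "- a"] by (simp add: eq_neg_iff_add_eq_0 add.commute)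

lemma rcoef_diff: "rcoef (a - b) = rcoef a - rcoef b"
  using rcoef_add[of a "- b"] by (simp add: rcoef_uminus)

lemma rcoef_sum: "rcoef (sum f A) = (\<Sum>x\<in>A. rcoef (f x))"
  by (induction A rule: infinite_finite_induct) (simp_all add: rcoef_add)

interpretation ratweyl: vector_space "\<lambda>c (P :: 'v::finite ratweyl). rcoef c * P"
  by standard (simp_all add: rcoef_add rcoef_mult distrib_left distrib_right mult.assoc)

text \<open>Families over an arbitrary index type instead of sets: later bases are indexed by a
  disjoint union or by a basis of another algebra, and injectivity then follows from
  independence.\<close>

definition indep_mod :: "'v::finite ratweyl set \<Rightarrow> 'i set \<Rightarrow> ('i \<Rightarrow> 'v ratweyl) \<Rightarrow> bool" where
  "indep_mod I S f \<longleftrightarrow> (\<forall>c. (\<Sum>i\<in>S. rcoef (c i) * f i) \<in> I \<longrightarrow> (\<forall>i\<in>S. c i = 0))"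

definition spans_mod :: "'v::finite ratweyl set \<Rightarrow> 'i set \<Rightarrow> ('i \<Rightarrow> 'v ratweyl) \<Rightarrow> bool" where
  "spans_mod I S f \<longleftrightarrow> (\<forall>x. \<exists>c. x - (\<Sum>i\<in>S. rcoef (c i) * f i) \<in> I)"

text \<open>If two indices had equal values, the coefficients 1 and -1 would give the relation 0,
  which lies in I.\<close>

lemma indep_mod_inj_on:
  fixes I :: "'v::finite ratweyl set"
  assumes "0 \<in> I" "finite S" "indep_mod I S f"
  shows "inj_on f S"
proof (rule inj_onI, rule ccontr)
  fix i j assume ij: "i \<in> S" "j \<in> S" "f i = f j" "i \<noteq> j"
  define c where "c k = (if k = i then 1 else if k = j then - 1 else 0 :: 'v ratfun)" for k
  have "(\<Sum>k\<in>S. rcoef (c k) * f k) = (\<Sum>k\<in>{i, j}. rcoef (c k) * f k)"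
    using assms(2) ij by (intro sum.mono_neutral_right) (auto simp: c_def)
  also have "\<dots> = 0"
    using ij by (simp add: c_def)
  finally show False
    using assms(1,3) ij(1) unfolding indep_mod_def by (metis c_def zero_neq_one)
qed

text \<open>Steinitz exchange in R/I without the quotient: each \<open>g t\<close> is replaced by a
  representative \<open>h t\<close> in the actual span of f that differs from it by an element of I.
  The \<open>h t\<close> are still independent modulo I, hence independent in R, and the ordinary
  bound applies.\<close>

lemma card_indep_mod_le:
  assumes I: "ratweyl.subspace I" and fin: "finite S" "finite T"
    and sp: "spans_mod I S f" and ind: "indep_mod I T g"
  shows "card T \<le> card S"
proof -
  obtain c where c: "\<And>x. x - (\<Sum>i\<in>S. rcoef (c x i) * f i) \<in> I"
    using sp unfolding spans_mod_def by metis
  define h where "h t = (\<Sum>i\<in>S. rcoef (c (g t) i) * f i)" for t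
  have gh: "g t - h t \<in> I" for t
    unfolding h_def by (rule c)
  have ind': "indep_mod I T h"
    unfolding indep_mod_def
  proof (intro allI impI)
    fix a assume "(\<Sum>i\<in>T. rcoef (a i) * h i) \<in> I"
    moreover have "(\<Sum>i\<in>T. rcoef (a i) * (g i - h i)) \<in> I"
      using I gh by (intro ratweyl.subspace_sum ratweyl.subspace_scale) auto
    ultimately have "(\<Sum>i\<in>T. rcoef (a i) * h i) + (\<Sum>i\<in>T. rcoef (a i) * (g i - h i)) \<in> I"
      using I by (rule ratweyl.subspace_add[rotated])
    then have "(\<Sum>i\<in>T. rcoef (a i) * g i) \<in> I"
      by (simp add: right_diff_distrib sum_subtractf)
    then show "\<forall>i\<in>T. a i = 0"
      using ind unfolding indep_mod_def by blast
  qed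
  have inj: "inj_on h T"
    using ratweyl.subspace_0[OF I] fin(2) ind' by (rule indep_mod_inj_on)
  have "ratweyl.independent (h ` T)"
  proof -
    have "\<forall>v\<in>h ` T. u v = 0" if "(\<Sum>v\<in>h ` T. rcoef (u v) * v) = 0" for u
    proof -
      have "(\<Sum>i\<in>T. rcoef (u (h i)) * h i) \<in> I"
        using that ratweyl.subspace_0[OF I] by (simp add: sum.reindex[OF inj])
      then show ?thesis
        using ind' unfolding indep_mod_def by auto
    qed
    then show ?thesis
      using fin(2) by (auto simp: ratweyl.dependent_finite)
  qed
  moreover have "h ` T \<subseteq> ratweyl.span (f ` S)"
    by (auto simp only: h_def intro!: ratweyl.span_sum) (intro ratweyl.span_scale ratweyl.span_base imageI)
  ultimately have "card (h ` T) \<le> card (f ` S)"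
    using fin(1) by (intro ratweyl.independent_span_bound[THEN conjunct2]) auto
  also have "\<dots> \<le> card S"
    using fin(1) by (rule card_image_le)
  finally show ?thesis
    using inj by (simp add: card_image)
qed

text \<open>A bound on the size of independent sets allows picking a largest one; an element outside
  its span modulo I could be adjoined.\<close>

lemma ex_basis_mod:
  assumes I: "ratweyl.subspace I"
    and bound: "\<And>T. finite T \<Longrightarrow> indep_mod I T (\<lambda>x. x) \<Longrightarrow> card T \<le> n"
  shows "\<exists>B. finite B \<and> indep_mod I B (\<lambda>x. x) \<and> spans_mod I B (\<lambda>x. x)"
proof -
  let ?P = "\<lambda>T. finite T \<and> indep_mod I T (\<lambda>x. x)"
  have "?P {}"
    by (simp add: indep_mod_def)
  moreover have "\<forall>T. ?P T \<longrightarrow> card T < Suc n"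
    using bound by (simp add: less_Suc_eq_le)
  ultimately obtain B where B: "?P B" and max: "\<And>T. ?P T \<Longrightarrow> card T \<le> card B"
    using ex_has_greatest_nat[of ?P "{}" card "Suc n"] by (metis less_imp_le)
  have "\<exists>c. x - (\<Sum>i\<in>B. rcoef (c i) * i) \<in> I" for x
  proof (cases "x \<in> B")
    case True
    then have "(\<Sum>i\<in>B. rcoef (of_bool (i = x)) * i) = (\<Sum>i\<in>{x}. rcoef (of_bool (i = x)) * i)"
      using B by (intro sum.mono_neutral_right) auto
    then show ?thesis
      using ratweyl.subspace_0[OF I] by (intro exI[of _ "\<lambda>i. of_bool (i = x)"]) simp
  next
    case False
    then have "\<not> ?P (insert x B)"
      using max[of "insert x B"] B by auto
    then obtain c where c: "(\<Sum>i\<in>insert x B. rcoef (c i) * i) \<in> I" "\<exists>i\<in>insert x B. c i \<noteq> 0"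
      using B unfolding indep_mod_def by auto
    have c': "rcoef (c x) * x + (\<Sum>i\<in>B. rcoef (c i) * i) \<in> I"
      using c(1) False B by simp
    have "c x \<noteq> 0"
    proof
      assume "c x = 0"
      with c' c(2) B show False
        unfolding indep_mod_def by auto
    qed
    have "rcoef (inverse (c x)) * (rcoef (c x) * x + (\<Sum>i\<in>B. rcoef (c i) * i)) \<in> I"
      using I c' by (rule ratweyl.subspace_scale)
    then have "x - (\<Sum>i\<in>B. rcoef (- (inverse (c x) * c i)) * i) \<in> I"
      using \<open>c x \<noteq> 0\<close>
      by (simp add: ratweyl.scale_right_distrib ratweyl.scale_sum_right sum_negf)
    then show ?thesis
      by (intro exI[of _ "\<lambda>i. - (inverse (c x) * c i)"])
  qed
  then show ?thesis
    using B unfolding spans_mod_def by blast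
qed

subsection \<open>Left ideals and their rank\<close>

lemma left_span_base:
  assumes "1 \<in> A" "s \<in> S"
  shows "s \<in> left_span A S"
  unfolding left_span_def mem_Collect_eq
  using assms by (intro exI[of _ "{s}"] exI[of _ "\<lambda>_. 1"]) auto

lemma left_span_0: "0 \<in> left_span A S"
  unfolding left_span_def mem_Collect_eq by (intro exI[of _ "{}"]) auto

lemma left_span_add:
  assumes "0 \<in> A" "\<And>a b. a \<in> A \<Longrightarrow> b \<in> A \<Longrightarrow> a + b \<in> A"
    and "x \<in> left_span A S" "y \<in> left_span A S"
  shows "x + y \<in> left_span A S"
proof -
  obtain F a where F: "finite F" "F \<subseteq> S" "a ` F \<subseteq> A" "x = (\<Sum>s\<in>F. a s * s)"
    using assms(3) unfolding left_span_def by auto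
  obtain G b where G: "finite G" "G \<subseteq> S" "b ` G \<subseteq> A" "y = (\<Sum>s\<in>G. b s * s)"
    using assms(4) unfolding left_span_def by auto
  define a' b' where "a' s = (if s \<in> F then a s else 0)" and "b' s = (if s \<in> G then b s else 0)" for s
  have "x = (\<Sum>s\<in>F \<union> G. a' s * s)"
    unfolding F(4) using F(1) G(1) by (intro sum.mono_neutral_cong_left) (auto simp: a'_def)
  moreover have "y = (\<Sum>s\<in>F \<union> G. b' s * s)"
    unfolding G(4) using F(1) G(1) by (intro sum.mono_neutral_cong_left) (auto simp: b'_def)
  ultimately have "x + y = (\<Sum>s\<in>F \<union> G. (a' s + b' s) * s)"
    by (simp add: sum.distrib distrib_right)
  moreover have "(\<lambda>s. a' s + b' s) ` (F \<union> G) \<subseteq> A"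
    using F(3) G(3) assms(1,2) by (simp add: a'_def b'_def image_subset_iff)
  ultimately show ?thesis
    unfolding left_span_def mem_Collect_eq
    using F(1,2) G(1,2) by (intro exI[of _ "F \<union> G"] exI[of _ "\<lambda>s. a' s + b' s"]) auto
qed

lemma left_span_mult:
  assumes "\<And>b. b \<in> A \<Longrightarrow> a * b \<in> A" "x \<in> left_span A S"
  shows "a * x \<in> left_span A S"
proof -
  obtain F b where F: "finite F" "F \<subseteq> S" "b ` F \<subseteq> A" "x = (\<Sum>s\<in>F. b s * s)"
    using assms(2) unfolding left_span_def by auto
  then show ?thesis
    unfolding left_span_def mem_Collect_eq using assms(1)
    by (intro exI[of _ F] exI[of _ "\<lambda>s. a * b s"]) (auto simp: sum_distrib_left mult.assoc)
qed

lemma left_span_minimal: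
  assumes "x \<in> left_span A S" "0 \<in> I" "\<And>x y. x \<in> I \<Longrightarrow> y \<in> I \<Longrightarrow> x + y \<in> I"
    and "\<And>a s. a \<in> A \<Longrightarrow> s \<in> S \<Longrightarrow> a * s \<in> I"
  shows "x \<in> I"
proof -
  obtain F b where F: "finite F" "F \<subseteq> S" "b ` F \<subseteq> A" and x: "x = (\<Sum>s\<in>F. b s * s)"
    using assms(1) unfolding left_span_def by auto
  show ?thesis
    unfolding x using F by induction (auto intro: assms(2-4))
qed

definition left_ideal :: "'v::finite ratweyl set \<Rightarrow> bool" where
  "left_ideal I \<longleftrightarrow> 0 \<in> I \<and> (\<forall>x\<in>I. \<forall>y\<in>I. x + y \<in> I) \<and> (\<forall>a. \<forall>x\<in>I. a * x \<in> I)"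

lemma left_idealD:
  assumes "left_ideal I"
  shows left_ideal_0: "0 \<in> I"
    and left_ideal_add: "\<And>x y. x \<in> I \<Longrightarrow> y \<in> I \<Longrightarrow> x + y \<in> I"
    and left_ideal_mult: "\<And>a x. x \<in> I \<Longrightarrow> a * x \<in> I"
  using assms unfolding left_ideal_def by auto

lemma left_ideal_uminus: "left_ideal I \<Longrightarrow> x \<in> I \<Longrightarrow> - x \<in> I"
  using left_ideal_mult[of I x "- 1"] by simp

lemma left_ideal_diff: "left_ideal I \<Longrightarrow> x \<in> I \<Longrightarrow> y \<in> I \<Longrightarrow> x - y \<in> I"
  using left_ideal_add[of I x "- y"] left_ideal_uminus[of I y] by simp

lemma left_ideal_sum: "left_ideal I \<Longrightarrow> (\<And>i. i \<in> A \<Longrightarrow> f i \<in> I) \<Longrightarrow> sum f A \<in> I"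
  by (induction A rule: infinite_finite_induct) (auto intro: left_ideal_0 left_ideal_add)

lemma left_ideal_left_span [intro]: "left_ideal (left_span UNIV S)"
  unfolding left_ideal_def
  using left_span_0 left_span_add[of UNIV] left_span_mult[of UNIV] by blast

lemma subspace_left_ideal: "left_ideal I \<Longrightarrow> ratweyl.subspace I"
  by (simp add: ratweyl.subspace_def left_ideal_def)

lemma left_span_subset_left_ideal:
  assumes "left_ideal I" "S \<subseteq> I"
  shows "left_span A S \<subseteq> I"
proof
  fix x assume "x \<in> left_span A S"
  then show "x \<in> I"
    by (rule left_span_minimal) (use assms left_idealD[OF assms(1)] in auto)
qed

text \<open>Hence the rational ideal, and with it the rank, of a Weyl ideal can be computed from its
  generators.\<close>

lemma left_span_left_span:
  assumes "1 \<in> A"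
  shows "left_span UNIV (left_span A S) = left_span UNIV S"
proof
  have "left_span A S \<subseteq> left_span UNIV S"
    by (intro left_span_subset_left_ideal) (auto intro: left_span_base)
  then show "left_span UNIV (left_span A S) \<subseteq> left_span UNIV S"
    by (rule left_span_subset_left_ideal[OF left_ideal_left_span])
  have "S \<subseteq> left_span UNIV (left_span A S)"
    using assms left_span_base[of A _ S] left_span_base[of UNIV _ "left_span A S"] by blast
  then show "left_span UNIV S \<subseteq> left_span UNIV (left_span A S)"
    by (rule left_span_subset_left_ideal[OF left_ideal_left_span])
qed

lemma quotient_basis_iff:
  "quotient_basis I B \<longleftrightarrow> indep_mod I B (\<lambda>x. x) \<and> spans_mod I B (\<lambda>x. x)"
  by (simp add: quotient_basis_def indep_mod_def spans_mod_def)

text \<open>\<open>card_indep_mod_le\<close> in both directions shows that all finite bases have the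
  same size, so the infimum in \<open>holonomic_rank\<close> runs over a constant.\<close>

lemma holonomic_rank_eqI:
  assumes fin: "finite S" and ind: "indep_mod (left_span UNIV L) S f"
    and sp: "spans_mod (left_span UNIV L) S f"
  shows "holonomic_rank L = enat (card S)"
proof -
  let ?I = "left_span UNIV L"
  have I: "ratweyl.subspace ?I"
    by (intro subspace_left_ideal) auto
  have inj: "inj_on f S"
    using fin ind by (intro indep_mod_inj_on[of ?I]) (auto simp: left_span_0)
  have "quotient_basis ?I (f ` S)"
    unfolding quotient_basis_def
  proof (intro conjI allI impI)
    fix c assume "(\<Sum>b\<in>f ` S. rcoef (c b) * b) \<in> ?I"
    then have "(\<Sum>i\<in>S. rcoef (c (f i)) * f i) \<in> ?I"
      using inj by (simp add: sum.reindex)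
    then have "\<forall>i\<in>S. c (f i) = 0"
      using spec[OF ind[unfolded indep_mod_def], of "\<lambda>i. c (f i)"] by simp
    then show "\<forall>b\<in>f ` S. c b = 0"
      by simp
  next
    fix P
    obtain c where c: "P - (\<Sum>i\<in>S. rcoef (c i) * f i) \<in> ?I"
      using sp unfolding spans_mod_def by blast
    have "(\<Sum>b\<in>f ` S. rcoef (c (the_inv_into S f b)) * b) = (\<Sum>i\<in>S. rcoef (c i) * f i)"
      using inj by (simp add: sum.reindex the_inv_into_f_f)
    with c show "\<exists>c. P - (\<Sum>b\<in>f ` S. rcoef (c b) * b) \<in> ?I"
      by (intro exI[of _ "\<lambda>b. c (the_inv_into S f b)"]) simp
  qed
  then have "f ` S \<in> {B. finite B \<and> quotient_basis ?I B}"
    using fin by auto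
  moreover have "card B = card S" if "B \<in> {B. finite B \<and> quotient_basis ?I B}" for B
    using that fin ind sp card_indep_mod_le[OF I, of B S "\<lambda>x. x" f]
      card_indep_mod_le[OF I, of S B f "\<lambda>x. x"]
    by (intro antisym) (auto simp: quotient_basis_iff)
  ultimately show ?thesis
    unfolding holonomic_rank_def by (intro INF_eqI) (auto simp: card_image[OF inj])
qed

lemma holonomic_rank_cases:
  obtains "holonomic_rank L = \<infinity>"
  | B where "finite B" "indep_mod (left_span UNIV L) B (\<lambda>x. x)"
      "spans_mod (left_span UNIV L) B (\<lambda>x. x)" "holonomic_rank L = enat (card B)"
proof (cases "{B. finite B \<and> quotient_basis (left_span UNIV L) B} = {}")
  case True
  then have "holonomic_rank L = \<infinity>"
    unfolding holonomic_rank_def by (simp only: image_empty Inf_empty top_enat_def)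
  then show ?thesis by (rule that)
next
  case False
  then obtain B where "finite B" "quotient_basis (left_span UNIV L) B"
    by auto
  then show ?thesis
    using holonomic_rank_eqI[of B L "\<lambda>x. x"] that(2)[of B] by (simp add: quotient_basis_iff)
qed

text \<open>Together with \<open>holonomic_rank_leI\<close> this makes the rank the supremum of the
  sizes of independent families, which is how infinite ranks are compared.\<close>

lemma card_indep_mod_le_rank:
  assumes "finite T" "indep_mod (left_span UNIV L) T f"
  shows "enat (card T) \<le> holonomic_rank L"
proof (rule holonomic_rank_cases[of L])
  fix B assume "finite B" "spans_mod (left_span UNIV L) B (\<lambda>x. x)"
    "holonomic_rank L = enat (card B)"
  then show ?thesis
    using assms card_indep_mod_le[of "left_span UNIV L" B T "\<lambda>x. x" f]
    by (simp add: subspace_left_ideal left_ideal_left_span)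
qed simp

lemma holonomic_rank_leI:
  assumes "\<And>B. finite B \<Longrightarrow> indep_mod (left_span UNIV L) B (\<lambda>x. x) \<Longrightarrow>
    enat (card B) \<le> r"
  shows "holonomic_rank L \<le> r"
proof (cases r)
  case (enat n)
  have "ratweyl.subspace (left_span UNIV L)"
    by (intro subspace_left_ideal) auto
  then obtain B where "finite B" "indep_mod (left_span UNIV L) B (\<lambda>x. x)"
    "spans_mod (left_span UNIV L) B (\<lambda>x. x)"
    using ex_basis_mod[of "left_span UNIV L" n] assms enat by auto
  then show ?thesis
    using holonomic_rank_eqI[of B L "\<lambda>x. x"] assms by simp
qed simp

subsection \<open>Polynomials and operators\<close>

lemma single_unit_add: "Poly_Mapping.single (m + unit_index v) c = mvar v * Poly_Mapping.single m c"
  by (simp add: mvar_def mult_single add.commute)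

lemma mpoly_induct [case_names const var add]:
  fixes p :: "'v::finite mpoly"
  assumes "\<And>c. P (Poly_Mapping.single 0 c)" "\<And>v p. P p \<Longrightarrow> P (mvar v * p)"
    and "\<And>p q. P p \<Longrightarrow> P q \<Longrightarrow> P (p + q)"
  shows "P p"
proof (induction p rule: poly_mapping_add_induct)
  case zero
  then show ?case using assms(1)[of 0] by simp
next
  case (single m c)
  then show ?case
    by (induction m rule: mindex_induct) (simp_all add: assms single_unit_add)
qed (rule assms)

lemma mpderiv_sum: "mpderiv v (sum f A) = (\<Sum>x\<in>A. mpderiv v (f x))"
  by (induction A rule: infinite_finite_induct) (simp_all add: mpderiv_add)

lemma mpderiv_const [simp]: "mpderiv v (Poly_Mapping.single 0 c) = 0"
  by (simp add: mpderiv_single zero_mindex.rep_eq)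

lemma mpderiv_1 [simp]: "mpderiv v 1 = 0"
  using mpderiv_const[of v 1] by simp

lemma mpderiv_mvar: "mpderiv v (mvar w) = of_bool (v = w)"
proof -
  have "unit_index w - unit_index v = 0" if "v = w"
    using that by transfer (simp add: fun_eq_iff)
  then show ?thesis
    by (simp add: mvar_def mpderiv_single unit_index.rep_eq)
qed

lemma poly_in_dvar_uminus: "poly_in_dvar (- p) = - poly_in_dvar p"
  using poly_in_dvar_add[of p "- p"] by (simp add: eq_neg_iff_add_eq_0 add.commute)

lemma poly_in_dvar_diff: "poly_in_dvar (p - q) = poly_in_dvar p - poly_in_dvar q"
  using poly_in_dvar_add[of p "- q"] by (simp add: poly_in_dvar_uminus)

lemma poly_in_dvar_sum: "poly_in_dvar (sum f A) = (\<Sum>x\<in>A. poly_in_dvar (f x))"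
  by (induction A rule: infinite_finite_induct) (simp_all add: poly_in_dvar_add)

lemma poly_in_dvar_const:
  "poly_in_dvar (Poly_Mapping.single 0 c) = rcoef (Fract (Poly_Mapping.single 0 c) 1)"
  by (simp add: poly_in_dvar_def rcoef_def Zero_fract_def)

lemma poly_in_dvar_1 [simp]: "poly_in_dvar 1 = 1"
  using poly_in_dvar_const[of 1] by (simp add: One_fract_def[symmetric])

lemma poly_in_dvar_commute: "poly_in_dvar p * poly_in_dvar q = poly_in_dvar q * poly_in_dvar p"
  by (simp add: mult.commute flip: poly_in_dvar_mult)

lemma dvar_commute: "dvar v * dvar w = dvar w * dvar v"
  by (simp add: mult.commute flip: poly_in_dvar_mvar poly_in_dvar_mult)

lemma rcoef_commute: "rcoef a * rcoef b = rcoef b * rcoef a"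
  by (simp add: mult.commute flip: rcoef_mult)

lemma rderiv_mvar: "rderiv v (Fract (mvar w) 1) = of_bool (v = w)"
  by (simp add: rderiv_poly mpderiv_mvar One_fract_def Zero_fract_def)

lemma dvar_xvar: "dvar v * xvar w = xvar w * dvar v + of_bool (v = w)"
  by (simp add: xvar_def dvar_rcoef rderiv_mvar)

text \<open>Each \<partial>_v that x_v passes leaves a commutator behind, so x_v acts on polynomials
  in the derivations as minus a derivation: the Leibniz rule with variables and derivations
  exchanged.\<close>

lemma xvar_poly_in_dvar:
  "xvar v * poly_in_dvar q = poly_in_dvar q * xvar v - poly_in_dvar (mpderiv v q)"
proof (induction q rule: mpoly_induct)
  case (const c)
  then show ?case
    by (simp add: poly_in_dvar_const xvar_def rcoef_commute)
next
  case (var w q)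
  have "xvar v * dvar w = dvar w * xvar v - of_bool (v = w)"
    using dvar_xvar[of w v] by (auto simp: algebra_simps)
  then have "xvar v * (dvar w * poly_in_dvar q) =
      dvar w * (xvar v * poly_in_dvar q) - of_bool (v = w) * poly_in_dvar q"
    by (simp add: left_diff_distrib flip: mult.assoc)
  also have "\<dots> = dvar w * poly_in_dvar q * xvar v - dvar w * poly_in_dvar (mpderiv v q)
      - of_bool (v = w) * poly_in_dvar q"
    by (simp add: var right_diff_distrib mult.assoc)
  finally show ?case
    by (simp add: poly_in_dvar_mult poly_in_dvar_mvar mpderiv_mult mpderiv_mvar poly_in_dvar_add)
next
  case (add p q)
  then show ?case
    by (simp add: poly_in_dvar_add mpderiv_add algebra_simps)
qed

section \<open>Normal forms and induction principles in the rational and the polynomial Weyl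
  algebra\<close>

definition dmon :: "'v::finite mindex \<Rightarrow> 'v ratweyl" where
  "dmon m = DiffOp (Poly_Mapping.single m 1)"

lemma dvar_times: "dvar v * P = DiffOp (dstep v (dcoeffs P))"
proof -
  have "mixed dstep (unit_index v) q = dstep v q" for q
    using mixed_dstep_unit[of 0 v q] by simp
  then show ?thesis
    by (cases P) (simp add: dvar_def times_ratweyl.abs_eq dmult_single DiffOp_inverse mult_map_scale_conv_mult)
qed

lemma dmon_0 [simp]: "dmon 0 = 1"
  by (simp add: dmon_def one_ratweyl_def)

lemma dmon_unit: "dmon (m + unit_index v) = dvar v * dmon m"
  by (simp add: dmon_def dvar_times DiffOp_inverse dstep_single)

lemma rcoef_dmon: "rcoef r * dmon m = DiffOp (Poly_Mapping.single m r)"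
  by (simp add: rcoef_def dmon_def times_ratweyl.abs_eq dmult_single mult_map_scale_conv_mult mult_single)

lemma DiffOp_add: "DiffOp (p + q) = DiffOp p + DiffOp q"
  by (simp add: plus_ratweyl.abs_eq)

lemma DiffOp_sum: "DiffOp (sum f A) = (\<Sum>x\<in>A. DiffOp (f x))"
  by (induction A rule: infinite_finite_induct) (simp_all add: DiffOp_add flip: zero_ratweyl_def)

lemma ratweyl_expand:
  "P = (\<Sum>m\<in>Poly_Mapping.keys (dcoeffs P). rcoef (Poly_Mapping.lookup (dcoeffs P) m) * dmon m)"
  by (simp add: rcoef_dmon DiffOp_inverse dcoeffs_inverse flip: DiffOp_sum poly_mapping_sum_single)

text \<open>R is exhausted by sums of what arises from 1 by left multiplication with coefficients
  and derivations. This form suits left ideals and module actions, since only one-step products have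
  to be understood.\<close>

lemma ratweyl_induct [case_names one rcoef dvar add]:
  fixes P :: "'v::finite ratweyl"
  assumes 1: "Q 1" and "\<And>r P. Q P \<Longrightarrow> Q (rcoef r * P)" "\<And>v P. Q P \<Longrightarrow> Q (dvar v * P)"
    and "\<And>P P'. Q P \<Longrightarrow> Q P' \<Longrightarrow> Q (P + P')"
  shows "Q P"
proof -
  have mon: "Q (dmon m)" for m
    by (induction m rule: mindex_induct) (simp_all add: assms dmon_unit)
  have "Q (\<Sum>m\<in>A. rcoef (c m) * dmon m)" if "finite A" for A c
    using that
  proof (induction rule: finite_induct)
    case empty
    then show ?case using assms(2)[OF 1, of 0] by simp
  qed (simp add: assms mon)
  then show ?thesis
    by (subst ratweyl_expand) simp
qed

abbreviation pcoef :: "'v::finite mpoly \<Rightarrow> 'v ratweyl" where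
  "pcoef p \<equiv> rcoef (Fract p 1)"

lemma weyl_algebra_induct [consumes 1, case_names one pcoef dvar add]:
  fixes P :: "'v::finite ratweyl"
  assumes P: "P \<in> weyl_algebra"
    and 1: "Q 1" and step: "\<And>r P. Q P \<Longrightarrow> Q (pcoef r * P)" "\<And>v P. Q P \<Longrightarrow> Q (dvar v * P)"
      "\<And>P P'. Q P \<Longrightarrow> Q P' \<Longrightarrow> Q (P + P')"
  shows "Q P"
proof -
  have mon: "Q (dmon m)" for m
    by (induction m rule: mindex_induct) (simp_all add: assms dmon_unit)
  have "Q (\<Sum>m\<in>A. rcoef (c m) * dmon m)" if "finite A" "\<And>m. c m \<in> range (\<lambda>p. Fract p 1)" for A c
    using that
  proof induction
    case empty
    then show ?case
      using step(1)[OF 1, of 0] by (simp add: Zero_fract_def[symmetric])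
  next
    case (insert m A)
    obtain p where "c m = Fract p 1"
      using insert.prems[of m] by auto
    then show ?case
      using insert step mon by simp
  qed
  moreover have "Poly_Mapping.lookup (dcoeffs P) m \<in> range (\<lambda>p. Fract p 1)" for m
    using P by (auto simp: weyl_algebra_def)
  ultimately show ?thesis
    by (subst ratweyl_expand) simp
qed

section \<open>Closure properties of the polynomial Weyl algebra\<close>

lemma weyl_algebra_0 [simp]: "0 \<in> weyl_algebra"
  by (auto simp: weyl_algebra_def zero_ratweyl.rep_eq Zero_fract_def)

lemma weyl_algebra_add:
  assumes "P \<in> weyl_algebra" "Q \<in> weyl_algebra"
  shows "P + Q \<in> weyl_algebra"
  unfolding weyl_algebra_def mem_Collect_eq
proof
  fix m
  obtain p q where "Poly_Mapping.lookup (dcoeffs P) m = Fract p 1" "Poly_Mapping.lookup (dcoeffs Q) m = Fract q 1"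
    using assms unfolding weyl_algebra_def by blast
  then show "Poly_Mapping.lookup (dcoeffs (P + Q)) m \<in> range (\<lambda>p. Fract p 1)"
    by (intro image_eqI[of _ _ "p + q"]) (simp_all add: plus_ratweyl.rep_eq lookup_add)
qed

lemma weyl_algebra_sum:
  "(\<And>i. i \<in> A \<Longrightarrow> f i \<in> weyl_algebra) \<Longrightarrow> sum f A \<in> weyl_algebra"
  by (induction A rule: infinite_finite_induct) (simp_all add: weyl_algebra_add)

lemma weyl_algebra_single: "DiffOp (Poly_Mapping.single m (Fract p 1)) \<in> weyl_algebra"
  by (auto simp: weyl_algebra_def DiffOp_inverse lookup_single when_def Zero_fract_def)

lemma weyl_algebra_pcoef [simp]: "pcoef p \<in> weyl_algebra"
  unfolding rcoef_def by (rule weyl_algebra_single)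

lemma weyl_algebra_1 [simp]: "1 \<in> weyl_algebra"
  using weyl_algebra_pcoef[of 1] by (simp add: One_fract_def[symmetric])

lemma weyl_algebra_expand:
  assumes "P \<in> weyl_algebra"
  obtains p where "P = (\<Sum>m\<in>Poly_Mapping.keys (dcoeffs P). pcoef (p m) * dmon m)"
    "\<And>m. Poly_Mapping.lookup (dcoeffs P) m = Fract (p m) 1"
proof -
  have "\<forall>m. \<exists>p. Poly_Mapping.lookup (dcoeffs P) m = Fract p 1"
    using assms unfolding weyl_algebra_def by blast
  then obtain p where p: "\<And>m. Poly_Mapping.lookup (dcoeffs P) m = Fract (p m) 1"
    by metis
  with that show ?thesis
    using ratweyl_expand[of P] by simp
qed

lemma weyl_algebra_pcoef_mult:
  assumes "P \<in> weyl_algebra" shows "pcoef p * P \<in> weyl_algebra"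
proof -
  obtain c where c: "P = (\<Sum>m\<in>Poly_Mapping.keys (dcoeffs P). pcoef (c m) * dmon m)"
    using assms by (rule weyl_algebra_expand)
  have "pcoef p * (pcoef (c m) * dmon m) \<in> weyl_algebra" for m
  proof -
    have "pcoef p * (pcoef (c m) * dmon m) = pcoef (p * c m) * dmon m"
      by (simp flip: mult.assoc rcoef_mult)
    then show ?thesis
      using weyl_algebra_single[of m "p * c m"] by (simp add: rcoef_dmon)
  qed
  then show ?thesis
    by (subst c) (simp add: sum_distrib_left weyl_algebra_sum)
qed

lemma weyl_algebra_dvar_mult:
  assumes "P \<in> weyl_algebra" shows "dvar v * P \<in> weyl_algebra"
proof -
  obtain c where c: "P = (\<Sum>m\<in>Poly_Mapping.keys (dcoeffs P). pcoef (c m) * dmon m)"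
    using assms by (rule weyl_algebra_expand)
  have "dvar v * (pcoef (c m) * dmon m) \<in> weyl_algebra" for m
    by (simp add: rcoef_dmon dvar_times DiffOp_inverse dstep_single rderiv_poly weyl_algebra_single
        weyl_algebra_add flip: plus_ratweyl.abs_eq)
  then show ?thesis
    by (subst c) (simp add: sum_distrib_left weyl_algebra_sum)
qed

lemma weyl_algebra_mult:
  assumes "P \<in> weyl_algebra" "Q \<in> weyl_algebra"
  shows "P * Q \<in> weyl_algebra"
  using assms(1)
  by (induction rule: weyl_algebra_induct)
    (simp_all add: assms(2) mult.assoc distrib_right weyl_algebra_add weyl_algebra_pcoef_mult
      weyl_algebra_dvar_mult)

lemma weyl_algebra_dvar [simp]: "dvar v \<in> weyl_algebra"
  using weyl_algebra_dvar_mult[of 1 v] by simp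

lemma weyl_algebra_xvar [simp]: "xvar v \<in> weyl_algebra"
  by (simp add: xvar_def)

lemma weyl_algebra_poly_in_dvar [simp]: "poly_in_dvar p \<in> weyl_algebra"
  by (induction p rule: mpoly_induct)
    (simp_all add: poly_in_dvar_const poly_in_dvar_mult poly_in_dvar_add poly_in_dvar_mvar
      weyl_algebra_add weyl_algebra_mult)

lemma weyl_ideal_add: "x \<in> weyl_ideal S \<Longrightarrow> y \<in> weyl_ideal S \<Longrightarrow> x + y \<in> weyl_ideal S"
  by (rule left_span_add) (simp_all add: weyl_algebra_add)

lemma weyl_ideal_mult: "P \<in> weyl_algebra \<Longrightarrow> x \<in> weyl_ideal S \<Longrightarrow> P * x \<in> weyl_ideal S"
  by (rule left_span_mult) (simp_all add: weyl_algebra_mult)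

subsection \<open>The equations of the orthogonal group\<close>

definition ring_ideal :: "'a::comm_ring_1 set \<Rightarrow> bool" where
  "ring_ideal I \<longleftrightarrow> 0 \<in> I \<and> (\<forall>x\<in>I. \<forall>y\<in>I. x + y \<in> I) \<and> (\<forall>a. \<forall>x\<in>I. a * x \<in> I)"

lemma ring_idealD:
  assumes "ring_ideal I"
  shows ring_ideal_0: "0 \<in> I"
    and ring_ideal_add: "\<And>x y. x \<in> I \<Longrightarrow> y \<in> I \<Longrightarrow> x + y \<in> I"
    and ring_ideal_mult: "\<And>a x. x \<in> I \<Longrightarrow> a * x \<in> I"
  using assms unfolding ring_ideal_def by auto

lemma ring_ideal_diff: "ring_ideal I \<Longrightarrow> x \<in> I \<Longrightarrow> y \<in> I \<Longrightarrow> x - y \<in> I"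
  using ring_ideal_add[of I x "- y"] ring_ideal_mult[of I y "- 1"] by simp

lemma ring_ideal_sum: "ring_ideal I \<Longrightarrow> (\<And>i. i \<in> A \<Longrightarrow> f i \<in> I) \<Longrightarrow> sum f A \<in> I"
  by (induction A rule: infinite_finite_induct) (auto intro: ring_ideal_0 ring_ideal_add)

lemma ring_ideal_prod_diff:
  assumes I: "ring_ideal I" and "\<And>i. i \<in> A \<Longrightarrow> f i - g i \<in> I"
  shows "prod f A - prod g A \<in> I"
  using assms(2)
proof (induction A rule: infinite_finite_induct)
  case (insert x A)
  have "f x * (prod f A - prod g A) + prod g A * (f x - g x) \<in> I"
    using insert by (intro ring_ideal_add[OF I] ring_ideal_mult[OF I]) auto
  then show ?case
    using insert by (simp add: algebra_simps)
qed (simp_all add: ring_ideal_0[OF I])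

lemma ring_ideal_det_diff:
  fixes A B :: "'a::comm_ring_1 ^ 'n ^ 'n"
  assumes I: "ring_ideal I" and "\<And>i j. A $ i $ j - B $ i $ j \<in> I"
  shows "det A - det B \<in> I"
  unfolding det_def sum_subtractf[symmetric] right_diff_distrib[symmetric]
  using assms(2) by (intro ring_ideal_sum ring_ideal_mult I ring_ideal_prod_diff)

text \<open>Entry (k, l) is the cofactor at position (l, k), written as a determinant of full size
  in which row l is a unit vector.\<close>

definition adjugate :: "'a::comm_ring_1 ^ 'n ^ 'n \<Rightarrow> 'a ^ 'n ^ 'n" where
  "adjugate A = (\<chi> k l. det (\<chi> i. if i = l then axis k 1 else A $ i))"

text \<open>By linearity in row l, entry (m, l) is the determinant of A with row l replaced by row
  m, which has a repeated row unless m = l.\<close>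

lemma matrix_mul_adjugate:
  fixes A :: "'a::comm_ring_1 ^ 'n ^ 'n"
  shows "(A ** adjugate A) $ m $ l = (if m = l then det A else 0)"
proof -
  have "det (\<chi> i. if i = l then A $ m else A $ i)
      = det (\<chi> i. if i = l then (\<Sum>k\<in>UNIV. A $ m $ k *s axis k 1) else A $ i)"
    by (subst basis_expansion) simp
  also have "\<dots> = (\<Sum>k\<in>UNIV. A $ m $ k * det (\<chi> i. if i = l then axis k 1 else A $ i))"
    by (subst det_linear_row_sum) (simp_all add: det_row_mul)
  also have "\<dots> = (A ** adjugate A) $ m $ l"
    by (simp add: matrix_matrix_mult_def adjugate_def)
  finally have "(A ** adjugate A) $ m $ l = det (\<chi> i. if i = l then A $ m else A $ i)" ..
  moreover have "det (\<chi> i. if i = l then A $ m else A $ i) = 0" if "m \<noteq> l"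
    using that by (intro det_identical_rows[of m l]) (auto simp: row_def vec_eq_iff)
  moreover have "(\<chi> i. if i = l then A $ l else A $ i) = A"
    by (simp add: vec_eq_iff)
  ultimately show ?thesis
    by auto
qed

text \<open>Taking determinants of A A^t \<equiv> 1 gives the first claim. For the second, A (A^t
  adj(A^t)) = det(A) A becomes det(A) A \<equiv> adj(A^t); multiplying by A^t yields det(A) (A^t A -
  1) \<equiv> 0, and det(A) is a unit modulo I because its square is 1.\<close>

lemma
  fixes A :: "'a::comm_ring_1 ^ 'n ^ 'n"
  assumes I: "ring_ideal I"
    and A: "\<And>i j. (A ** transpose A) $ i $ j - of_bool (i = j) \<in> I"
  shows orthogonal_mod_det: "(det A)\<^sup>2 - 1 \<in> I"
    and orthogonal_mod_transpose: "(transpose A ** A) $ i $ j - of_bool (i = j) \<in> I"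
proof -
  have "(A ** transpose A) $ i $ j - mat 1 $ i $ j \<in> I" for i j
    using A[of i j] by (simp add: mat_def of_bool_def)
  from ring_ideal_det_diff[OF I this] show det: "(det A)\<^sup>2 - 1 \<in> I"
    by (simp add: det_mul power2_eq_square)
  let ?C = "adjugate (transpose A)"
  \<comment> \<open>The product A A^t adj(A^t) is evaluated with both bracketings.\<close>
  have C: "det A * A $ i $ j - ?C $ i $ j \<in> I" for i j
  proof -
    have "(A ** (transpose A ** ?C)) $ i $ j =
        (\<Sum>k\<in>UNIV. A $ i $ k * (transpose A ** ?C) $ k $ j)"
      unfolding matrix_matrix_mult_def by simp
    also have "\<dots> = A $ i $ j * det A"
      unfolding matrix_mul_adjugate by (simp add: if_distrib[of "\<lambda>x. _ * x"] cong: if_cong)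
    finally have "A $ i $ j * det A = (A ** transpose A ** ?C) $ i $ j"
      by (simp add: matrix_mul_assoc)
    also have "\<dots> = (\<Sum>k\<in>UNIV. (A ** transpose A) $ i $ k * ?C $ k $ j)"
      by (simp add: matrix_matrix_mult_def[of "A ** transpose A"])
    finally have "det A * A $ i $ j - ?C $ i $ j =
        (\<Sum>k\<in>UNIV. (A ** transpose A) $ i $ k * ?C $ k $ j) - (\<Sum>k\<in>UNIV. of_bool (i = k) * ?C $ k $ j)"
      by (simp add: mult.commute if_distrib[of "\<lambda>x. x * _"] of_bool_def cong: if_cong)
    also have "\<dots> = (\<Sum>k\<in>UNIV. ?C $ k $ j * ((A ** transpose A) $ i $ k - of_bool (i = k)))"
      by (simp add: right_diff_distrib left_diff_distrib sum_subtractf mult.commute)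
    finally show ?thesis
      using A by (simp add: ring_ideal_sum[OF I] ring_ideal_mult[OF I])
  qed
  let ?x = "(transpose A ** A) $ i $ j - of_bool (i = j)"
  have "det A * ?x = (\<Sum>k\<in>UNIV. A $ k $ i * (det A * A $ k $ j)) - (transpose A ** ?C) $ i $ j"
    unfolding matrix_mul_adjugate det_transpose
    by (simp add: matrix_matrix_mult_def transpose_def sum_distrib_left right_diff_distrib mult_ac)
  also have "\<dots> = (\<Sum>k\<in>UNIV. A $ k $ i * (det A * A $ k $ j - ?C $ k $ j))"
    by (simp add: matrix_matrix_mult_def transpose_def right_diff_distrib sum_subtractf)
  finally have "det A * ?x \<in> I"
    using C by (simp add: ring_ideal_sum[OF I] ring_ideal_mult[OF I])
  then have "det A * (det A * ?x) - ?x * ((det A)\<^sup>2 - 1) \<in> I"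
    using det by (rule ring_ideal_diff[OF I ring_ideal_mult[OF I] ring_ideal_mult[OF I]])
  then show "?x \<in> I"
    by (simp add: algebra_simps power2_eq_square)
qed

section \<open>The generators of J' as a matrix equation in the derivations\<close>

definition var_matrix :: "('n::finite \<times> 'n) mpoly ^ 'n ^ 'n" where
  "var_matrix = (\<chi> i j. mvar (i, j))"

text \<open>The transposed equations, with columns in place of rows; these are the ones that descend
  to the Gram matrix.\<close>

definition g'_op :: "'n::{finite,linorder} \<Rightarrow> 'n \<Rightarrow> ('n \<times> 'n) ratweyl" where
  "g'_op i j = of_bool (i = j) - (\<Sum>k\<in>UNIV. dvar (k, i) * dvar (k, j))"

abbreviation det_op :: "('n::{finite,linorder} \<times> 'n) ratweyl" where
  "det_op \<equiv> poly_in_dvar (det var_matrix)"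

lemma d_op_eq: "d_op = 1 - det_op"
  by (simp add: d_op_def var_matrix_def)

lemma poly_in_dvar_g:
  "poly_in_dvar ((var_matrix ** transpose var_matrix) $ i $ j - of_bool (i = j)) = - g_op i j"
  by (simp add: g_op_def var_matrix_def matrix_matrix_mult_def transpose_def poly_in_dvar_diff
      poly_in_dvar_sum poly_in_dvar_mult poly_in_dvar_mvar)

lemma poly_in_dvar_g':
  "poly_in_dvar ((transpose var_matrix ** var_matrix) $ i $ j - of_bool (i = j)) = - g'_op i j"
  by (simp add: g'_op_def var_matrix_def matrix_matrix_mult_def transpose_def poly_in_dvar_diff
      poly_in_dvar_sum poly_in_dvar_mult poly_in_dvar_mvar)

lemma g_op_commute: "g_op i j = g_op j i"
  by (simp add: g_op_def dvar_commute eq_commute)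

lemma P_op_commute: "P_op j i = - P_op i j"
  by (simp add: P_op_def flip: sum_negf)

lemma ring_ideal_poly_in_dvar:
  assumes "0 \<in> L" "\<And>x y. x \<in> L \<Longrightarrow> y \<in> L \<Longrightarrow> x + y \<in> L"
    and "\<And>p x. x \<in> L \<Longrightarrow> poly_in_dvar p * x \<in> L"
  shows "ring_ideal {q. poly_in_dvar q \<in> L}"
  using assms by (auto simp: ring_ideal_def poly_in_dvar_add poly_in_dvar_mult)

text \<open>Pulled back along \<open>poly_in_dvar\<close>, L becomes an ideal of a commutative
  polynomial ring, where the orthogonality lemmas apply to the generic matrix. Closure under
  multiples by constant-coefficient operators is shared by left ideals of R and of the Weyl algebra,
  and the lemma is used for both.\<close>

lemma
  assumes L: "0 \<in> L" "\<And>x y. x \<in> L \<Longrightarrow> y \<in> L \<Longrightarrow> x + y \<in> L"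
    and mult: "\<And>p x. x \<in> L \<Longrightarrow> poly_in_dvar p * x \<in> L"
  shows g'_op_in_g_ideal: "(\<And>i j. g_op i j \<in> L) \<Longrightarrow> g'_op i j \<in> L"
    and g_op_in_g'_ideal: "(\<And>i j. g'_op i j \<in> L) \<Longrightarrow> g_op i j \<in> L"
    and det_op_in_g_ideal: "(\<And>i j. g_op i j \<in> L) \<Longrightarrow> det_op * det_op - 1 \<in> L"
proof -
  have minus: "- x \<in> L \<longleftrightarrow> x \<in> L" for x
    using mult[of x "- 1"] mult[of "- x" "- 1"] by (auto simp: poly_in_dvar_uminus)
  note I = ring_ideal_poly_in_dvar[OF assms]
  show "g'_op i j \<in> L" if "\<And>i j. g_op i j \<in> L"
    using orthogonal_mod_transpose[OF I, of var_matrix i j] that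
    by (simp add: poly_in_dvar_g poly_in_dvar_g' minus)
  show "det_op * det_op - 1 \<in> L" if "\<And>i j. g_op i j \<in> L"
  proof -
    have "(var_matrix ** transpose var_matrix) $ i $ j - of_bool (i = j) \<in> {q. poly_in_dvar q \<in> L}" for i j
      unfolding mem_Collect_eq poly_in_dvar_g minus by (rule that)
    from orthogonal_mod_det[OF I this]
    show ?thesis
      by (simp add: poly_in_dvar_diff poly_in_dvar_mult power2_eq_square)
  qed
  show "g_op i j \<in> L" if "\<And>i j. g'_op i j \<in> L"
    using orthogonal_mod_transpose[OF I, of "transpose var_matrix" i j] that
    by (simp add: poly_in_dvar_g poly_in_dvar_g' minus transpose_transpose)
qed

lemma weyl_ideal_poly_in_dvar: "x \<in> weyl_ideal S \<Longrightarrow> poly_in_dvar p * x \<in> weyl_ideal S"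
  by (rule weyl_ideal_mult) simp

text \<open>The operator \<Sum>_k x_jk \<partial>/\<partial>x_ik is the derivation that sends row i
  to row j and kills the other rows; a product with one factor per row is hit at most once.\<close>

lemma sum_mpderiv_prod_var:
  fixes p :: "'n::finite \<Rightarrow> 'n"
  assumes "finite A"
  shows "(\<Sum>k\<in>UNIV. mvar (j, k) * mpderiv (i, k) (\<Prod>a\<in>A. mvar (a, p a))) =
    (if i \<in> A then mvar (j, p i) * (\<Prod>a\<in>A - {i}. mvar (a, p a)) else 0)"
  using assms
proof induction
  case (insert b A)
  have E: "(\<Sum>k\<in>UNIV. mvar (j, k) * mpderiv (i, k) (mvar (b, p b) * q)) =
      of_bool (i = b) * mvar (j, p b) * q + mvar (b, p b) * (\<Sum>k\<in>UNIV. mvar (j, k) * mpderiv (i, k) q)" for q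
  proof -
    have "(\<Sum>k\<in>UNIV. mvar (j, k) * mpderiv (i, k) (mvar (b, p b) * q)) =
       (\<Sum>k\<in>UNIV. (if k = p b then of_bool (i = b) * mvar (j, k) * q else 0) + mvar (b, p b) * (mvar (j, k) * mpderiv (i, k) q))"
      by (intro sum.cong) (auto simp: mpderiv_mult mpderiv_mvar algebra_simps)
    then show ?thesis
      by (simp add: sum.distrib sum_distrib_left)
  qed
  show ?case
  proof (cases "i = b")
    case True
    then have "i \<notin> A" using insert.hyps by simp
    then show ?thesis
      unfolding prod.insert[OF insert.hyps] E insert.IH using True insert.hyps by simp
  next
    case False
    then have "insert b A - {i} = insert b (A - {i})"
      by auto
    with False show ?thesis
      unfolding prod.insert[OF insert.hyps] E insert.IH using insert.hyps by (simp add: mult_ac)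
  qed
qed simp

text \<open>The derivation replaces row i of the determinant by row j, leaving two equal
  rows.\<close>

lemma sum_mpderiv_det_var:
  assumes "i \<noteq> j"
  shows "(\<Sum>k\<in>UNIV. mvar (j, k) * mpderiv (i, k) (det var_matrix)) = 0"
proof -
  have E: "(\<Sum>k\<in>UNIV. mvar (j, k) * mpderiv (i, k) (of_int c * (\<Prod>a\<in>UNIV. mvar (a, p a)))) =
      of_int c * (\<Prod>a\<in>UNIV. mvar (if a = i then j else a, p a))"
    for c and p :: "'a \<Rightarrow> 'a"
  proof -
    have [simp]: "mpderiv v (of_int c * q) = of_int c * mpderiv v q" for v :: "'a \<times> 'a" and q
    proof -
      have nat: "mpderiv v (of_nat k * q) = of_nat k * mpderiv v q" for k q
        by (induction k) (simp_all add: mpderiv_add algebra_simps)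
      then show ?thesis
        by (cases c rule: int_cases2) (simp_all add: mpderiv_uminus)
    qed
    have "(\<Prod>a\<in>UNIV. mvar (if a = i then j else a, p a)) =
        mvar (j, p i) * (\<Prod>a\<in>UNIV - {i}. mvar (if a = i then j else a, p a))"
      by (subst prod.remove[of _ i]) auto
    also have "(\<Prod>a\<in>UNIV - {i}. mvar (if a = i then j else a, p a)) = (\<Prod>a\<in>UNIV - {i}. mvar (a, p a))"
      by (intro prod.cong) auto
    finally show ?thesis
      using sum_mpderiv_prod_var[of UNIV j i p]
      by (simp add: mult.left_commute[of _ "of_int c"] flip: sum_distrib_left)
  qed
  have "(\<Sum>k\<in>UNIV. mvar (j, k) * mpderiv (i, k) (det var_matrix)) =
     (\<Sum>p | p permutes UNIV. \<Sum>k\<in>UNIV. mvar (j, k) * mpderiv (i, k) (of_int (sign p) * (\<Prod>a\<in>UNIV. mvar (a, p a))))"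
    by (subst sum.swap) (simp add: det_def var_matrix_def mpderiv_sum sum_distrib_left)
  also have "\<dots> = det ((\<chi> a b. mvar (if a = i then j else a, b)) :: ('a \<times> 'a) mpoly ^ 'a ^ 'a)"
    unfolding E by (simp add: det_def)
  also have "\<dots> = 0"
    using assms by (intro det_identical_rows[of i j]) (auto simp: row_def vec_eq_iff)
  finally show ?thesis .
qed

text \<open>The commutators arising when the variables move past det(\<partial>) add up to the sums
  of \<open>sum_mpderiv_det_var\<close>. In other words, det(\<partial>) is invariant under
  infinitesimal rotations of the rows.\<close>

lemma P_op_det_op:
  assumes "i \<noteq> j"
  shows "P_op i j * det_op = det_op * P_op i j"
proof -
  let ?d = "det var_matrix :: ('a \<times> 'a) mpoly"
  have comm: "xvar v * dvar w * poly_in_dvar ?d =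
      poly_in_dvar ?d * (xvar v * dvar w) - poly_in_dvar (mvar w * mpderiv v ?d)" for v w
  proof -
    have "xvar v * dvar w * poly_in_dvar ?d = xvar v * poly_in_dvar ?d * dvar w"
      by (simp add: mult.assoc poly_in_dvar_commute flip: poly_in_dvar_mvar)
    then show ?thesis
      by (simp add: xvar_poly_in_dvar left_diff_distrib mult.assoc mult.commute[of "mvar w"]
          poly_in_dvar_mult poly_in_dvar_mvar)
  qed
  have "P_op i j * det_op = (\<Sum>k\<in>UNIV.
      (det_op * (xvar (i, k) * dvar (j, k)) - poly_in_dvar (mvar (j, k) * mpderiv (i, k) ?d)) -
      (det_op * (xvar (j, k) * dvar (i, k)) - poly_in_dvar (mvar (i, k) * mpderiv (j, k) ?d)))"
    unfolding P_op_def sum_distrib_right left_diff_distrib comm ..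
  also have "\<dots> = det_op * P_op i j -
      poly_in_dvar ((\<Sum>k\<in>UNIV. mvar (j, k) * mpderiv (i, k) ?d) - (\<Sum>k\<in>UNIV. mvar (i, k) * mpderiv (j, k) ?d))"
    by (simp add: P_op_def sum_distrib_left right_diff_distrib poly_in_dvar_diff poly_in_dvar_sum
        sum_subtractf)
  finally have "P_op i j * det_op = \<dots>" .
  then show ?thesis
    using assms by (simp add: sum_mpderiv_det_var)
qed

lemma g_op_det_op: "g_op i j * det_op = det_op * g_op i j"
proof -
  have "g_op i j = poly_in_dvar (- ((var_matrix ** transpose var_matrix) $ i $ j - of_bool (i = j)))"
    unfolding poly_in_dvar_uminus poly_in_dvar_g by simp
  then show ?thesis
    by (metis poly_in_dvar_commute)
qed

subsection \<open>Substitution\<close>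

definition ring_hom :: "('a::comm_ring_1 \<Rightarrow> 'b::comm_ring_1) \<Rightarrow> bool" where
  "ring_hom h \<longleftrightarrow> h 1 = 1 \<and> (\<forall>a b. h (a + b) = h a + h b) \<and> (\<forall>a b. h (a * b) = h a * h b)"

lemma ring_homD:
  assumes "ring_hom h"
  shows ring_hom_1: "h 1 = 1" and ring_hom_add: "h (a + b) = h a + h b"
    and ring_hom_mult: "h (a * b) = h a * h b" and ring_hom_0: "h 0 = 0"
    and ring_hom_uminus: "h (- a) = - h a"
proof -
  show 1: "h 1 = 1" "h (a + b) = h a + h b" "h (a * b) = h a * h b" for a b
    using assms unfolding ring_hom_def by auto
  show 0: "h 0 = 0"
    using 1(2)[of 0 0] by simp
  show "h (- a) = - h a"
    using 1(2)[of a "- a"] 0 by (simp add: eq_neg_iff_add_eq_0 add.commute)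
qed

lemma ring_hom_sum: "ring_hom h \<Longrightarrow> h (sum f A) = (\<Sum>x\<in>A. h (f x))"
  by (induction A rule: infinite_finite_induct) (simp_all add: ring_homD)

lemma ring_hom_prod: "ring_hom h \<Longrightarrow> h (prod f A) = (\<Prod>x\<in>A. h (f x))"
  by (induction A rule: infinite_finite_induct) (simp_all add: ring_homD)

lemma ring_hom_of_int: "ring_hom h \<Longrightarrow> h (of_int k) = of_int k"
proof -
  assume h: "ring_hom h"
  have "h (of_nat n) = of_nat n" for n
    by (induction n) (simp_all add: ring_homD[OF h])
  then show ?thesis
    by (cases k rule: int_cases2) (simp_all add: ring_homD[OF h])
qed

lemma ring_hom_det: "ring_hom h \<Longrightarrow> h (det A) = det (\<chi> i j. h (A $ i $ j))"
  by (simp add: det_def ring_hom_sum ring_hom_prod ring_hom_mult ring_hom_of_int)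

text \<open>Coefficients pass through a homomorphism h, so that one definition serves for values in
  C, substitution into polynomials and substitution into rational functions.\<close>

definition mpoly_eval :: "(complex \<Rightarrow> 'a::comm_ring_1) \<Rightarrow> ('v::finite \<Rightarrow> 'a) \<Rightarrow> 'v mpoly \<Rightarrow> 'a" where
  "mpoly_eval h y p =
     (\<Sum>m\<in>Poly_Mapping.keys p. h (Poly_Mapping.lookup p m) * (\<Prod>v\<in>UNIV. y v ^ expo m v))"

lemma mpoly_eval_add: "ring_hom h \<Longrightarrow> mpoly_eval h y (p + q) = mpoly_eval h y p + mpoly_eval h y q"
  unfolding mpoly_eval_def
  by (rule setsum_keys_plus_distrib) (simp_all add: ring_homD distrib_right)

lemma mpoly_eval_single:
  "ring_hom h \<Longrightarrow> mpoly_eval h y (Poly_Mapping.single m c) = h c * (\<Prod>v\<in>UNIV. y v ^ expo m v)"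
  by (cases "c = 0") (simp_all add: mpoly_eval_def ring_hom_0)

lemma mpoly_eval_const: "ring_hom h \<Longrightarrow> mpoly_eval h y (Poly_Mapping.single 0 c) = h c"
  by (simp add: mpoly_eval_single zero_mindex.rep_eq)

lemma prod_expo_unit_index:
  "(\<Prod>v\<in>UNIV. y v ^ expo (unit_index w) v) = (y w :: 'a::comm_ring_1)" for w :: "'v::finite"
proof -
  have "(\<Prod>v\<in>UNIV. y v ^ expo (unit_index w) v) = (\<Prod>v\<in>UNIV. if v = w then y v else 1)"
    by (intro prod.cong) (auto simp: unit_index.rep_eq)
  then show ?thesis
    by simp
qed

lemma mpoly_eval_mult:
  assumes h: "ring_hom h"
  shows "mpoly_eval h y (p * q) = mpoly_eval h y p * mpoly_eval h y q"
proof (induction p rule: poly_mapping_add_induct)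
  case (single m c)
  show ?case
    by (induction q rule: poly_mapping_add_induct)
      (simp_all add: mpoly_eval_add[OF h] mpoly_eval_single[OF h] mult_single algebra_simps
        ring_homD[OF h] plus_mindex.rep_eq power_add prod.distrib,
       simp add: mpoly_eval_def)
qed (simp_all add: mpoly_eval_add[OF h] algebra_simps, simp add: mpoly_eval_def)

lemma mpoly_eval_mvar: "ring_hom h \<Longrightarrow> mpoly_eval h y (mvar v) = y v"
  by (simp add: mvar_def mpoly_eval_single prod_expo_unit_index ring_homD)

lemma ring_hom_mpoly_eval: "ring_hom h \<Longrightarrow> ring_hom (mpoly_eval h y)"
  using mpoly_eval_const[of h y 1]
  by (simp add: ring_hom_def[of "mpoly_eval h y"] mpoly_eval_add mpoly_eval_mult ring_hom_1)

lemma mpoly_eval_0 [simp]: "mpoly_eval h y 0 = 0"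
  by (simp add: mpoly_eval_def)

lemma mpoly_eval_1: "ring_hom h \<Longrightarrow> mpoly_eval h y 1 = 1"
  by (rule ring_hom_1[OF ring_hom_mpoly_eval])

abbreviation rconst :: "complex \<Rightarrow> 'v::finite ratfun" where
  "rconst c \<equiv> Fract (Poly_Mapping.single 0 c) 1"

lemma ring_hom_Fract1: "ring_hom (\<lambda>p. Fract p 1 :: 'a::idom fract)"
  by (simp add: ring_hom_def One_fract_def)

lemma ring_hom_rconst: "ring_hom rconst"
  by (simp add: ring_hom_def single_add mult_single One_fract_def)

lemma ring_hom_single: "ring_hom (Poly_Mapping.single 0 :: complex \<Rightarrow> 'v::finite mpoly)"
  by (simp add: ring_hom_def single_add mult_single)

lemma rderiv_uminus: "rderiv v (- r) = - rderiv v r"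
  using rderiv_add[of v r "- r"] by (simp add: eq_neg_iff_add_eq_0 add.commute)

lemma rderiv_sum: "rderiv v (sum f A) = (\<Sum>x\<in>A. rderiv v (f x))"
  by (induction A rule: infinite_finite_induct) (simp_all add: rderiv_add)

lemma rderiv_mpoly_eval:
  "rderiv v (mpoly_eval rconst y p) =
    (\<Sum>w\<in>UNIV. mpoly_eval rconst y (mpderiv w p) * rderiv v (y w))"
proof (induction p rule: mpoly_induct)
  case (const c)
  then show ?case
    by (simp add: mpoly_eval_const[OF ring_hom_rconst] rderiv_poly Zero_fract_def[symmetric])
next
  case (var u p)
  have "(\<Sum>w\<in>UNIV. mpoly_eval rconst y (mpderiv w (mvar u * p)) * rderiv v (y w)) =
    (\<Sum>w\<in>UNIV. (if w = u then mpoly_eval rconst y p * rderiv v (y w) else 0) +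
       y u * (mpoly_eval rconst y (mpderiv w p) * rderiv v (y w)))"
    by (intro sum.cong)
      (auto simp: mpderiv_mult mpderiv_mvar mpoly_eval_add[OF ring_hom_rconst] algebra_simps
        mpoly_eval_mult[OF ring_hom_rconst] mpoly_eval_mvar[OF ring_hom_rconst]
        mpoly_eval_1[OF ring_hom_rconst])
  also have "\<dots> = mpoly_eval rconst y p * rderiv v (y u) + y u * rderiv v (mpoly_eval rconst y p)"
    by (simp add: sum.distrib var sum_distrib_left)
  finally show ?case
    by (simp add: mpoly_eval_mult[OF ring_hom_rconst] mpoly_eval_mvar[OF ring_hom_rconst] rderiv_mult
        algebra_simps)
next
  case (add p q)
  then show ?case
    by (simp add: mpderiv_add mpoly_eval_add[OF ring_hom_rconst] rderiv_add sum.distrib algebra_simps)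
qed

definition alg_indep :: "('w::finite \<Rightarrow> 'v::finite ratfun) \<Rightarrow> bool" where
  "alg_indep y \<longleftrightarrow> (\<forall>p. mpoly_eval rconst y p = 0 \<longrightarrow> p = 0)"

text \<open>Only sensible for algebraically independent \<open>y\<close>: otherwise a denominator may become \<open>0\<close>.\<close>

definition rsubst :: "('w::finite \<Rightarrow> 'v::finite ratfun) \<Rightarrow> 'w ratfun \<Rightarrow> 'v ratfun" where
  "rsubst y r = (THE z. \<exists>a b. b \<noteq> 0 \<and> r = Fract a b \<and>
     z = mpoly_eval rconst y a / mpoly_eval rconst y b)"

lemma rsubst_Fract:
  assumes y: "alg_indep y" and "b \<noteq> 0"
  shows "rsubst y (Fract a b) = mpoly_eval rconst y a / mpoly_eval rconst y b"
  unfolding rsubst_def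
proof (rule the_equality)
  let ?e = "mpoly_eval rconst y"
  have nz: "?e b \<noteq> 0" if "b \<noteq> 0" for b
    using y that unfolding alg_indep_def by blast
  fix z assume "\<exists>c d. d \<noteq> 0 \<and> Fract a b = Fract c d \<and> z = ?e c / ?e d"
  then obtain c d where cd: "d \<noteq> 0" "Fract a b = Fract c d" "z = ?e c / ?e d"
    by blast
  then have "a * d = c * b"
    using assms by (simp add: eq_fract)
  then have "?e a * ?e d = ?e c * ?e b"
    by (simp flip: mpoly_eval_mult[OF ring_hom_rconst])
  then show "z = ?e a / ?e b"
    unfolding cd(3) using nz assms(2) cd(1) by (subst frac_eq_eq) auto
qed (use assms in blast)

lemma rsubst_poly:
  "alg_indep y \<Longrightarrow> rsubst y (Fract p 1) = mpoly_eval rconst y p"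
  using ring_hom_1[OF ring_hom_mpoly_eval[OF ring_hom_rconst], of y] by (simp add: rsubst_Fract)

lemma ring_hom_rsubst:
  assumes y: "alg_indep y"
  shows "ring_hom (rsubst y)"
proof -
  let ?e = "mpoly_eval rconst y"
  have nz: "?e b \<noteq> 0" if "b \<noteq> 0" for b
    using y that unfolding alg_indep_def by blast
  note e = mpoly_eval_add[OF ring_hom_rconst] mpoly_eval_mult[OF ring_hom_rconst]
  have "rsubst y (r + s) = rsubst y r + rsubst y s \<and> rsubst y (r * s) = rsubst y r * rsubst y s" for r s
    by (cases r; cases s) (simp add: rsubst_Fract[OF y] e nz field_simps)
  moreover have "rsubst y 1 = 1"
    using rsubst_poly[OF y, of 1, folded One_fract_def] by (simp add: mpoly_eval_1[OF ring_hom_rconst])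
  ultimately show ?thesis
    by (simp add: ring_hom_def)
qed

lemma rsubst_eq_0_iff:
  assumes y: "alg_indep y"
  shows "rsubst y r = 0 \<longleftrightarrow> r = 0"
proof (cases r)
  case (Fract a b)
  have "r = 0 \<longleftrightarrow> a = 0"
    using Fract by (simp add: Zero_fract_def eq_fract)
  moreover have "mpoly_eval rconst y p = 0 \<longleftrightarrow> p = 0" for p
    using y by (auto simp: alg_indep_def)
  ultimately show ?thesis
    using Fract by (simp add: rsubst_Fract[OF y])
qed

lemma rderiv_rsubst:
  assumes y: "alg_indep y"
  shows "rderiv v (rsubst y r) = (\<Sum>w\<in>UNIV. rsubst y (rderiv w r) * rderiv v (y w))"
proof (cases r)
  case (Fract a b)
  note h = ring_homD[OF ring_hom_rsubst[OF y]]
  let ?A = "Fract a 1" and ?B = "Fract b 1"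
  have A: "?A = r * ?B"
    using Fract by (simp add: eq_fract)
  have poly: "rderiv v (rsubst y (Fract p 1)) = (\<Sum>w\<in>UNIV. rsubst y (rderiv w (Fract p 1)) * rderiv v (y w))" for p
    by (simp add: rsubst_poly[OF y] rderiv_poly rderiv_mpoly_eval)
  \<comment> \<open>The chain rule for the quotient r = a/b follows from the product rule for a = r
    b, as the polynomials a and b already satisfy it.\<close>
  have "rderiv v (rsubst y r) * rsubst y ?B + rsubst y r * rderiv v (rsubst y ?B) =
      rderiv v (rsubst y ?A)"
    unfolding A by (simp add: h rderiv_mult)
  also have "\<dots> = (\<Sum>w\<in>UNIV. rsubst y (rderiv w r) * rderiv v (y w)) * rsubst y ?B
      + rsubst y r * rderiv v (rsubst y ?B)"
    unfolding poly unfolding A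
    by (simp add: h rderiv_mult sum.distrib sum_distrib_left sum_distrib_right algebra_simps)
  finally have "rderiv v (rsubst y r) * rsubst y ?B =
      (\<Sum>w\<in>UNIV. rsubst y (rderiv w r) * rderiv v (y w)) * rsubst y ?B"
    by simp
  moreover have "rsubst y ?B \<noteq> 0"
    unfolding rsubst_eq_0_iff[OF y] using Fract by (simp add: Zero_fract_def eq_fract)
  ultimately show ?thesis
    by simp
qed

subsection \<open>Reflections\<close>

lemma ratweyl_monom_induct [case_names monom add]:
  fixes P :: "'v::finite ratweyl"
  assumes "\<And>r m. Q (rcoef r * dmon m)" "\<And>P P'. Q P \<Longrightarrow> Q P' \<Longrightarrow> Q (P + P')"
  shows "Q P"
proof -
  have "Q (\<Sum>m\<in>A. rcoef (c m) * dmon m)" if "finite A" for A c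
    using that
  proof (induction rule: finite_induct)
    case empty
    then show ?case using assms(1)[of 0] by simp
  qed (simp add: assms)
  then show ?thesis
    by (subst ratweyl_expand) simp
qed

definition refl_sign :: "'v set \<Rightarrow> 'v \<Rightarrow> 'a::comm_ring_1" where
  "refl_sign S v = (if v \<in> S then - 1 else 1)"

definition refl_poly :: "'v::finite set \<Rightarrow> 'v mpoly \<Rightarrow> 'v mpoly" where
  "refl_poly S = mpoly_eval (Poly_Mapping.single 0) (\<lambda>v. refl_sign S v * mvar v)"

definition refl_vars :: "'v::finite set \<Rightarrow> 'v \<Rightarrow> 'v ratfun" where
  "refl_vars S v = refl_sign S v * Fract (mvar v) 1"

lemma refl_sign_square [simp]: "refl_sign S v * refl_sign S v = 1"
  by (simp add: refl_sign_def)

lemma ring_hom_refl_poly: "ring_hom (refl_poly S)"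
  unfolding refl_poly_def by (rule ring_hom_mpoly_eval[OF ring_hom_single])

lemma refl_poly_const: "refl_poly S (Poly_Mapping.single 0 c) = Poly_Mapping.single 0 c"
  unfolding refl_poly_def by (rule mpoly_eval_const[OF ring_hom_single])

lemma refl_poly_mvar: "refl_poly S (mvar v) = refl_sign S v * mvar v"
  unfolding refl_poly_def by (rule mpoly_eval_mvar[OF ring_hom_single])

lemma ring_hom_refl_sign: "ring_hom h \<Longrightarrow> h (refl_sign S v) = refl_sign S v"
  by (simp add: refl_sign_def ring_homD)

lemma refl_poly_refl_poly: "refl_poly S (refl_poly S p) = p"
proof (induction p rule: mpoly_induct)
  case (var v p)
  then show ?case
    by (simp add: ring_homD[OF ring_hom_refl_poly] refl_poly_mvar ring_hom_refl_sign[OF ring_hom_refl_poly]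
        flip: mult.assoc)
qed (simp_all add: refl_poly_const ring_homD[OF ring_hom_refl_poly])

lemma mpoly_eval_refl_vars: "mpoly_eval rconst (refl_vars S) p = Fract (refl_poly S p) 1"
proof (induction p rule: mpoly_induct)
  case (var v p)
  have "refl_sign S v = Fract (refl_sign S v) (1 :: 'a mpoly)"
    by (simp add: refl_sign_def One_fract_def)
  then show ?case
    using var by (simp add: mpoly_eval_mult[OF ring_hom_rconst] mpoly_eval_mvar[OF ring_hom_rconst]
        ring_homD[OF ring_hom_refl_poly] refl_poly_mvar refl_vars_def)
qed (simp_all add: mpoly_eval_const[OF ring_hom_rconst] refl_poly_const
    mpoly_eval_add[OF ring_hom_rconst] ring_homD[OF ring_hom_refl_poly])

lemma refl_poly_eq_0: "refl_poly S p = 0 \<longleftrightarrow> p = 0"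
  by (metis refl_poly_refl_poly ring_hom_0[OF ring_hom_refl_poly])

lemma alg_indep_refl_vars: "alg_indep (refl_vars S)"
  by (auto simp: alg_indep_def mpoly_eval_refl_vars Zero_fract_def eq_fract refl_poly_eq_0)

abbreviation refl_rat :: "'v::finite set \<Rightarrow> 'v ratfun \<Rightarrow> 'v ratfun" where
  "refl_rat S \<equiv> rsubst (refl_vars S)"

lemma refl_rat_Fract: "b \<noteq> 0 \<Longrightarrow> refl_rat S (Fract a b) = Fract (refl_poly S a) (refl_poly S b)"
  by (simp add: rsubst_Fract[OF alg_indep_refl_vars] mpoly_eval_refl_vars refl_poly_eq_0)

lemma refl_rat_refl_rat: "refl_rat S (refl_rat S r) = r"
  by (cases r) (simp add: refl_rat_Fract refl_poly_eq_0 refl_poly_refl_poly)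

lemma rderiv_refl_rat: "rderiv v (refl_rat S r) = refl_sign S v * refl_rat S (rderiv v r)"
proof -
  have "rderiv v (refl_vars S w) = (if w = v then refl_sign S v else 0)" for w
    by (simp add: refl_vars_def refl_sign_def rderiv_poly mpderiv_uminus mpderiv_mvar One_fract_def Zero_fract_def)
  then show ?thesis
    by (simp add: rderiv_rsubst[OF alg_indep_refl_vars] if_distrib[of "\<lambda>x. _ * x"] mult.commute cong: if_cong)
qed

definition refl_index :: "'v::finite set \<Rightarrow> 'v mindex \<Rightarrow> 'a::comm_ring_1" where
  "refl_index S m = (\<Prod>v\<in>UNIV. refl_sign S v ^ expo m v)"

lemma refl_index_unit: "refl_index S (m + unit_index v) = refl_sign S v * refl_index S m"
  by (simp add: refl_index_def plus_mindex.rep_eq power_add prod.distrib prod_expo_unit_index mult.commute)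

text \<open>The ring automorphism of R that flips the sign of the variables in S. The chain rule
  forces it to flip the corresponding derivations, whence the sign \<open>refl_index\<close> of a
  monomial.\<close>

definition refl_op :: "'v::finite set \<Rightarrow> 'v ratweyl \<Rightarrow> 'v ratweyl" where
  "refl_op S P = (\<Sum>m\<in>Poly_Mapping.keys (dcoeffs P).
     rcoef (refl_index S m * refl_rat S (Poly_Mapping.lookup (dcoeffs P) m)) * dmon m)"

lemma refl_op_add: "refl_op S (P + Q) = refl_op S P + refl_op S Q"
  unfolding refl_op_def plus_ratweyl.rep_eq
  by (rule setsum_keys_plus_distrib)
    (simp_all add: ring_homD[OF ring_hom_rsubst[OF alg_indep_refl_vars]] distrib_left distrib_right rcoef_add)

lemma refl_op_0 [simp]: "refl_op S 0 = 0"
  by (simp add: refl_op_def zero_ratweyl.rep_eq)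

lemma refl_op_sum: "refl_op S (sum f A) = (\<Sum>x\<in>A. refl_op S (f x))"
  by (induction A rule: infinite_finite_induct) (simp_all add: refl_op_add)

lemma refl_op_uminus: "refl_op S (- P) = - refl_op S P"
  using refl_op_add[of S P "- P"] by (simp add: eq_neg_iff_add_eq_0 add.commute)

lemma refl_op_diff: "refl_op S (P - Q) = refl_op S P - refl_op S Q"
  using refl_op_add[of S P "- Q"] by (simp add: refl_op_uminus)

lemma refl_op_monom: "refl_op S (rcoef r * dmon m) = rcoef (refl_index S m * refl_rat S r) * dmon m"
proof (cases "r = 0")
  case False
  then show ?thesis
    by (simp add: rcoef_dmon refl_op_def DiffOp_inverse)
qed (simp add: ring_hom_0[OF ring_hom_rsubst[OF alg_indep_refl_vars]])

lemma refl_op_rcoef_mult: "refl_op S (rcoef r * P) = rcoef (refl_rat S r) * refl_op S P"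
proof -
  have "refl_op S (rcoef r * (rcoef s * dmon m)) = rcoef (refl_rat S r) * refl_op S (rcoef s * dmon m)" for s m
  proof -
    have "refl_op S (rcoef r * (rcoef s * dmon m)) = refl_op S (rcoef (r * s) * dmon m)"
      by (simp only: rcoef_mult mult.assoc)
    also have "\<dots> = rcoef (refl_rat S r) * refl_op S (rcoef s * dmon m)"
      unfolding refl_op_monom ring_hom_mult[OF ring_hom_rsubst[OF alg_indep_refl_vars]]
        mult.left_commute[of "refl_index S m"]
      by (simp only: rcoef_mult mult.assoc)
    finally show ?thesis .
  qed
  then show ?thesis
    by (induction P rule: ratweyl_monom_induct) (simp_all add: refl_op_add distrib_left)
qed

lemma rcoef_refl_sign: "rcoef (refl_sign S v) = (if v \<in> S then - 1 else 1)"
  by (simp add: refl_sign_def rcoef_uminus)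

lemma refl_op_dvar_mult: "refl_op S (dvar v * P) = rcoef (refl_sign S v) * dvar v * refl_op S P"
proof -
  have "refl_op S (dvar v * (rcoef s * dmon m)) = rcoef (refl_sign S v) * dvar v * refl_op S (rcoef s * dmon m)" for s m
  proof -
    have "dvar v * (rcoef s * dmon m) = rcoef s * dmon (m + unit_index v) + rcoef (rderiv v s) * dmon m" for s
      by (simp add: dvar_rcoef distrib_right dmon_unit mult.assoc flip: mult.assoc[of "dvar v" "rcoef s"])
    note this[simp]
    \<comment> \<open>\<open>refl_index S m\<close> is 1 or -1, hence a constant for every
      derivation.\<close>
    have const: "rderiv v (refl_index S m * r) = refl_index S m * rderiv v r" for r
    proof -
      have "refl_index S m = (1 :: 'a ratfun) \<or> refl_index S m = (- 1 :: 'a ratfun)"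
        by (induction m rule: mindex_induct)
          (auto simp: refl_index_unit refl_sign_def, simp add: refl_index_def zero_mindex.rep_eq)
      then show ?thesis
        by (auto simp: rderiv_uminus)
    qed
    show ?thesis
      by (simp add: refl_op_add refl_op_monom refl_index_unit const rderiv_refl_rat mult.assoc)
        (simp add: rcoef_refl_sign refl_sign_def rcoef_uminus algebra_simps)
  qed
  then show ?thesis
    by (induction P rule: ratweyl_monom_induct) (simp_all add: refl_op_add distrib_left)
qed

lemma refl_op_1 [simp]: "refl_op S 1 = 1"
  using refl_op_monom[of S 1 0]
  by (simp add: ring_hom_1[OF ring_hom_rsubst[OF alg_indep_refl_vars]] refl_index_def zero_mindex.rep_eq)

lemma refl_op_mult: "refl_op S (P * Q) = refl_op S P * refl_op S Q"
  by (induction P rule: ratweyl_induct)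
    (simp_all add: refl_op_rcoef_mult refl_op_dvar_mult refl_op_add distrib_right mult.assoc)

lemma refl_op_dvar: "refl_op S (dvar v) = rcoef (refl_sign S v) * dvar v"
  using refl_op_dvar_mult[of S v 1] by simp

lemma refl_op_rcoef: "refl_op S (rcoef r) = rcoef (refl_rat S r)"
  using refl_op_rcoef_mult[of S r 1] by simp

lemma refl_op_xvar: "refl_op S (xvar v) = rcoef (refl_sign S v) * xvar v"
  by (simp add: xvar_def refl_op_rcoef refl_rat_Fract refl_poly_mvar ring_homD[OF ring_hom_refl_poly] flip: rcoef_mult)
    (simp add: refl_sign_def)

lemma refl_op_refl_op: "refl_op S (refl_op S P) = P"
proof (induction P rule: ratweyl_induct)
  case (dvar v P)
  then show ?case
    by (simp add: refl_op_mult refl_op_dvar rcoef_refl_sign refl_op_uminus)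
qed (simp_all add: refl_op_mult refl_op_rcoef refl_op_add refl_rat_refl_rat)

lemma refl_op_poly_in_dvar: "refl_op S (poly_in_dvar p) = poly_in_dvar (refl_poly S p)"
proof (induction p rule: mpoly_induct)
  case (const c)
  then show ?case
    by (simp add: poly_in_dvar_const refl_poly_const refl_op_rcoef refl_rat_Fract
        ring_homD[OF ring_hom_refl_poly])
next
  case (var v p)
  then show ?case
    by (simp add: poly_in_dvar_mult refl_op_mult poly_in_dvar_mvar refl_op_dvar refl_poly_mvar
        ring_homD[OF ring_hom_refl_poly])
      (simp add: rcoef_refl_sign refl_sign_def poly_in_dvar_uminus)
qed (simp_all add: poly_in_dvar_add refl_op_add ring_homD[OF ring_hom_refl_poly])

text \<open>Allows division by 2, on which the splitting into eigenspaces and the arguments by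
  antisymmetry rest.\<close>

lemma ratfun_two_neq_0: "(2 :: 'v::finite ratfun) \<noteq> 0"
proof -
  have "(2 :: 'v ratfun) = rconst 2"
    using ring_hom_add[OF ring_hom_rconst, of 1 1] ring_hom_1[OF ring_hom_rconst]
    by (metis one_add_one)
  moreover have "Poly_Mapping.single 0 2 \<noteq> (0 :: 'v mpoly)"
    by (metis lookup_single_eq lookup_zero zero_neq_numeral)
  moreover have "rconst 2 \<noteq> (0 :: 'v ratfun) \<longleftrightarrow> Poly_Mapping.single 0 2 \<noteq> (0 :: 'v mpoly)"
    unfolding Zero_fract_def by (subst eq_fract) auto
  ultimately show ?thesis
    by simp
qed

subsection \<open>The two ideals of the Fisher distribution\<close>

abbreviation rJ' :: "('n::{finite,linorder} \<times> 'n) ratweyl set" where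
  "rJ' \<equiv> left_span UNIV ideal_J'"

abbreviation rJ :: "('n::{finite,linorder} \<times> 'n) ratweyl set" where
  "rJ \<equiv> left_span UNIV ideal_J"

lemma rJ'_eq: "rJ' = left_span UNIV ({g_op i j |i j. i \<le> j} \<union> {P_op i j |i j. i < j})"
  unfolding ideal_J'_def by (rule left_span_left_span) simp

lemma P_op_self [simp]: "P_op i i = 0"
  by (simp add: P_op_def)

lemma
  shows g_op_in_ideal_J': "g_op i j \<in> ideal_J'"
    and P_op_in_ideal_J': "P_op i j \<in> ideal_J'"
proof -
  note base = left_span_base[of weyl_algebra, OF weyl_algebra_1]
  show "g_op i j \<in> ideal_J'"
    unfolding ideal_J'_def
  proof (rule base)
    show "g_op i j \<in> {g_op i j |i j. i \<le> j} \<union> {P_op i j |i j. i < j}"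
      using g_op_commute[of i j] by (cases i j rule: le_cases) auto
  qed
  have *: "P_op i j \<in> ideal_J'" if "i < j" for i j :: 'a
    unfolding ideal_J'_def by (rule base) (use that in auto)
  have "- P_op j i \<in> ideal_J'" if "j < i"
  proof -
    have "pcoef (- 1) * P_op j i \<in> ideal_J'"
      unfolding ideal_J'_def
      using *[OF that] by (intro weyl_ideal_mult weyl_algebra_pcoef) (simp add: ideal_J'_def)
    moreover have "pcoef (- 1) = (- 1 :: ('a \<times> 'a) ratweyl)"
      using rcoef_uminus[of 1] by (simp add: One_fract_def[symmetric] del: minus_fract)
        (simp add: One_fract_def flip: minus_fract)
    ultimately show ?thesis
      by simp
  qed
  moreover have "(0 :: ('a \<times> 'a) ratweyl) \<in> ideal_J'"
    unfolding ideal_J'_def by (rule left_span_0)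
  ultimately show "P_op i j \<in> ideal_J'"
    using *[of i j] P_op_commute[of j i] by (cases i j rule: linorder_cases) auto
qed

lemma ideal_J'_subset_rJ': "ideal_J' \<subseteq> rJ'"
  by (auto intro: left_span_base)

lemma rJ'_subset:
  assumes "left_ideal I" "\<And>i j. g_op i j \<in> I" "\<And>i j. P_op i j \<in> I"
  shows "rJ' \<subseteq> I"
  unfolding rJ'_eq by (rule left_span_subset_left_ideal) (use assms in auto)

lemma left_ideal_rmult: "left_ideal I \<Longrightarrow> left_ideal {x. x * y \<in> I}"
  by (auto simp: left_ideal_def distrib_right mult.assoc)

text \<open>Right multiplication by D = det(\<partial>) preserves the left ideal RJ' because D
  commutes with every generator. So D acts on R/RJ' from the right, by \<open>det_op_square\<close>
  as an involution.\<close>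

lemma rJ'_mult_det_op:
  fixes x :: "('n::{finite,linorder} \<times> 'n) ratweyl"
  assumes "x \<in> rJ'" shows "x * det_op \<in> rJ'"
proof -
  have "rJ' \<subseteq> {x :: ('n \<times> 'n) ratweyl. x * det_op \<in> rJ'}"
  proof (rule rJ'_subset)
    show "g_op i j \<in> {x. x * det_op \<in> rJ'}" for i j :: 'n
      using g_op_in_ideal_J'[of i j] ideal_J'_subset_rJ'
      by (auto simp: g_op_det_op intro!: left_ideal_mult[OF left_ideal_left_span])
    show "P_op i j \<in> {x. x * det_op \<in> rJ'}" for i j :: 'n
      using P_op_in_ideal_J'[of i j] ideal_J'_subset_rJ' left_ideal_0[OF left_ideal_left_span, of ideal_J']
      by (cases "i = j") (auto simp: P_op_det_op intro!: left_ideal_mult[OF left_ideal_left_span])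
  qed (intro left_ideal_rmult left_ideal_left_span)
  with assms show ?thesis by auto
qed

lemma det_op_square: "det_op * det_op - 1 \<in> (rJ' :: ('n::{finite,linorder} \<times> 'n) ratweyl set)"
proof (rule det_op_in_g_ideal)
  show "g_op i j \<in> rJ'" for i j :: 'n
    using g_op_in_ideal_J'[of i j] ideal_J'_subset_rJ' by auto
qed (auto intro: left_idealD[OF left_ideal_left_span])

lemma rJ'_mult_1_plus_det_op: "x \<in> rJ' \<Longrightarrow> x * (1 + det_op) \<in> rJ'"
  unfolding distrib_left mult_1_right
  by (rule left_ideal_add[OF left_ideal_left_span _ rJ'_mult_det_op])

text \<open>RJ is the kernel of right multiplication by 1 + D on R/RJ'. One inclusion is (1 - D)(1 +
  D) = 1 - D^2 \<in> RJ'; the other comes from 2x = x(1 + D) + x(1 - D), where 1 - D is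
  \<open>d_op\<close>.\<close>

lemma rJ_iff:
  fixes x :: "('a::{finite,linorder} \<times> 'a) ratweyl"
  shows "x \<in> rJ \<longleftrightarrow> x * (1 + det_op) \<in> rJ'"
proof
  let ?I = "{x :: ('a \<times> 'a) ratweyl. x * (1 + det_op) \<in> rJ'}"
  have I: "left_ideal ?I"
    by (intro left_ideal_rmult left_ideal_left_span)
  have "d_op \<in> ?I"
    using left_ideal_uminus[OF left_ideal_left_span det_op_square]
    by (simp add: d_op_eq algebra_simps)
  then have "weyl_ideal {d_op} \<subseteq> ?I"
    using I by (intro left_span_subset_left_ideal) auto
  moreover have "ideal_J' \<subseteq> ?I"
    using ideal_J'_subset_rJ' rJ'_mult_1_plus_det_op by blast
  ultimately have "ideal_J \<subseteq> ?I"
    using left_ideal_add[OF I] by (auto simp: ideal_J_def)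
  then have "rJ \<subseteq> ?I"
    by (rule left_span_subset_left_ideal[OF I])
  then show "x \<in> rJ \<Longrightarrow> x * (1 + det_op) \<in> rJ'"
    by auto
next
  have I: "left_ideal (rJ :: ('a \<times> 'a) ratweyl set)" by auto
  have "ideal_J' \<subseteq> (ideal_J :: ('a \<times> 'a) ratweyl set)"
    by (force simp: ideal_J_def left_span_0)
  then have J': "rJ' \<subseteq> (rJ :: ('a \<times> 'a) ratweyl set)"
    by (intro left_span_subset_left_ideal I) (auto intro: left_span_base)
  have "d_op \<in> weyl_ideal {d_op :: ('a \<times> 'a) ratweyl}"
    by (rule left_span_base) auto
  then have "d_op \<in> (ideal_J :: ('a \<times> 'a) ratweyl set)"
    by (force simp: ideal_J_def ideal_J'_def left_span_0)
  then have d: "d_op \<in> (rJ :: ('a \<times> 'a) ratweyl set)"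
    by (auto intro: left_span_base)
  assume "x * (1 + det_op) \<in> rJ'"
  then have "x * (1 + det_op) + x * d_op \<in> rJ"
    using J' by (intro left_ideal_add[OF I _ left_ideal_mult[OF I d]]) (rule subsetD)
  then have "rcoef (1 / 2) * (x * (1 + det_op) + x * d_op) \<in> rJ"
    by (rule left_ideal_mult[OF I])
  also have "x * (1 + det_op) + x * d_op = rcoef 2 * x"
  proof -
    have "rcoef 2 = (1 + 1 :: ('a \<times> 'a) ratweyl)"
      by (metis rcoef_add rcoef_1 one_add_one)
    then show ?thesis
      by (simp only: d_op_eq distrib_left distrib_right right_diff_distrib mult_1_left mult_1_right) simp
  qed
  also have "rcoef (1 / 2) * (rcoef 2 * x) = x"
  proof -
    have "rcoef (1 / 2) * rcoef 2 = (1 :: ('a \<times> 'a) ratweyl)"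
      by (subst rcoef_mult[symmetric]) (simp add: ratfun_two_neq_0)
    then show ?thesis
      by (simp flip: mult.assoc)
  qed
  finally show "x \<in> rJ" .
qed

text \<open>\<open>undefined\<close> stands for one arbitrary but fixed row index; flipping a single
  row is what changes the sign of the determinant.\<close>

definition top_row :: "('n::{finite,linorder} \<times> 'n) set" where
  "top_row = {(undefined, k) |k. True}"

lemma top_row_iff: "(i, k) \<in> top_row \<longleftrightarrow> i = undefined"
  by (simp add: top_row_def)

abbreviation row_refl :: "('n::{finite,linorder} \<times> 'n) ratweyl \<Rightarrow> ('n \<times> 'n) ratweyl" where
  "row_refl \<equiv> refl_op top_row"

lemma row_refl_dvar:
  "row_refl (dvar (i, k)) = (if i = undefined then - 1 else 1) * dvar (i, k)"
  by (simp add: refl_op_dvar rcoef_refl_sign top_row_iff)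

lemma row_refl_xvar:
  "row_refl (xvar (i, k)) = (if i = undefined then - 1 else 1) * xvar (i, k)"
  by (simp add: refl_op_xvar rcoef_refl_sign top_row_iff)

lemmas row_refl_hom = refl_op_add refl_op_diff refl_op_uminus refl_op_mult refl_op_sum refl_op_1
  refl_op_0 refl_op_rcoef

lemma row_refl_g_op: "row_refl (g_op i j) = g_op i j \<or> row_refl (g_op i j) = - g_op i j"
  by (cases "i = undefined"; cases "j = undefined")
    (simp_all add: g_op_def row_refl_hom row_refl_dvar sum_negf)

lemma row_refl_P_op: "row_refl (P_op i j) = P_op i j \<or> row_refl (P_op i j) = - P_op i j"
proof -
  define s :: "('a \<times> 'a) ratweyl" where "s = (if (i = undefined) = (j = undefined) then 1 else - 1)"
  have "row_refl (xvar (i, k) * dvar (j, k) - xvar (j, k) * dvar (i, k)) =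
      s * (xvar (i, k) * dvar (j, k) - xvar (j, k) * dvar (i, k))" for k
    by (auto simp: s_def row_refl_hom row_refl_dvar row_refl_xvar)
  then have "row_refl (P_op i j) = s * P_op i j"
    unfolding P_op_def row_refl_hom(5) sum_distrib_left by simp
  then show ?thesis
    by (simp add: s_def split: if_splits)
qed

lemma row_refl_det_op: "row_refl det_op = - det_op"
proof -
  have "refl_poly top_row (det var_matrix) =
      det (\<chi> i. if i = undefined then - 1 *s var_matrix $ i else (var_matrix $ i :: ('a \<times> 'a) mpoly ^ 'a::{finite,linorder}))"
    unfolding ring_hom_det[OF ring_hom_refl_poly]
    by (intro arg_cong[of _ _ det]) (auto simp: vec_eq_iff var_matrix_def refl_poly_mvar refl_sign_def top_row_iff)
  also have "\<dots> = - det var_matrix"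
    unfolding det_row_mul by simp
  finally show ?thesis
    by (simp add: refl_op_poly_in_dvar poly_in_dvar_uminus)
qed

text \<open>The reflection is a ring homomorphism that maps each generator to itself or to its
  negative.\<close>

lemma row_refl_rJ':
  fixes x :: "('a::{finite,linorder} \<times> 'a) ratweyl"
  assumes "x \<in> rJ'" shows "row_refl x \<in> rJ'"
proof -
  have J': "left_ideal (rJ' :: ('a \<times> 'a) ratweyl set)" by auto
  have I: "left_ideal {x :: ('a \<times> 'a) ratweyl. row_refl x \<in> rJ'}"
    using left_idealD[OF J'] by (auto simp: left_ideal_def[of "Collect _"] row_refl_hom)
  have "rJ' \<subseteq> {x :: ('a \<times> 'a) ratweyl. row_refl x \<in> rJ'}"
  proof (rule rJ'_subset[OF I])
    show "g_op i j \<in> {x. row_refl x \<in> rJ'}" for i j :: 'a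
      using row_refl_g_op[of i j] g_op_in_ideal_J'[of i j] ideal_J'_subset_rJ'
      by (auto intro!: left_ideal_uminus[OF left_ideal_left_span])
    show "P_op i j \<in> {x. row_refl x \<in> rJ'}" for i j :: 'a
      using row_refl_P_op[of i j] P_op_in_ideal_J'[of i j] ideal_J'_subset_rJ'
      by (auto intro!: left_ideal_uminus[OF left_ideal_left_span])
  qed
  with assms show ?thesis by auto
qed

lemma half_mult: "rcoef (1 / 2) * (P + P) = P"
proof -
  have "rcoef (1 / 2) * (P + P) = (rcoef (1 / 2) + rcoef (1 / 2)) * P"
    by (simp only: distrib_left distrib_right)
  also have "rcoef (1 / 2) + rcoef (1 / 2) = (1 :: 'a ratweyl)"
    by (subst rcoef_add[symmetric]) (simp add: ratfun_two_neq_0 flip: mult_2)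
  finally show ?thesis by simp
qed

lemma indep_mod_mono: "I \<subseteq> I' \<Longrightarrow> indep_mod I' S f \<Longrightarrow> indep_mod I S f"
  unfolding indep_mod_def by blast

text \<open>First identity: up to multiples of D^2 - 1, right multiplication by 1 + D annihilates
  y(1 - D) and doubles x(1 + D). Second identity: 1 + D and 1 - D add up to 2.\<close>

lemma proj_identities:
  fixes x y D :: "'a::ring_1"
  shows "x * (1 + D) + y * (1 - D) + (x * (1 + D) + y * (1 - D)) * D - (x - y) * (D * D - 1) =
      x * (1 + D) + x * (1 + D)"
    and "(z - x) * (1 + D) + (z - y) * (1 - D) = (z + z) - (x * (1 + D) + y * (1 - D))"
  by (simp_all add: algebra_simps)

text \<open>Multiplying the relation by 1 + D and halving leaves (\<Sum> c_b f_b)(1 + D) \<in> RJ',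
  which by \<open>rJ_iff\<close> says \<Sum> c_b f_b \<in> RJ.\<close>

lemma indep_mod_pair:
  fixes f :: "'i \<Rightarrow> ('a::{finite,linorder} \<times> 'a) ratweyl"
  assumes ind: "indep_mod rJ B f"
    and sum: "(\<Sum>b\<in>B. rcoef (c b) * (f b * (1 + det_op))) +
      (\<Sum>b\<in>B. rcoef (c' b) * (row_refl (f b) * (1 - det_op))) \<in> rJ'"
  shows "\<forall>b\<in>B. c b = 0"
proof -
  have I: "left_ideal (rJ' :: ('a \<times> 'a) ratweyl set)" by auto
  let ?x = "\<Sum>b\<in>B. rcoef (c b) * f b" and ?y = "\<Sum>b\<in>B. rcoef (c' b) * row_refl (f b)"
  have "?x * (1 + det_op) + ?y * (1 - det_op) \<in> rJ'"
    using sum by (simp add: sum_distrib_right mult.assoc)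
  from left_ideal_add[OF I this rJ'_mult_det_op[OF this]]
  have "(?x * (1 + det_op) + ?y * (1 - det_op)) + (?x * (1 + det_op) + ?y * (1 - det_op)) * det_op \<in> rJ'"
    .
  from left_ideal_diff[OF I this left_ideal_mult[OF I det_op_square, of "?x - ?y"]]
  have "(?x * (1 + det_op) + ?y * (1 - det_op)) + (?x * (1 + det_op) + ?y * (1 - det_op)) * det_op
      - (?x - ?y) * (det_op * det_op - 1) \<in> rJ'"
    .
  also have "(?x * (1 + det_op) + ?y * (1 - det_op)) + (?x * (1 + det_op) + ?y * (1 - det_op)) * det_op
      - (?x - ?y) * (det_op * det_op - 1) = ?x * (1 + det_op) + ?x * (1 + det_op)"
    by (rule proj_identities)
  finally have "rcoef (1 / 2) * (?x * (1 + det_op) + ?x * (1 + det_op)) \<in> rJ'"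
    by (rule left_ideal_mult[OF I])
  then have "?x \<in> rJ"
    by (simp only: half_mult rJ_iff)
  then show ?thesis
    using ind unfolding indep_mod_def by blast
qed

theorem holonomic_rank_J':
  "holonomic_rank (ideal_J' :: ('n::{finite,linorder} \<times> 'n) ratweyl set) = 2 * holonomic_rank (ideal_J :: ('n \<times> 'n) ratweyl set)"
proof (rule holonomic_rank_cases[of "ideal_J :: ('n \<times> 'n) ratweyl set"])
  assume inf: "holonomic_rank (ideal_J :: ('n \<times> 'n) ratweyl set) = \<infinity>"
  \<comment> \<open>Independence modulo the larger RJ implies independence modulo RJ', so infinite
    rank is inherited.\<close>
  have "rJ' \<subseteq> (rJ :: ('n \<times> 'n) ratweyl set)"
    using rJ'_mult_1_plus_det_op rJ_iff by blast
  from indep_mod_mono[OF this]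
  have "holonomic_rank (ideal_J :: ('n \<times> 'n) ratweyl set) \<le> holonomic_rank (ideal_J' :: ('n \<times> 'n) ratweyl set)"
    by (intro holonomic_rank_leI card_indep_mod_le_rank)
  then have "holonomic_rank (ideal_J' :: ('n \<times> 'n) ratweyl set) = \<infinity>"
    unfolding inf by simp
  with inf show ?thesis
    by (simp add: imult_infinity_right)
next
  fix B :: "('n \<times> 'n) ratweyl set" assume fin: "finite B" and ind: "indep_mod rJ B (\<lambda>x. x)" and sp: "spans_mod rJ B (\<lambda>x. x)"
    and rank: "holonomic_rank (ideal_J :: ('n \<times> 'n) ratweyl set) = enat (card B)"
  have I: "left_ideal (rJ' :: ('n \<times> 'n) ratweyl set)" by auto
  \<comment> \<open>A basis B of R/RJ gives the elements b(1 + D) of one eigenspace; as the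
    reflection sends D to -D, the reflected b times 1 - D do the same for the other.\<close>
  define f :: "('n \<times> 'n) ratweyl + ('n \<times> 'n) ratweyl \<Rightarrow> _" where
    "f = case_sum (\<lambda>b. b * (1 + det_op)) (\<lambda>b. row_refl b * (1 - det_op))"
  have f: "(\<Sum>i\<in>B <+> B. rcoef (c i) * f i) = (\<Sum>b\<in>B. rcoef (c (Inl b)) * (b * (1 + det_op))) +
      (\<Sum>b\<in>B. rcoef (c (Inr b)) * (row_refl b * (1 - det_op)))" for c
    using fin by (simp add: sum.Plus f_def)
  have "indep_mod rJ' (B <+> B) f"
    unfolding indep_mod_def
  proof (intro allI impI)
    fix c assume "(\<Sum>i\<in>B <+> B. rcoef (c i) * f i) \<in> rJ'"
    note c = this[unfolded f]
    have 1: "\<forall>b\<in>B. c (Inl b) = 0"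
      using ind c by (rule indep_mod_pair)
    \<comment> \<open>The reflection interchanges the two families, so the coefficients of the
      second one are reached by the same projection.\<close>
    have "row_refl ((\<Sum>b\<in>B. rcoef (c (Inl b)) * (b * (1 + det_op))) +
      (\<Sum>b\<in>B. rcoef (c (Inr b)) * (row_refl b * (1 - det_op)))) \<in> rJ'"
      using c by (rule row_refl_rJ')
    then have "(\<Sum>b\<in>B. rcoef (refl_rat top_row (c (Inr b))) * (b * (1 + det_op))) +
      (\<Sum>b\<in>B. rcoef (refl_rat top_row (c (Inl b))) * (row_refl b * (1 - det_op))) \<in> rJ'"
      by (simp add: row_refl_hom row_refl_det_op refl_op_refl_op add.commute)
    then have "\<forall>b\<in>B. refl_rat top_row (c (Inr b)) = 0"
      by (rule indep_mod_pair[OF ind])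
    then have 2: "\<forall>b\<in>B. c (Inr b) = 0"
      by (simp add: rsubst_eq_0_iff[OF alg_indep_refl_vars])
    show "\<forall>i\<in>B <+> B. c i = 0"
      using 1 2 by auto
  qed
  moreover have "spans_mod rJ' (B <+> B) f"
    unfolding spans_mod_def
  proof
    fix x
    obtain c where c: "x - (\<Sum>b\<in>B. rcoef (c b) * b) \<in> rJ"
      using sp unfolding spans_mod_def by blast
    \<comment> \<open>It is \<open>row_refl x\<close> that is expanded: reflecting the outcome gives
      an expansion of x that holds after multiplication by 1 - D.\<close>
    obtain c' where c': "row_refl x - (\<Sum>b\<in>B. rcoef (c' b) * b) \<in> rJ"
      using sp unfolding spans_mod_def by blast
    define c'' where "c'' b = refl_rat top_row (c' b)" for b
    have "row_refl ((row_refl x - (\<Sum>b\<in>B. rcoef (c' b) * b)) * (1 + det_op)) \<in> rJ'"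
      using c' unfolding rJ_iff by (rule row_refl_rJ')
    then have 2: "(x - (\<Sum>b\<in>B. rcoef (c'' b) * row_refl b)) * (1 - det_op) \<in> rJ'"
      by (simp add: row_refl_hom row_refl_det_op refl_op_refl_op c''_def)
    define C where "C i = 1 / 2 * case_sum c c'' i" for i
    have "rcoef (1 / 2) * ((x - (\<Sum>b\<in>B. rcoef (c b) * b)) * (1 + det_op) +
        (x - (\<Sum>b\<in>B. rcoef (c'' b) * row_refl b)) * (1 - det_op)) \<in> rJ'"
      by (rule left_ideal_mult[OF I left_ideal_add[OF I c[unfolded rJ_iff] 2]])
    also have "(x - (\<Sum>b\<in>B. rcoef (c b) * b)) * (1 + det_op) +
        (x - (\<Sum>b\<in>B. rcoef (c'' b) * row_refl b)) * (1 - det_op) =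
        (x + x) - ((\<Sum>b\<in>B. rcoef (c b) * b) * (1 + det_op) + (\<Sum>b\<in>B. rcoef (c'' b) * row_refl b) * (1 - det_op))"
      by (rule proj_identities)
    also have "rcoef (1 / 2) * \<dots> = x - (\<Sum>i\<in>B <+> B. rcoef (C i) * f i)"
      unfolding right_diff_distrib[of "rcoef (1 / 2)"] half_mult f
      by (simp only: C_def sum.case rcoef_mult distrib_left[of "rcoef (1 / 2)"] sum_distrib_right
          sum_distrib_left mult.assoc)
    finally show "\<exists>c. x - (\<Sum>i\<in>B <+> B. rcoef (c i) * f i) \<in> rJ'"
      by blast
  qed
  ultimately have "holonomic_rank (ideal_J' :: ('n \<times> 'n) ratweyl set) = enat (card (B <+> B))"
    using fin by (intro holonomic_rank_eqI) auto
  then show ?thesis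
    using fin by (simp add: rank card_Plus mult_2 numeral_eq_enat)
qed

subsection \<open>Pullback of operators along a submersion\<close>

lemma lookup_mpderiv:
  "Poly_Mapping.lookup (mpderiv v p) m = of_nat (Suc (expo m v)) * Poly_Mapping.lookup p (m + unit_index v)"
proof (induction p rule: poly_mapping_add_induct)
  case (single k c)
  have *: "k - unit_index v = m \<and> expo k v \<noteq> 0 \<longleftrightarrow> k = m + unit_index v"
    by (auto simp: fun_eq_iff plus_mindex.rep_eq minus_mindex.rep_eq unit_index.rep_eq simp flip: expo_inject)
  have "expo (m + unit_index v) v = Suc (expo m v)"
    by (simp add: plus_mindex.rep_eq unit_index.rep_eq)
  then show ?case
    using * by (auto simp: mpderiv_single lookup_single when_def)
qed (simp_all add: mpderiv_add lookup_add distrib_left)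

definition tdeg :: "'v::finite mindex \<Rightarrow> nat" where
  "tdeg m = (\<Sum>v\<in>UNIV. expo m v)"

lemma tdeg_unit: "tdeg (m + unit_index v) = Suc (tdeg m)"
proof -
  have "(\<Sum>w\<in>UNIV. of_bool (w = v)) = (1 :: nat)"
    by (simp add: of_bool_def)
  then show ?thesis
    by (simp add: tdeg_def plus_mindex.rep_eq unit_index.rep_eq sum.distrib)
qed

lemma tdeg_eq_0: "tdeg m = 0 \<longleftrightarrow> m = 0"
  by (auto simp: tdeg_def zero_mindex.rep_eq fun_eq_iff simp flip: expo_inject)

lemma poly_map_add:
  assumes "f 0 = 0" "\<And>a b. f (a + b) = f a + f b"
  shows "Poly_Mapping.map f (p + q) = Poly_Mapping.map f p + Poly_Mapping.map f q"
  by (rule poly_mapping_eqI) (auto simp: lookup_add map.rep_eq when_def assms(1) simp flip: assms(2))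

section \<open>Vector fields as operators and as derivations of the rational functions\<close>

definition field_op :: "('v::finite \<Rightarrow> 'v ratfun) \<Rightarrow> 'v ratweyl" where
  "field_op z = (\<Sum>v\<in>UNIV. rcoef (z v) * dvar v)"

definition field_app :: "('v::finite \<Rightarrow> 'v ratfun) \<Rightarrow> 'v ratfun \<Rightarrow> 'v ratfun" where
  "field_app z r = (\<Sum>v\<in>UNIV. z v * rderiv v r)"

definition lie :: "('v::finite \<Rightarrow> 'v ratfun) \<Rightarrow> ('v \<Rightarrow> 'v ratfun) \<Rightarrow> 'v \<Rightarrow> 'v ratfun" where
  "lie z w v = field_app z (w v) - field_app w (z v)"

lemma field_op_mult:
  "field_op z * field_op w =
     (\<Sum>v\<in>UNIV. \<Sum>u\<in>UNIV. rcoef (z v * w u) * (dvar v * dvar u)) + field_op (\<lambda>u. field_app z (w u))"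
proof -
  have "rcoef (z v) * dvar v * (rcoef (w u) * dvar u) =
      rcoef (z v * w u) * (dvar v * dvar u) + rcoef (z v * rderiv v (w u)) * dvar u" for u v
  proof -
    have "rcoef (z v) * dvar v * (rcoef (w u) * dvar u) = rcoef (z v) * (dvar v * rcoef (w u)) * dvar u"
      by (simp only: mult.assoc)
    then show ?thesis
      by (simp only: dvar_rcoef distrib_left distrib_right mult.assoc rcoef_mult)
  qed
  then have "field_op z * field_op w = (\<Sum>v\<in>UNIV. \<Sum>u\<in>UNIV. rcoef (z v * w u) * (dvar v * dvar u)) +
      (\<Sum>v\<in>UNIV. \<Sum>u\<in>UNIV. rcoef (z v * rderiv v (w u)) * dvar u)"
    by (simp add: field_op_def sum_product sum.distrib)
  also have "(\<Sum>v\<in>UNIV. \<Sum>u\<in>UNIV. rcoef (z v * rderiv v (w u)) * dvar u) =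
      field_op (\<lambda>u. field_app z (w u))"
    unfolding field_op_def field_app_def rcoef_sum sum_distrib_right by (rule sum.swap)
  finally show ?thesis .
qed

text \<open>The second-order terms are symmetric in the two fields and cancel.\<close>

lemma field_op_commutator: "field_op z * field_op w - field_op w * field_op z = field_op (lie z w)"
proof -
  have "(\<Sum>v\<in>UNIV. \<Sum>u\<in>UNIV. rcoef (z v * w u) * (dvar v * dvar u)) =
      (\<Sum>v\<in>UNIV. \<Sum>u\<in>UNIV. rcoef (w v * z u) * (dvar v * dvar u))"
    by (subst sum.swap) (simp add: mult.commute dvar_commute)
  then show ?thesis
    by (simp add: field_op_mult) (simp add: field_op_def lie_def rcoef_diff left_diff_distrib sum_subtractf)
qed

lemma field_app_lie: "field_app (lie z w) r = field_app z (field_app w r) - field_app w (field_app z r)"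
proof -
  have fa: "field_app z (field_app w r) =
      (\<Sum>v\<in>UNIV. \<Sum>u\<in>UNIV. z v * w u * rderiv v (rderiv u r)) + (\<Sum>u\<in>UNIV. field_app z (w u) * rderiv u r)" for z w
  proof -
    have "field_app z (field_app w r) =
       (\<Sum>v\<in>UNIV. \<Sum>u\<in>UNIV. z v * w u * rderiv v (rderiv u r)) + (\<Sum>v\<in>UNIV. \<Sum>u\<in>UNIV. z v * rderiv v (w u) * rderiv u r)"
      by (simp add: field_app_def rderiv_sum rderiv_mult sum_distrib_left sum.distrib algebra_simps)
    also have "(\<Sum>v\<in>UNIV. \<Sum>u\<in>UNIV. z v * rderiv v (w u) * rderiv u r) = (\<Sum>u\<in>UNIV. field_app z (w u) * rderiv u r)"
      unfolding field_app_def sum_distrib_right by (rule sum.swap)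
    finally show ?thesis .
  qed
  have "(\<Sum>v\<in>UNIV. \<Sum>u\<in>UNIV. z v * w u * rderiv v (rderiv u r)) = (\<Sum>v\<in>UNIV. \<Sum>u\<in>UNIV. w v * z u * rderiv v (rderiv u r))"
    by (subst sum.swap) (simp add: mult.commute rderiv_commute)
  then show ?thesis
    unfolding fa by (simp add: field_app_def[of "lie z w"] lie_def left_diff_distrib sum_subtractf)
qed

lemma field_app_of_bool [simp]: "field_app z (of_bool b) = 0"
  by (cases b) (simp_all add: field_app_def)

lemma mixed_hom:
  assumes "\<And>v x. F v (h x) = h (G v x)"
  shows "mixed F m (h x) = h (mixed G m x)"
proof -
  have pow: "(F v ^^ k) (h x) = h ((G v ^^ k) x)" for v k x
    by (induction k) (simp_all add: assms)
  have "foldr (\<lambda>v. F v ^^ expo m v) vs (h x) = h (foldr (\<lambda>v. G v ^^ expo m v) vs x)" for vs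
    by (induction vs) (simp_all add: pow)
  then show ?thesis
    by (simp add: mixed_def)
qed

text \<open>Vector fields \<open>b\<close> dual to \<open>y\<close> exist if and only if the Jacobian of \<open>y\<close> has full rank.\<close>

locale submersion =
  fixes y :: "'w::finite \<Rightarrow> 'v::finite ratfun" and b :: "'w \<Rightarrow> 'v \<Rightarrow> 'v ratfun"
  assumes dual: "field_app (b u) (y w) = of_bool (u = w)"
begin

text \<open>Induction on a degree bound for a relation p(y) = 0: the derivation \<open>b u\<close>
  turns it into (\<partial>_u p)(y) = 0 of smaller degree, so all partial derivatives of p vanish.
  By characteristic 0, used with \<open>lookup_mpderiv\<close>, p is then constant and therefore
  0.\<close>

lemma alg_indep_y: "alg_indep y"
proof -
  have const: "p = 0" if "mpoly_eval rconst y p = 0" "\<And>m. Poly_Mapping.lookup p m \<noteq> 0 \<Longrightarrow> m = 0" for p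
  proof -
    have "p = Poly_Mapping.single 0 (Poly_Mapping.lookup p 0)"
      using that(2) by (intro poly_mapping_eqI) (force simp: lookup_single when_def)
    then obtain c where c: "p = Poly_Mapping.single 0 c" ..
    then have "rconst c = (0 :: 'v ratfun)"
      using that(1) by (simp add: mpoly_eval_const[OF ring_hom_rconst])
    then show "p = 0"
      unfolding c by (simp add: Zero_fract_def eq_fract) (metis lookup_single_eq lookup_zero single_zero)
  qed
  have "p = 0" if "mpoly_eval rconst y p = 0" "\<forall>m. Poly_Mapping.lookup p m \<noteq> 0 \<longrightarrow> tdeg m \<le> n" for p n
    using that
  proof (induction n arbitrary: p)
    case (Suc n)
    have "mpderiv u p = 0" for u
    proof (rule Suc.IH)
      have "(\<Sum>v\<in>UNIV. b u v * (\<Sum>w\<in>UNIV. mpoly_eval rconst y (mpderiv w p) * rderiv v (y w))) = 0"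
        using Suc.prems(1) by (simp flip: rderiv_mpoly_eval)
      also have "(\<Sum>v\<in>UNIV. b u v * (\<Sum>w\<in>UNIV. mpoly_eval rconst y (mpderiv w p) * rderiv v (y w))) =
          (\<Sum>w\<in>UNIV. mpoly_eval rconst y (mpderiv w p) * field_app (b u) (y w))"
        unfolding field_app_def sum_distrib_left by (subst sum.swap) (simp add: mult_ac)
      also have "\<dots> = (\<Sum>w\<in>UNIV. if w = u then mpoly_eval rconst y (mpderiv w p) else 0)"
        unfolding dual by (intro sum.cong) auto
      also have "\<dots> = mpoly_eval rconst y (mpderiv u p)"
        by simp
      finally show "mpoly_eval rconst y (mpderiv u p) = 0" .
      show "\<forall>m. Poly_Mapping.lookup (mpderiv u p) m \<noteq> 0 \<longrightarrow> tdeg m \<le> n"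
      proof (intro allI impI)
        fix m assume "Poly_Mapping.lookup (mpderiv u p) m \<noteq> 0"
        then have "Poly_Mapping.lookup p (m + unit_index u) \<noteq> 0"
          by (auto simp: lookup_mpderiv)
        with Suc.prems(2) have "tdeg (m + unit_index u) \<le> Suc n"
          by blast
        then show "tdeg m \<le> n"
          by (simp add: tdeg_unit)
      qed
    qed
    then have der: "Poly_Mapping.lookup p (m + unit_index u) = 0" for m u
      using lookup_mpderiv[of u p m] by (simp del: of_nat_Suc)
    have "Poly_Mapping.lookup p m \<noteq> 0 \<longrightarrow> m = 0" for m
      by (induction m rule: mindex_induct) (simp_all add: der)
    then show ?case
      using const[OF Suc.prems(1)] by blast
  next
    case 0
    then show ?case
      using const[OF 0(1)] tdeg_eq_0 by auto
  qed
  moreover have "\<exists>n. \<forall>m. Poly_Mapping.lookup p m \<noteq> 0 \<longrightarrow> tdeg m \<le> n" for p :: "'w mpoly"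
    by (rule exI[of _ "Max (tdeg ` Poly_Mapping.keys p)"]) (auto simp: in_keys_iff)
  ultimately show ?thesis
    unfolding alg_indep_def by blast
qed

lemmas ring_hom_y = ring_hom_rsubst[OF alg_indep_y]
lemmas rsubst_y_hom = ring_homD[OF ring_hom_y]

text \<open>
  An element \<open>n\<close> of the type below stands for an element of the transfer module
  $\bigoplus_m \mathbb{C}(x)\,\partial_y^m$. The commutative product of \<^type>\<open>poly_mapping\<close> merely helps
  to write down how $\partial_v$ acts on it.
\<close>

definition jac :: "'v \<Rightarrow> 'w mindex \<Rightarrow>\<^sub>0 'v ratfun" where
  "jac v = (\<Sum>w\<in>UNIV. Poly_Mapping.single (unit_index w) (rderiv v (y w)))"

text \<open>\<partial>_v differentiates the coefficient and acts on the rest as \<Sum>_w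
  (\<partial>y_w/\<partial>x_v) \<partial>_w, which on monomials is multiplication by
  \<open>jac v\<close>.\<close>

definition tstep :: "'v \<Rightarrow> ('w mindex \<Rightarrow>\<^sub>0 'v ratfun) \<Rightarrow> 'w mindex \<Rightarrow>\<^sub>0 'v ratfun" where
  "tstep v n = Poly_Mapping.map (rderiv v) n + n * jac v"

abbreviation sc :: "'v ratfun \<Rightarrow> ('w mindex \<Rightarrow>\<^sub>0 'v ratfun) \<Rightarrow> 'w mindex \<Rightarrow>\<^sub>0 'v ratfun" where
  "sc a n \<equiv> Poly_Mapping.single 0 a * n"

text \<open>The map Q \<mapsto> 1 \<otimes> Q in terms of normal forms.\<close>

definition pull :: "'w ratweyl \<Rightarrow> 'w mindex \<Rightarrow>\<^sub>0 'v ratfun" where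
  "pull Q = Poly_Mapping.map (rsubst y) (dcoeffs Q)"

lemma map_rderiv_add:
  "Poly_Mapping.map (rderiv v) (p + q) = Poly_Mapping.map (rderiv v) p + Poly_Mapping.map (rderiv v) q"
  by (rule poly_map_add) (simp_all add: rderiv_add)

lemma map_single0: "f 0 = 0 \<Longrightarrow> Poly_Mapping.map f (Poly_Mapping.single m a) = Poly_Mapping.single m (f a)"
  by (rule poly_mapping_eqI) (auto simp: map.rep_eq lookup_single when_def)

lemma map_zero0: "f 0 = 0 \<Longrightarrow> Poly_Mapping.map f 0 = 0"
  by (rule poly_mapping_eqI) (simp add: map.rep_eq)

lemma map_rderiv_mult:
  "Poly_Mapping.map (rderiv v) (p * q) = Poly_Mapping.map (rderiv v) p * q + p * Poly_Mapping.map (rderiv v) q"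
proof (induction p rule: poly_mapping_add_induct)
  case (single m a)
  show ?case
    by (induction q rule: poly_mapping_add_induct)
      (simp_all add: map_zero0 map_single0 mult_single rderiv_mult map_rderiv_add algebra_simps single_add)
qed (simp_all add: map_zero0 map_rderiv_add algebra_simps)

text \<open>Mixed second derivatives of y agree; this is what makes the operators
  \<open>tstep\<close> commute.\<close>

lemma map_rderiv_jac: "Poly_Mapping.map (rderiv v) (jac u) = Poly_Mapping.map (rderiv u) (jac v)"
proof -
  have "Poly_Mapping.map (rderiv v) (sum f A) = (\<Sum>x\<in>A. Poly_Mapping.map (rderiv v) (f x))"
    for v and f :: "'w \<Rightarrow> 'w mindex \<Rightarrow>\<^sub>0 'v ratfun" and A
    by (induction A rule: infinite_finite_induct) (simp_all add: map_zero0 map_rderiv_add)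
  then show ?thesis
    by (simp add: jac_def map_single0 rderiv_commute[of v u])
qed

lemma map_rderiv_commute:
  "Poly_Mapping.map (rderiv v) (Poly_Mapping.map (rderiv u) p) = Poly_Mapping.map (rderiv u) (Poly_Mapping.map (rderiv v) p)"
  by (induction p rule: poly_mapping_add_induct)
    (simp_all add: map_zero0 map_single0 map_rderiv_add rderiv_commute[of v u])

lemma tstep_commute: "tstep v (tstep u n) = tstep u (tstep v n)"
  by (simp add: tstep_def map_rderiv_add map_rderiv_mult map_rderiv_commute[of v u]
      map_rderiv_jac[of v u] algebra_simps)

lemmas mixed_tstep_unit = mixed_unit[of tstep, OF tstep_commute]

lemma tstep_add: "tstep v (p + q) = tstep v p + tstep v q"
  by (simp add: tstep_def map_rderiv_add distrib_right)

lemma tstep_0 [simp]: "tstep v 0 = 0"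
  by (simp add: tstep_def map_zero0)

lemma tstep_sc: "tstep v (sc a n) = sc (rderiv v a) n + sc a (tstep v n)"
  by (simp add: tstep_def map_rderiv_mult map_single0 algebra_simps)

lemma tstep_sum: "tstep v (sum f A) = (\<Sum>x\<in>A. tstep v (f x))"
  by (induction A rule: infinite_finite_induct) (simp_all add: tstep_add)

section \<open>The transfer module as a left module over R\<close>

definition act :: "'v ratweyl \<Rightarrow> ('w mindex \<Rightarrow>\<^sub>0 'v ratfun) \<Rightarrow> 'w mindex \<Rightarrow>\<^sub>0 'v ratfun" where
  "act P n = (\<Sum>m\<in>Poly_Mapping.keys (dcoeffs P). sc (Poly_Mapping.lookup (dcoeffs P) m) (mixed tstep m n))"

lemma act_add: "act (P + Q) n = act P n + act Q n"
  unfolding act_def plus_ratweyl.rep_eq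
  by (rule setsum_keys_plus_distrib) (simp_all add: single_add distrib_right)

lemma act_0 [simp]: "act 0 n = 0"
  by (simp add: act_def zero_ratweyl.rep_eq)

lemma act_sum: "act (sum f A) n = (\<Sum>x\<in>A. act (f x) n)"
  by (induction A rule: infinite_finite_induct) (simp_all add: act_add)

lemma act_uminus: "act (- P) n = - act P n"
  using act_add[of P "- P" n] by (simp add: eq_neg_iff_add_eq_0 add.commute)

lemma act_diff: "act (P - Q) n = act P n - act Q n"
  using act_add[of P "- Q" n] by (simp add: act_uminus)

lemma act_monom: "act (rcoef r * dmon m) n = sc r (mixed tstep m n)"
proof (cases "r = 0")
  case False
  then show ?thesis
    by (simp add: act_def rcoef_dmon DiffOp_inverse)
qed simp

lemma act_1 [simp]: "act 1 n = n"
  using act_monom[of 1 0 n] by simp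

lemma act_rcoef: "act (rcoef r * P) n = sc r (act P n)"
proof (induction P rule: ratweyl_monom_induct)
  case (monom s m)
  have "act (rcoef r * (rcoef s * dmon m)) n = act (rcoef (r * s) * dmon m) n"
    by (simp only: rcoef_mult mult.assoc)
  then show ?case
    by (simp add: act_monom mult_single flip: mult.assoc)
qed (simp_all add: distrib_left act_add)

lemma dvar_monom: "dvar v * (rcoef s * dmon m) = rcoef s * dmon (m + unit_index v) + rcoef (rderiv v s) * dmon m"
proof -
  have "dvar v * (rcoef s * dmon m) = dvar v * rcoef s * dmon m"
    by (simp only: mult.assoc)
  then show ?thesis
    by (simp only: dvar_rcoef distrib_right dmon_unit mult.assoc)
qed

lemma act_dvar: "act (dvar v * P) n = tstep v (act P n)"
  by (induction P rule: ratweyl_monom_induct)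
    (simp_all add: distrib_left act_add tstep_add dvar_monom act_monom mixed_tstep_unit tstep_sc)

lemma act_mult: "act (P * Q) n = act P (act Q n)"
  by (induction P rule: ratweyl_induct)
    (simp_all add: act_rcoef act_dvar act_add distrib_right mult.assoc)

lemma pull_add: "pull (P + Q) = pull P + pull Q"
  unfolding pull_def plus_ratweyl.rep_eq by (rule poly_map_add) (simp_all add: rsubst_y_hom)

lemma pull_0 [simp]: "pull 0 = 0"
  by (simp add: pull_def zero_ratweyl.rep_eq map_zero0 rsubst_y_hom)

lemma pull_uminus: "pull (- P) = - pull P"
  using pull_add[of P "- P"] by (simp add: eq_neg_iff_add_eq_0 add.commute)

lemma pull_diff: "pull (P - Q) = pull P - pull Q"
  using pull_add[of P "- Q"] by (simp add: pull_uminus)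

lemma pull_sum: "pull (sum f A) = (\<Sum>x\<in>A. pull (f x))"
  by (induction A rule: infinite_finite_induct) (simp_all add: pull_add)

lemma pull_monom: "pull (rcoef r * dmon m) = Poly_Mapping.single m (rsubst y r)"
  by (simp add: pull_def rcoef_dmon DiffOp_inverse map_single0 rsubst_y_hom)

lemma pull_1 [simp]: "pull 1 = 1"
  using pull_monom[of 1 0] by (simp add: rsubst_y_hom)

lemma pull_rcoef: "pull (rcoef r * P) = sc (rsubst y r) (pull P)"
proof (induction P rule: ratweyl_monom_induct)
  case (monom s m)
  have "pull (rcoef r * (rcoef s * dmon m)) = pull (rcoef (r * s) * dmon m)"
    by (simp only: rcoef_mult mult.assoc)
  then show ?case
    by (simp add: pull_monom mult_single rsubst_y_hom)
qed (simp_all add: distrib_left pull_add)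

text \<open>For a monomial with coefficient r, \<partial>_v also hits r(y); by the chain rule this
  supplies exactly the terms with \<partial>_w r that occur in \<partial>_w Q.\<close>

lemma tstep_pull: "tstep v (pull Q) = (\<Sum>w\<in>UNIV. sc (rderiv v (y w)) (pull (dvar w * Q)))"
proof (induction Q rule: ratweyl_monom_induct)
  case (monom r m)
  have "tstep v (pull (rcoef r * dmon m)) = Poly_Mapping.single m (rderiv v (rsubst y r)) +
      (\<Sum>w\<in>UNIV. Poly_Mapping.single (m + unit_index w) (rsubst y r * rderiv v (y w)))"
    by (simp add: pull_monom tstep_def map_single0 jac_def sum_distrib_left mult_single)
  also have "Poly_Mapping.single m (rderiv v (rsubst y r)) =
      (\<Sum>w\<in>UNIV. Poly_Mapping.single m (rsubst y (rderiv w r) * rderiv v (y w)))"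
  proof -
    have "Poly_Mapping.single m (sum f A) = (\<Sum>x\<in>A. Poly_Mapping.single m (f x))" for f :: "'w \<Rightarrow> 'v ratfun" and A
      by (induction A rule: infinite_finite_induct) (simp_all add: single_add)
    then show ?thesis
      by (simp add: rderiv_rsubst[OF alg_indep_y])
  qed
  finally show ?case
    by (simp add: dvar_monom pull_add pull_monom distrib_left mult_single ac_simps flip: sum.distrib)
qed (simp_all add: pull_add tstep_add distrib_left sum.distrib)

lemma act_field_op: "act (field_op z * P) n = (\<Sum>v\<in>UNIV. sc (z v) (tstep v (act P n)))"
  by (simp add: field_op_def sum_distrib_right mult.assoc act_sum act_rcoef act_dvar)

lemma act_field_op_pull:
  "act (field_op z) (pull Q) = (\<Sum>w\<in>UNIV. sc (field_app z (y w)) (pull (dvar w * Q)))"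
proof -
  have sum: "sc (sum f A) n = (\<Sum>x\<in>A. sc (f x) n)" for f :: "'v \<Rightarrow> 'v ratfun" and A n
    by (induction A rule: infinite_finite_induct) (simp_all add: single_add distrib_right)
  have "act (field_op z) (pull Q) = (\<Sum>v\<in>UNIV. sc (z v) (tstep v (pull Q)))"
    using act_field_op[of z 1] by simp
  also have "\<dots> = (\<Sum>v\<in>UNIV. \<Sum>w\<in>UNIV. sc (z v * rderiv v (y w)) (pull (dvar w * Q)))"
    by (simp add: tstep_pull sum_distrib_left mult_single flip: mult.assoc)
  also have "\<dots> = (\<Sum>w\<in>UNIV. sc (field_app z (y w)) (pull (dvar w * Q)))"
    unfolding field_app_def sum by (rule sum.swap)
  finally show ?thesis .
qed

section \<open>Horizontal lifts of the derivations along y, and the left ideal of vertical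
  fields\<close>

definition xi :: "'w \<Rightarrow> 'v ratweyl" where
  "xi u = field_op (b u)"

lemma act_xi_pull: "act (xi u) (pull Q) = pull (dvar u * Q)"
proof -
  have "act (xi u) (pull Q) = (\<Sum>w\<in>UNIV. if w = u then pull (dvar w * Q) else 0)"
    unfolding xi_def act_field_op_pull dual by (intro sum.cong) auto
  then show ?thesis by simp
qed

definition vertical :: "('v \<Rightarrow> 'v ratfun) \<Rightarrow> bool" where
  "vertical z \<longleftrightarrow> (\<forall>w. field_app z (y w) = 0)"

definition vert_ideal :: "'v ratweyl set" where
  "vert_ideal = left_span UNIV {field_op z |z. vertical z}"

lemma left_ideal_vert: "left_ideal vert_ideal"
  unfolding vert_ideal_def ..

lemma field_op_in_vert: "vertical z \<Longrightarrow> field_op z \<in> vert_ideal"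
  unfolding vert_ideal_def by (rule left_span_base) auto

text \<open>The bracket of two derivations with constant values on the y_w kills every y_w.\<close>

lemma vertical_lie_b: "vertical z \<Longrightarrow> vertical (lie z (b u))" "vertical (lie (b u) (b w))"
  by (auto simp: vertical_def field_app_lie dual) (simp add: field_app_def)

text \<open>Moving a vertical field past \<open>xi u\<close> produces their bracket, which is
  vertical again; hence this left ideal is stable under right multiplication by
  \<open>xi u\<close>.\<close>

lemma vert_mult_xi:
  assumes "x \<in> vert_ideal" shows "x * xi u \<in> vert_ideal"
proof -
  have I: "left_ideal {x. x * xi u \<in> vert_ideal}"
    by (intro left_ideal_rmult left_ideal_vert)
  have "field_op z * xi u \<in> vert_ideal" if "vertical z" for z
  proof -
    have "field_op z * xi u = xi u * field_op z + field_op (lie z (b u))"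
      unfolding xi_def by (simp flip: field_op_commutator)
    also have "\<dots> \<in> vert_ideal"
      using that vertical_lie_b(1)[OF that, of u]
      by (intro left_ideal_add[OF left_ideal_vert left_ideal_mult[OF left_ideal_vert]] field_op_in_vert)
    finally show ?thesis .
  qed
  then have "vert_ideal \<subseteq> {x. x * xi u \<in> vert_ideal}"
    unfolding vert_ideal_def[THEN eq_refl, THEN subset_antisym, symmetric]
    by (subst (1) vert_ideal_def, intro left_span_subset_left_ideal[OF I]) auto
  with assms show ?thesis by auto
qed

lemma xi_commute: "xi u * xi w - xi w * xi u \<in> vert_ideal"
  unfolding xi_def field_op_commutator by (intro field_op_in_vert vertical_lie_b)

text \<open>The factors come in the fixed order of \<open>var_list\<close>, as the
  \<open>xi u\<close> need not commute.\<close>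

definition xi_mon :: "'w mindex \<Rightarrow> 'v ratweyl" where
  "xi_mon m = mixed (\<lambda>u x. x * xi u) m 1"

lemma xi_mon_0 [simp]: "xi_mon 0 = 1"
  by (simp add: xi_mon_def)

text \<open>
  The \<open>xi u\<close> commute only modulo the vertical ideal, but right multiplication by them descends to
  genuinely commuting operators on (unions of) cosets.
\<close>

lemma xi_mon_unit_right: "xi_mon (m + unit_index u) - xi_mon m * xi u \<in> vert_ideal"
proof -
  note V = left_ideal_add[OF left_ideal_vert] left_ideal_diff[OF left_ideal_vert] left_ideal_mult[OF left_ideal_vert]
  define F where "F u X = {z. \<exists>x\<in>X. z - x * xi u \<in> vert_ideal}" for u and X :: "'v ratweyl set"
  define co where "co x = {z. z - x \<in> vert_ideal}" for x
  have FF: "F v (F w X) = {z. \<exists>x\<in>X. z - x * xi w * xi v \<in> vert_ideal}" for v w X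
  proof (intro equalityI subsetI)
    fix z assume "z \<in> F v (F w X)"
    then obtain x x' where "x \<in> X" and x: "x' - x * xi w \<in> vert_ideal" "z - x' * xi v \<in> vert_ideal"
      by (auto simp: F_def)
    have "z - x' * xi v + (x' - x * xi w) * xi v \<in> vert_ideal"
      using x by (intro V(1) vert_mult_xi)
    then show "z \<in> {z. \<exists>x\<in>X. z - x * xi w * xi v \<in> vert_ideal}"
      using \<open>x \<in> X\<close> by (auto simp: left_diff_distrib)
  next
    fix z assume "z \<in> {z. \<exists>x\<in>X. z - x * xi w * xi v \<in> vert_ideal}"
    then obtain x where x: "x \<in> X" "z - x * xi w * xi v \<in> vert_ideal"
      by auto
    moreover from x have "x * xi w \<in> F w X"
      unfolding F_def by (auto intro!: bexI[of _ x] simp: left_ideal_0[OF left_ideal_vert])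
    ultimately show "z \<in> F v (F w X)"
      unfolding F_def[of v] by auto
  qed
  have "F v (F w X) \<subseteq> F w (F v X)" for v w X
  proof
    fix z assume "z \<in> F v (F w X)"
    then obtain x where x: "x \<in> X" "z - x * xi w * xi v \<in> vert_ideal"
      unfolding FF by auto
    have "z - x * xi w * xi v + x * (xi w * xi v - xi v * xi w) \<in> vert_ideal"
      by (intro V(1) V(3) x xi_commute)
    then show "z \<in> F w (F v X)"
      unfolding FF using x(1) by (auto simp: right_diff_distrib mult.assoc)
  qed
  then have comm: "F v (F w X) = F w (F v X)" for v w X
    by blast
  have coF: "F u (co x) = co (x * xi u)" for u x
  proof (intro equalityI subsetI)
    fix z assume "z \<in> F u (co x)"
    then obtain x' where x: "x' - x \<in> vert_ideal" "z - x' * xi u \<in> vert_ideal"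
      by (auto simp: F_def co_def)
    have "z - x' * xi u + (x' - x) * xi u \<in> vert_ideal"
      using x by (intro V(1) vert_mult_xi)
    then show "z \<in> co (x * xi u)"
      by (simp add: co_def left_diff_distrib)
  next
    fix z assume "z \<in> co (x * xi u)"
    then show "z \<in> F u (co x)"
      unfolding F_def co_def using left_ideal_0[OF left_ideal_vert] by (auto intro!: exI[of _ x])
  qed
  \<comment> \<open>\<open>co\<close> carries right multiplication by \<open>xi u\<close> to
    \<open>F u\<close>; the operators \<open>F u\<close> commute, so the additional factor may be
    taken outermost.\<close>
  have "co (xi_mon (m + unit_index u)) = mixed F (m + unit_index u) (co 1)"
    unfolding xi_mon_def using coF by (rule mixed_hom[symmetric])
  also have "\<dots> = F u (mixed F m (co 1))"
    using comm by (rule mixed_unit)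
  also have "mixed F m (co 1) = co (xi_mon m)"
    unfolding xi_mon_def using coF by (rule mixed_hom)
  finally have "co (xi_mon (m + unit_index u)) = co (xi_mon m * xi u)"
    unfolding coF .
  moreover have "xi_mon (m + unit_index u) \<in> co (xi_mon (m + unit_index u))"
    by (simp add: co_def left_ideal_0[OF left_ideal_vert])
  ultimately show ?thesis
    by (auto simp: co_def)
qed

lemma vert_mult_xi_mon:
  assumes "x \<in> vert_ideal" shows "x * xi_mon m \<in> vert_ideal"
proof (induction m rule: mindex_induct)
  case (unit m u)
  have "x * (xi_mon (m + unit_index u) - xi_mon m * xi u) + x * xi_mon m * xi u \<in> vert_ideal"
    by (intro left_ideal_add[OF left_ideal_vert] left_ideal_mult[OF left_ideal_vert xi_mon_unit_right]
        vert_mult_xi unit)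
  then show ?case
    by (simp add: right_diff_distrib mult.assoc)
qed (use assms in simp)

text \<open>Induction on m by appending factors on the right; stability of the vertical ideal under
  right multiplication by \<open>xi w\<close> carries the hypothesis along.\<close>

lemma xi_mon_unit_left: "xi_mon (m + unit_index u) - xi u * xi_mon m \<in> vert_ideal"
proof (induction m rule: mindex_induct)
  case 0
  then show ?case
    using xi_mon_unit_right[of 0 u] by simp
next
  case (unit m w)
  have "(xi_mon (m + unit_index u + unit_index w) - xi_mon (m + unit_index u) * xi w)
      + (xi_mon (m + unit_index u) - xi u * xi_mon m) * xi w
      - xi u * (xi_mon (m + unit_index w) - xi_mon m * xi w) \<in> vert_ideal"
    by (intro left_ideal_diff[OF left_ideal_vert left_ideal_add[OF left_ideal_vert
            xi_mon_unit_right vert_mult_xi[OF unit]] left_ideal_mult[OF left_ideal_vert xi_mon_unit_right]])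
  also have "(xi_mon (m + unit_index u + unit_index w) - xi_mon (m + unit_index u) * xi w)
      + (xi_mon (m + unit_index u) - xi u * xi_mon m) * xi w
      - xi u * (xi_mon (m + unit_index w) - xi_mon m * xi w) =
      xi_mon (m + unit_index w + unit_index u) - xi u * xi_mon (m + unit_index w)"
    by (simp add: left_diff_distrib right_diff_distrib mult.assoc add_ac)
  finally show ?case .
qed

text \<open>The inverse of P \<mapsto> \<open>act P 1\<close> up to vertical operators:
  \<partial>_y^m is replaced by the product of the horizontal lifts.\<close>

definition lift :: "('w mindex \<Rightarrow>\<^sub>0 'v ratfun) \<Rightarrow> 'v ratweyl" where
  "lift n = (\<Sum>m\<in>Poly_Mapping.keys n. rcoef (Poly_Mapping.lookup n m) * xi_mon m)"

lemma lift_add: "lift (p + q) = lift p + lift q"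
  unfolding lift_def by (rule setsum_keys_plus_distrib) (simp_all add: rcoef_add distrib_right)

lemma lift_0 [simp]: "lift 0 = 0"
  by (simp add: lift_def)

lemma lift_single: "lift (Poly_Mapping.single m a) = rcoef a * xi_mon m"
  by (cases "a = 0") (simp_all add: lift_def)

lemma lift_sum: "lift (sum f A) = (\<Sum>x\<in>A. lift (f x))"
  by (induction A rule: infinite_finite_induct) (simp_all add: lift_add)

lemma lift_sc: "lift (sc a n) = rcoef a * lift n"
  by (induction n rule: poly_mapping_add_induct)
    (simp_all add: lift_add distrib_left mult_single lift_single)

text \<open>The horizontal part takes the same values on y as \<partial>_v, so the remaining field
  is vertical; this is \<open>vertical_decompose\<close>.\<close>

lemma dvar_decompose:
  "dvar v = (\<Sum>w\<in>UNIV. rcoef (rderiv v (y w)) * xi w) + field_op (\<lambda>u. of_bool (u = v) - (\<Sum>w\<in>UNIV. rderiv v (y w) * b w u))"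
proof -
  have d1: "field_op (\<lambda>u. of_bool (u = v)) = dvar v"
    by (simp add: field_op_def of_bool_def if_distrib[of rcoef] if_distrib[of "\<lambda>x. x * _"] cong: if_cong)
  have d2: "field_op (\<lambda>u. \<Sum>w\<in>UNIV. rderiv v (y w) * b w u) = (\<Sum>w\<in>UNIV. rcoef (rderiv v (y w)) * xi w)"
    unfolding field_op_def xi_def rcoef_sum sum_distrib_left sum_distrib_right rcoef_mult mult.assoc
    by (rule sum.swap)
  have d3: "field_op (\<lambda>u. f u - g u) = field_op f - field_op g" for f g
    by (simp add: field_op_def rcoef_diff left_diff_distrib sum_subtractf)
  show ?thesis
    unfolding d3 d1 d2 by simp
qed

lemma vertical_decompose: "vertical (\<lambda>u. of_bool (u = v) - (\<Sum>w\<in>UNIV. rderiv v (y w) * b w u))"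
  unfolding vertical_def
proof
  fix x
  have "(\<Sum>u\<in>UNIV. of_bool (u = v) * rderiv u (y x)) = rderiv v (y x)"
    by (simp add: of_bool_def if_distrib[of "\<lambda>x. x * _"] cong: if_cong)
  moreover have "(\<Sum>u\<in>UNIV. (\<Sum>w\<in>UNIV. rderiv v (y w) * b w u) * rderiv u (y x)) =
      (\<Sum>w\<in>UNIV. rderiv v (y w) * field_app (b w) (y x))"
    unfolding field_app_def sum_distrib_left sum_distrib_right mult.assoc by (rule sum.swap)
  moreover have "\<dots> = rderiv v (y x)"
    unfolding dual by (simp add: of_bool_def if_distrib[of "\<lambda>x. _ * x"] cong: if_cong)
  ultimately show "field_app (\<lambda>u. of_bool (u = v) - (\<Sum>w\<in>UNIV. rderiv v (y w) * b w u)) (y x) = 0"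
    by (simp add: field_app_def left_diff_distrib sum_subtractf)
qed

text \<open>The horizontal part of \<partial>_v reproduces the \<open>jac\<close> term of
  \<open>tstep\<close>; the vertical part is absorbed because right multiplication by
  \<open>xi_mon m\<close> preserves the vertical ideal.\<close>

lemma lift_tstep: "lift (tstep v n) - dvar v * lift n \<in> vert_ideal"
proof (induction n rule: poly_mapping_add_induct)
  case zero
  then show ?case by (simp add: left_ideal_0[OF left_ideal_vert])
next
  case (single m a)
  let ?z = "\<lambda>u. of_bool (u = v) - (\<Sum>w\<in>UNIV. rderiv v (y w) * b w u)"
  have "lift (tstep v (Poly_Mapping.single m a)) =
      rcoef (rderiv v a) * xi_mon m + (\<Sum>w\<in>UNIV. rcoef (a * rderiv v (y w)) * xi_mon (m + unit_index w))"
    by (simp add: tstep_def map_single0 jac_def sum_distrib_left mult_single lift_add lift_single lift_sum)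
  moreover have "dvar v * lift (Poly_Mapping.single m a) =
      rcoef (rderiv v a) * xi_mon m + rcoef a * (dvar v * xi_mon m)"
  proof -
    have "dvar v * lift (Poly_Mapping.single m a) = dvar v * rcoef a * xi_mon m"
      by (simp only: lift_single mult.assoc)
    then show ?thesis
      by (simp only: dvar_rcoef distrib_right mult.assoc add.commute)
  qed
  moreover have "dvar v * xi_mon m = (\<Sum>w\<in>UNIV. rcoef (rderiv v (y w)) * (xi w * xi_mon m)) + field_op ?z * xi_mon m"
    by (subst dvar_decompose) (simp only: distrib_right sum_distrib_right mult.assoc)
  ultimately have "lift (tstep v (Poly_Mapping.single m a)) - dvar v * lift (Poly_Mapping.single m a) =
      rcoef a * ((\<Sum>w\<in>UNIV. rcoef (rderiv v (y w)) * (xi_mon (m + unit_index w) - xi w * xi_mon m))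
        - field_op ?z * xi_mon m)"
    by (simp add: right_diff_distrib sum_subtractf sum_distrib_left distrib_left)
  also have "\<dots> \<in> vert_ideal"
    by (intro left_ideal_mult[OF left_ideal_vert left_ideal_diff[OF left_ideal_vert
            left_ideal_sum[OF left_ideal_vert left_ideal_mult[OF left_ideal_vert xi_mon_unit_left]]
            vert_mult_xi_mon[OF field_op_in_vert[OF vertical_decompose]]]])
  finally show ?case .
next
  case (add p q)
  from left_ideal_add[OF left_ideal_vert this] show ?case
    by (simp add: tstep_add lift_add distrib_left algebra_simps)
qed

text \<open>For n = 1 it says that \<open>act P 1\<close> determines P up to the vertical
  ideal.\<close>

lemma lift_act: "lift (act P n) - P * lift n \<in> vert_ideal"
proof (induction P rule: ratweyl_induct)
  case one
  then show ?case by (simp add: left_ideal_0[OF left_ideal_vert])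
next
  case (rcoef r P)
  from left_ideal_mult[OF left_ideal_vert this, of "rcoef r"] show ?case
    by (simp add: act_rcoef lift_sc right_diff_distrib mult.assoc)
next
  case (dvar v P)
  from left_ideal_add[OF left_ideal_vert lift_tstep[of v "act P n"] left_ideal_mult[OF left_ideal_vert this, of "dvar v"]]
  show ?case
    by (simp add: act_dvar right_diff_distrib mult.assoc)
next
  case (add P Q)
  from left_ideal_add[OF left_ideal_vert this] show ?case
    by (simp add: act_add lift_add distrib_right algebra_simps)
qed

text \<open>The transfer module is cyclic: the \<open>xi u\<close> act on \<open>pull\<close> as
  \<partial>_u and reach every monomial from 1.\<close>

lemma ex_act_1: "\<exists>P. act P 1 = n"
proof (induction n rule: poly_mapping_add_induct)
  case zero
  then show ?case using act_0 by blast
next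
  case (single m a)
  have "\<exists>P. act P 1 = pull (dmon m)"
  proof (induction m rule: mindex_induct)
    case 0
    then show ?case by (intro exI[of _ 1]) simp
  next
    case (unit m v)
    then obtain P where "act P 1 = pull (dmon m)" ..
    then have "act (xi v * P) 1 = pull (dmon (m + unit_index v))"
      by (simp add: act_mult act_xi_pull dmon_unit)
    then show ?case ..
  qed
  then obtain P where "act P 1 = pull (dmon m)" ..
  moreover have "pull (dmon m) = Poly_Mapping.single m 1"
    using pull_monom[of 1 m] by (simp add: rsubst_y_hom)
  ultimately have "act (rcoef a * P) 1 = Poly_Mapping.single m a"
    by (simp add: act_rcoef mult_single)
  then show ?case ..
next
  case (add p q)
  then show ?case using act_add by metis
qed

end

section \<open>Extension of scalars and comparison of ranks\<close>

context submersion
begin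

text \<open>The image of C(x) \<otimes> K in the transfer module.\<close>

inductive_set pull_mod :: "'w ratweyl set \<Rightarrow> ('w mindex \<Rightarrow>\<^sub>0 'v ratfun) set" for K where
  zero: "0 \<in> pull_mod K"
| base: "k \<in> K \<Longrightarrow> sc a (pull k) \<in> pull_mod K"
| add: "n \<in> pull_mod K \<Longrightarrow> n' \<in> pull_mod K \<Longrightarrow> n + n' \<in> pull_mod K"

lemma pull_mod_pull: "k \<in> K \<Longrightarrow> pull k \<in> pull_mod K"
  using pull_mod.base[of k K 1] by simp

lemma pull_mod_sc: "n \<in> pull_mod K \<Longrightarrow> sc a n \<in> pull_mod K"
proof (induction rule: pull_mod.induct)
  case (base k c)
  then show ?case
    using pull_mod.base[of k K "a * c"] by (simp add: mult_single flip: mult.assoc)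
qed (auto simp: distrib_left intro: pull_mod.intros)

lemma pull_mod_sum: "(\<And>i. i \<in> A \<Longrightarrow> f i \<in> pull_mod K) \<Longrightarrow> sum f A \<in> pull_mod K"
  by (induction A rule: infinite_finite_induct) (auto intro: pull_mod.intros)

lemma pull_mod_tstep:
  assumes K: "left_ideal K" and n: "n \<in> pull_mod K"
  shows "tstep v n \<in> pull_mod K"
  using n
proof (induction rule: pull_mod.induct)
  case (base k a)
  have "tstep v (sc a (pull k)) = sc (rderiv v a) (pull k) +
      (\<Sum>w\<in>UNIV. sc a (sc (rderiv v (y w)) (pull (dvar w * k))))"
    by (simp add: tstep_sc tstep_pull sum_distrib_left)
  also have "\<dots> \<in> pull_mod K"
    using base by (intro pull_mod.add pull_mod_sum pull_mod_sc pull_mod_pull left_ideal_mult[OF K])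
  finally show ?case .
qed (auto simp: tstep_add intro: pull_mod.intros)

lemma pull_mod_act:
  assumes K: "left_ideal K" and n: "n \<in> pull_mod K"
  shows "act P n \<in> pull_mod K"
  by (induction P rule: ratweyl_induct)
    (auto simp: act_rcoef act_dvar act_add n intro: pull_mod_sc pull_mod_tstep[OF K] pull_mod.add)

lemma left_ideal_act_pull_mod: "left_ideal K \<Longrightarrow> left_ideal {P. act P 1 \<in> pull_mod K}"
  by (simp add: left_ideal_def[of "Collect _"] act_add act_mult pull_mod.zero pull_mod.add pull_mod_act)

text \<open>The operators k with \<open>lift (pull k)\<close> \<in> I form a left ideal, since
  \<open>lift\<close> is R-linear modulo I and \<open>xi u\<close> acts on \<open>pull\<close> as
  \<partial>_u. It contains L because each generator is the image of an element of I.\<close>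

lemma lift_pull_mod:
  assumes I: "left_ideal I" "vert_ideal \<subseteq> I"
    and L: "\<And>h. h \<in> L \<Longrightarrow> \<exists>P\<in>I. act P 1 = pull h"
    and n: "n \<in> pull_mod (left_span UNIV L)"
  shows "lift n \<in> I"
proof -
  let ?T = "{k. lift (pull k) \<in> I}"
  have lift1: "lift 1 = 1"
    using lift_single[of 0 1] by simp
  have "a * k \<in> ?T" if k: "k \<in> ?T" for a k
  proof (induction a rule: ratweyl_induct)
    case (rcoef r a)
    then show ?case
      using left_ideal_mult[OF I(1)] by (simp add: pull_rcoef lift_sc mult.assoc)
  next
    case (dvar u a)
    have "lift (act (xi u) (pull (a * k))) - xi u * lift (pull (a * k)) \<in> I"
      using lift_act I(2) by blast
    then have "lift (act (xi u) (pull (a * k))) - xi u * lift (pull (a * k)) + xi u * lift (pull (a * k)) \<in> I"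
      using dvar by (rule_tac left_ideal_add[OF I(1) _ left_ideal_mult[OF I(1)]]) simp_all
    then show ?case
      by (simp add: act_xi_pull mult.assoc)
  qed (use k left_ideal_add[OF I(1)] in \<open>simp_all add: distrib_right pull_add lift_add\<close>)
  then have T: "left_ideal ?T"
    using left_ideal_0[OF I(1)] left_ideal_add[OF I(1)]
    by (auto simp: left_ideal_def[of ?T] pull_add lift_add)
  have "L \<subseteq> ?T"
  proof
    fix h assume "h \<in> L"
    then obtain P where P: "P \<in> I" "act P 1 = pull h"
      using L by blast
    have "lift (act P 1) - P * lift 1 \<in> I"
      using lift_act I(2) by blast
    from left_ideal_add[OF I(1) this P(1)] show "h \<in> ?T"
      by (simp add: lift1 P(2))
  qed
  then have K: "left_span UNIV L \<subseteq> ?T"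
    by (rule left_span_subset_left_ideal[OF T])
  from n show ?thesis
  proof (induction rule: pull_mod.induct)
    case (base k a)
    then show ?case
      using K by (auto simp: lift_sc intro: left_ideal_mult[OF I(1)])
  qed (auto simp: lift_add intro: left_idealD[OF I(1)])
qed

text \<open>C(x) is a vector space over the copy of C(y) inside it; a nonzero element extends to a
  basis and has a coordinate functional.\<close>

lemma ex_coordinate:
  assumes "a \<noteq> (0 :: 'v ratfun)"
  obtains l :: "'v ratfun \<Rightarrow> 'w ratfun"
  where "\<And>p q. l (p + q) = l p + l q" "\<And>c p. l (rsubst y c * p) = c * l p" "l a = 1"
proof -
  interpret p: vector_space_pair "\<lambda>c (x :: 'v ratfun). rsubst y c * x" "(*) :: 'w ratfun \<Rightarrow> _ \<Rightarrow> _"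
    by unfold_locales (simp_all add: rsubst_y_hom algebra_simps)
  have "p.vs1.independent {a}"
    using assms by simp
  from p.linear_independent_extend[OF this, of "\<lambda>_. 1"] obtain l
    where l: "Vector_Spaces.linear (\<lambda>c x. rsubst y c * x) (*) l" "l a = 1"
    by auto
  interpret Vector_Spaces.linear "\<lambda>c x. rsubst y c * x" "(*)" l
    by (rule l(1))
  show ?thesis
    using that[of l] l(2) add scale by blast
qed

text \<open>Applying l to the coefficients of a normal form is the map l \<otimes> id; by
  C(y)-linearity it sends a \<otimes> k to l(a) k, hence C(x) \<otimes> K into K.\<close>

lemma pull_mod_coordinate:
  assumes l: "\<And>p q. l (p + q) = l p + l q" "\<And>c p. l (rsubst y c * p) = c * l p"
    and K: "left_ideal K" and mem: "(\<Sum>i\<in>A. sc (c i) (pull (f i))) \<in> pull_mod K"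
  shows "(\<Sum>i\<in>A. rcoef (l (c i)) * f i) \<in> K"
proof -
  have l0: "l 0 = 0"
    using l(2)[of 0 0] by simp
  define L where "L n = DiffOp (Poly_Mapping.map l n)" for n :: "'w mindex \<Rightarrow>\<^sub>0 'v ratfun"
  have L_add: "L (p + q) = L p + L q" for p q
    by (simp add: L_def poly_map_add[OF l0 l(1)] DiffOp_add)
  have L0: "L 0 = 0"
    by (simp add: L_def map_zero0[of l, OF l0] zero_ratweyl_def)
  have L_sum: "L (sum g B) = (\<Sum>x\<in>B. L (g x))" for g :: "'x \<Rightarrow> _" and B
    by (induction B rule: infinite_finite_induct) (simp_all add: L_add L0)
  have L_pull: "L (sc a (pull k)) = rcoef (l a) * k" for a k
  proof (induction k rule: ratweyl_monom_induct)
    case (monom r m)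
    have pm: "sc a (pull (rcoef r * dmon m)) = Poly_Mapping.single m (rsubst y r * a)"
      by (simp add: pull_monom mult_single mult.commute)
    have "L (sc a (pull (rcoef r * dmon m))) = rcoef (l a * r) * dmon m"
      unfolding L_def pm map_single0[of l, OF l0] l(2) by (simp add: rcoef_dmon mult.commute)
    then show ?case by simp
  qed (simp_all add: pull_add distrib_left L_add)
  have "L n \<in> K" if "n \<in> pull_mod K" for n
    using that
    by induction (auto simp: L0 L_add L_pull intro: left_idealD[OF K])
  from this[OF mem] show ?thesis
    by (simp add: L_sum L_pull)
qed

text \<open>The hypotheses make RM the preimage of C(x) \<otimes> K under P \<mapsto>
  \<open>act P 1\<close>, where K is the rational ideal of L. As this map is onto, R/RM is C(x)
  \<otimes> (R_y/K), and preimages of a basis of R_y/K form a basis.\<close>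

theorem holonomic_rank_pullback:
  assumes vert: "vert_ideal \<subseteq> left_span UNIV M"
    and L: "\<And>h. h \<in> L \<Longrightarrow> \<exists>P\<in>left_span UNIV M. act P 1 = pull h"
    and M: "\<And>P. P \<in> M \<Longrightarrow> act P 1 \<in> pull_mod (left_span UNIV L)"
  shows "holonomic_rank M = holonomic_rank L"
proof -
  let ?I = "left_span UNIV M" and ?K = "left_span UNIV L"
  have I: "left_ideal ?I" and K: "left_ideal ?K" by auto
  have "?I \<subseteq> {P. act P 1 \<in> pull_mod ?K}"
    using M by (intro left_span_subset_left_ideal left_ideal_act_pull_mod K) auto
  moreover have "P \<in> ?I" if "act P 1 \<in> pull_mod ?K" for P
  proof -
    have "lift (act P 1) \<in> ?I"
      using I vert L that by (rule lift_pull_mod)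
    moreover have "lift (act P 1) - P * lift 1 \<in> ?I"
      using lift_act vert by blast
    ultimately have "lift (act P 1) - (lift (act P 1) - P * lift 1) \<in> ?I"
      by (rule left_ideal_diff[OF I])
    then show ?thesis
      using lift_single[of 0 1] by simp
  qed
  ultimately have I_iff: "P \<in> ?I \<longleftrightarrow> act P 1 \<in> pull_mod ?K" for P
    by auto
  obtain R where R: "\<And>n. act (R n) 1 = n"
    using ex_act_1 by metis
  have act_sum_R: "act (\<Sum>k\<in>B. rcoef (c k) * R (pull k)) 1 = (\<Sum>k\<in>B. sc (c k) (pull k))" for B c
    by (simp add: act_sum act_rcoef R)
  have indep: "indep_mod ?I B (\<lambda>k. R (pull k))" if "indep_mod ?K B (\<lambda>k. k)" for B
    unfolding indep_mod_def
  proof (intro allI impI ballI, rule ccontr)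
    fix c k
    assume c: "(\<Sum>k\<in>B. rcoef (c k) * R (pull k)) \<in> ?I" and k: "k \<in> B" "c k \<noteq> 0"
    \<comment> \<open>A nontrivial relation over C(x) becomes a nontrivial one over C(y) under a
      functional that is 1 on a nonzero coefficient.\<close>
    obtain l :: "'v ratfun \<Rightarrow> 'w ratfun"
      where l: "\<And>p q. l (p + q) = l p + l q" "\<And>c p. l (rsubst y c * p) = c * l p" "l (c k) = 1"
      using ex_coordinate[OF k(2)] by blast
    have "(\<Sum>k\<in>B. sc (c k) (pull k)) \<in> pull_mod ?K"
      using c unfolding I_iff act_sum_R .
    with l(1,2) K have "(\<Sum>k\<in>B. rcoef (l (c k)) * k) \<in> ?K"
      by (rule pull_mod_coordinate)
    then have "l (c k) = 0"
      using spec[OF that[unfolded indep_mod_def], of "\<lambda>k. l (c k)"] k(1) by simp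
    with l(3) show False by simp
  qed
  show ?thesis
  proof (rule holonomic_rank_cases[of L])
    assume inf: "holonomic_rank L = \<infinity>"
    have "holonomic_rank L \<le> holonomic_rank M"
      by (rule holonomic_rank_leI) (rule card_indep_mod_le_rank[OF _ indep])
    then show ?thesis
      by (simp add: inf)
  next
    fix B assume fin: "finite B" and ind: "indep_mod ?K B (\<lambda>x. x)" and sp: "spans_mod ?K B (\<lambda>x. x)"
      and rank: "holonomic_rank L = enat (card B)"
    \<comment> \<open>Each monomial \<partial>_y^m is expanded over C(y) and the expansion
      multiplied by a coefficient from C(x).\<close>
    have "\<exists>c. n - (\<Sum>k\<in>B. sc (c k) (pull k)) \<in> pull_mod ?K" for n
    proof (induction n rule: poly_mapping_add_induct)
      case zero
      then show ?case
        by (intro exI[of _ "\<lambda>_. 0"]) (simp add: pull_mod.zero)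
    next
      case (single m a)
      obtain c where c: "dmon m - (\<Sum>k\<in>B. rcoef (c k) * k) \<in> ?K"
        using sp unfolding spans_mod_def by blast
      have "pull (dmon m) = Poly_Mapping.single m 1"
        using pull_monom[of 1 m] by (simp add: rsubst_y_hom)
      then have "sc a (pull (dmon m - (\<Sum>k\<in>B. rcoef (c k) * k))) =
          Poly_Mapping.single m a - (\<Sum>k\<in>B. sc (a * rsubst y (c k)) (pull k))"
        by (simp add: pull_diff pull_sum pull_rcoef right_diff_distrib sum_distrib_left mult_single flip: mult.assoc)
      moreover have "sc a (pull (dmon m - (\<Sum>k\<in>B. rcoef (c k) * k))) \<in> pull_mod ?K"
        using c by (rule pull_mod.base)
      ultimately show ?case
        by (intro exI[of _ "\<lambda>k. a * rsubst y (c k)"]) simp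
    next
      case (add p q)
      then obtain c d where "p - (\<Sum>k\<in>B. sc (c k) (pull k)) \<in> pull_mod ?K"
        "q - (\<Sum>k\<in>B. sc (d k) (pull k)) \<in> pull_mod ?K"
        by blast
      then have "p - (\<Sum>k\<in>B. sc (c k) (pull k)) + (q - (\<Sum>k\<in>B. sc (d k) (pull k))) \<in> pull_mod ?K"
        by (rule pull_mod.add)
      also have "p - (\<Sum>k\<in>B. sc (c k) (pull k)) + (q - (\<Sum>k\<in>B. sc (d k) (pull k))) =
          p + q - (\<Sum>k\<in>B. sc (c k + d k) (pull k))"
        by (simp add: single_add distrib_right sum.distrib)
      finally show ?case
        by (rule_tac x = "\<lambda>k. c k + d k" in exI)
    qed
    then have "spans_mod ?I B (\<lambda>k. R (pull k))"
      unfolding spans_mod_def I_iff act_diff act_sum_R by blast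
    then have "holonomic_rank M = enat (card B)"
      using fin indep[OF ind] by (intro holonomic_rank_eqI)
    with rank show ?thesis by simp
  qed
qed

end

subsection \<open>The Gram matrix as a submersion\<close>

definition tvar :: "'n::finite \<Rightarrow> 'n \<Rightarrow> ('n \<times> 'n) ratfun" where
  "tvar i j = Fract (mvar (i, j)) 1"

definition tmat :: "('n::finite \<times> 'n) ratfun ^ 'n ^ 'n" where
  "tmat = (\<chi> i j. tvar i j)"

definition gram_rat :: "'n::{finite,linorder} uprod \<Rightarrow> ('n \<times> 'n) ratfun" where
  "gram_rat u = (transpose tmat ** tmat) $ Min (set_uprod u) $ Max (set_uprod u)"

lemma Upair_swap: "Upair i j = Upair j i"
  by simp

lemma gram_rat_Upair: "gram_rat (Upair i j) = (\<Sum>k\<in>UNIV. tvar k i * tvar k j)"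
  by (auto simp: gram_rat_def matrix_matrix_mult_def transpose_def min_def max_def mult.commute tmat_def)

lemma rderiv_tvar: "rderiv (i, j) (tvar k l) = of_bool (i = k \<and> j = l)"
  by (auto simp: tvar_def rderiv_mvar)

lemma rderiv_gram_rat:
  "rderiv (i, j) (gram_rat (Upair p q)) = of_bool (j = p) * tvar i q + of_bool (j = q) * tvar i p"
proof -
  have "rderiv (i, j) (gram_rat (Upair p q)) =
      (\<Sum>k\<in>UNIV. (if k = i then of_bool (j = p) * tvar k q + of_bool (j = q) * tvar k p else 0))"
    unfolding gram_rat_Upair rderiv_sum by (intro sum.cong) (auto simp: rderiv_mult rderiv_tvar)
  then show ?thesis
    by simp
qed

lemma field_app_pairs:
  "field_app z r = (\<Sum>i\<in>UNIV. \<Sum>j\<in>UNIV. z (i, j) * rderiv (i, j) r)"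
  by (simp add: field_app_def sum.cartesian_product)

lemma field_app_gram_rat:
  "field_app z (gram_rat (Upair p q)) = (\<Sum>i\<in>UNIV. z (i, p) * tvar i q + z (i, q) * tvar i p)"
proof -
  have "field_app z (gram_rat (Upair p q)) =
      (\<Sum>i\<in>UNIV. \<Sum>j\<in>UNIV. (if j = p then z (i, j) * tvar i q else 0) + (if j = q then z (i, j) * tvar i p else 0))"
    unfolding field_app_pairs by (intro sum.cong refl) (auto simp: rderiv_gram_rat distrib_left)
  then show ?thesis
    by (simp add: sum.distrib)
qed

text \<open>The unordered pairs containing j correspond to their other member l, with l = j for the
  pair on the diagonal.\<close>

lemma sum_uprod:
  fixes g :: "'n::finite uprod \<Rightarrow> 'a::comm_monoid_add"
  assumes "\<And>u. j \<notin> set_uprod u \<Longrightarrow> g u = 0"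
  shows "(\<Sum>u\<in>UNIV. g u) = (\<Sum>l\<in>UNIV. g (Upair j l))"
proof -
  have "inj (Upair j)"
    by (auto intro: injI)
  have "(\<Sum>u\<in>UNIV. g u) = (\<Sum>u\<in>range (Upair j). g u)"
  proof (intro sum.mono_neutral_right ballI)
    fix u assume "u \<in> UNIV - range (Upair j)"
    then have "j \<notin> set_uprod u"
    proof (cases u)
      case (Upair a b)
      with \<open>u \<in> _\<close> show ?thesis
        by (auto simp: image_iff)
    qed
    then show "g u = 0" by (rule assms)
  qed auto
  also have "\<dots> = (\<Sum>l\<in>UNIV. g (Upair j l))"
    using \<open>inj (Upair j)\<close> by (simp add: sum.reindex)
  finally show ?thesis .
qed

text \<open>Evaluated at the identity matrix, the generic determinant is 1.\<close>

lemma det_tmat_nonzero: "det (tmat :: ('n::finite \<times> 'n) ratfun ^ 'n ^ 'n) \<noteq> 0"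
proof -
  have id: "ring_hom (\<lambda>c :: complex. c)"
    by (simp add: ring_hom_def)
  have "mpoly_eval (\<lambda>c. c) (\<lambda>(i, j). of_bool (i = j)) (det (var_matrix :: ('n \<times> 'n) mpoly ^ 'n ^ 'n)) = det (mat 1 :: complex ^ 'n ^ 'n)"
    unfolding ring_hom_det[OF ring_hom_mpoly_eval[OF id]]
    by (intro arg_cong[of _ _ det]) (simp add: vec_eq_iff var_matrix_def mpoly_eval_mvar[OF id] mat_def)
  then have "det (var_matrix :: ('n \<times> 'n) mpoly ^ 'n ^ 'n) \<noteq> 0"
    by auto
  moreover have "det (tmat :: ('n \<times> 'n) ratfun ^ 'n ^ 'n) = Fract (det var_matrix) 1"
    by (subst ring_hom_det[OF ring_hom_Fract1]) (simp add: tmat_def tvar_def var_matrix_def)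
  ultimately show ?thesis
    by (simp add: Zero_fract_def eq_fract)
qed

definition tinv :: "('n::finite \<times> 'n) ratfun ^ 'n ^ 'n" where
  "tinv = matrix_inv tmat"

lemma tinv_tmat: "tinv ** tmat = mat 1" "tmat ** tinv = mat 1"
proof -
  have "invertible (tmat :: ('n \<times> 'n) ratfun ^ 'n ^ 'n)"
    unfolding invertible_det_nz by (rule det_tmat_nonzero)
  then show "tinv ** tmat = (mat 1 :: ('n \<times> 'n) ratfun ^ 'n ^ 'n)" "tmat ** tinv = (mat 1 :: ('n \<times> 'n) ratfun ^ 'n ^ 'n)"
    unfolding tinv_def matrix_inv_def invertible_def by (metis (mono_tags, lifting) someI_ex)+
qed

text \<open>The derivation dual to $y_u$ moves $\Theta$ by $\frac12\Theta^{-\mathrm t}E_u$ with the symmetric matrix unit $E_u$.\<close>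

definition gram_dual :: "'n::finite uprod \<Rightarrow> 'n \<times> 'n \<Rightarrow> ('n \<times> 'n) ratfun" where
  "gram_dual u = (\<lambda>(i, j). 1 / 2 * (\<Sum>a\<in>UNIV. tinv $ a $ i * of_bool (Upair a j = u)))"

lemma gram_dual: "field_app (gram_dual u) (gram_rat w) = of_bool (u = w)"
proof (cases w)
  case (Upair p q)
  \<comment> \<open>Each of the two terms in the derivative of y_pq contributes one half, also on
    the diagonal; this is the origin of the constant in \<open>gram_dual\<close>.\<close>
  have half: "(\<Sum>i\<in>UNIV. gram_dual u (i, p) * tvar i q) = 1 / 2 * of_bool (Upair p q = u)" for p q
  proof -
    have "(\<Sum>i\<in>UNIV. gram_dual u (i, p) * tvar i q) =
        1 / 2 * (\<Sum>a\<in>UNIV. of_bool (Upair a p = u) * (tinv ** tmat) $ a $ q)"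
      unfolding gram_dual_def matrix_matrix_mult_def sum_distrib_left sum_distrib_right prod.case vec_lambda_beta
      by (subst sum.swap) (simp add: tmat_def mult_ac)
    also have "(\<Sum>a\<in>UNIV. of_bool (Upair a p = u) * (tinv ** tmat) $ a $ q) = of_bool (Upair q p = u)"
      unfolding tinv_tmat by (simp add: mat_def if_distrib[of "\<lambda>x. _ * x"] cong: if_cong)
    finally show ?thesis
      by (simp add: Upair_swap[of q p] del: of_bool_eq_iff)
  qed
  show ?thesis
    unfolding Upair field_app_gram_rat sum.distrib half
    by (simp add: Upair_swap[of q p] eq_commute[of u] ratfun_two_neq_0 flip: mult_2)
qed

interpretation gram: submersion gram_rat gram_dual
  by unfold_locales (rule gram_dual)

text \<open>This is (1 + \<delta>_ij) \<partial>_ij, for which the chain rule along y = \<Theta>^t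
  \<Theta> has the same form for all indices, although t_ij enters y_jj quadratically. It absorbs
  the powers of 2 in \<open>h_op\<close>.\<close>

definition sym_dvar :: "'n::finite \<Rightarrow> 'n \<Rightarrow> 'n uprod ratweyl" where
  "sym_dvar i j = (if i = j then dvar (Upair i j) + dvar (Upair i j) else dvar (Upair i j))"

lemma sym_dvar_commute: "sym_dvar i j = sym_dvar j i"
  unfolding sym_dvar_def Upair_swap[of i j] by auto

lemma sym_dvar_mult_commute: "sym_dvar i j * sym_dvar k l = sym_dvar k l * sym_dvar i j"
  by (simp add: sym_dvar_def distrib_left distrib_right dvar_commute)

lemma tstep_gram: "gram.tstep (i, j) (gram.pull Q) = (\<Sum>l\<in>UNIV. gram.sc (tvar i l) (gram.pull (sym_dvar j l * Q)))"
proof -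
  have "gram.tstep (i, j) (gram.pull Q) =
      (\<Sum>l\<in>UNIV. gram.sc (rderiv (i, j) (gram_rat (Upair j l))) (gram.pull (dvar (Upair j l) * Q)))"
    unfolding gram.tstep_pull
  proof (rule sum_uprod)
    fix u assume "j \<notin> set_uprod u"
    then have "rderiv (i, j) (gram_rat u) = 0"
      by (cases u) (auto simp: rderiv_gram_rat)
    then show "gram.sc (rderiv (i, j) (gram_rat u)) (gram.pull (dvar u * Q)) = 0"
      by simp
  qed
  also have "\<dots> = (\<Sum>l\<in>UNIV. gram.sc (tvar i l) (gram.pull (sym_dvar j l * Q)))"
  proof (intro sum.cong refl)
    fix l
    show "gram.sc (rderiv (i, j) (gram_rat (Upair j l))) (gram.pull (dvar (Upair j l) * Q)) =
        gram.sc (tvar i l) (gram.pull (sym_dvar j l * Q))"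
    proof (cases "j = l")
      case True
      have "gram.sc (t + t) X = gram.sc t (X + X)" for t X
        by (simp only: single_add distrib_left distrib_right)
      moreover have "rderiv (i, j) (gram_rat (Upair j l)) = tvar i l + tvar i l"
        using True by (simp add: rderiv_gram_rat)
      moreover have "sym_dvar j l * Q = dvar (Upair j l) * Q + dvar (Upair j l) * Q"
        using True by (simp add: sym_dvar_def distrib_right)
      ultimately show ?thesis
        by (simp only: gram.pull_add)
    qed (simp add: rderiv_gram_rat sym_dvar_def)
  qed
  finally show ?thesis .
qed

text \<open>The double sum is symmetric under exchange of i and j because \<open>sym_dvar\<close> is
  symmetric in its indices.\<close>

lemma act_P_op: "gram.act (P_op i j) 1 = 0"
proof -
  have *: "gram.act (xvar (i, k) * dvar (j, k)) 1 = (\<Sum>l\<in>UNIV. gram.sc (tvar i k * tvar j l) (gram.pull (sym_dvar k l)))" for i j k :: 'a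
  proof -
    have "gram.act (xvar (i, k) * dvar (j, k)) 1 = gram.sc (tvar i k) (gram.tstep (j, k) (gram.pull 1))"
      unfolding xvar_def gram.act_rcoef tvar_def
      using gram.act_dvar[of "(j, k)" 1] by simp
    then show ?thesis
      by (simp add: tstep_gram sum_distrib_left mult_single del: gram.pull_1 flip: mult.assoc)
  qed
  have "(\<Sum>k\<in>UNIV. \<Sum>l\<in>UNIV. gram.sc (tvar i k * tvar j l) (gram.pull (sym_dvar k l))) =
      (\<Sum>k\<in>UNIV. \<Sum>l\<in>UNIV. gram.sc (tvar j k * tvar i l) (gram.pull (sym_dvar k l)))"
    by (subst sum.swap) (simp add: mult.commute sym_dvar_commute)
  then show ?thesis
    by (simp add: P_op_def gram.act_sum gram.act_diff sum_subtractf *)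
qed

lemma h_op_eq:
  "h_op i j = of_nat CARD('n) * sym_dvar i j - of_bool (i = j) +
    (\<Sum>k\<in>UNIV. \<Sum>l\<in>UNIV. xvar (Upair k l) * (sym_dvar i k * sym_dvar j l))"
  for i j :: "'n::{finite,linorder}"
proof -
  have "2 ^ (of_bool (k = i) + of_bool (l = j)) * xvar (Upair k l) * dvar (Upair i k) * dvar (Upair j l) =
      xvar (Upair k l) * (sym_dvar i k * sym_dvar j l)" for k l :: 'n
  proof -
    have four: "4 * y = y + y + (y + y)" for y :: "'n uprod ratweyl"
    proof -
      have "(4 :: 'n uprod ratweyl) = 1 + 1 + (1 + 1)"
        by simp
      then show ?thesis
        by (simp only: distrib_right mult_1_left)
    qed
    show ?thesis
      by (cases "k = i"; cases "l = j")
        (simp_all add: sym_dvar_def distrib_left distrib_right mult.assoc four mult_2)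
  qed
  moreover have "2 ^ of_bool (i = j) * of_nat CARD('n) * dvar (Upair i j) = of_nat CARD('n) * sym_dvar i j"
    by (cases "i = j") (simp_all add: sym_dvar_def mult_2 distrib_left distrib_right)
  ultimately show ?thesis
    unfolding h_op_def by simp
qed

lemma h_op_commute:
  fixes i j :: "'a::{finite,linorder}"
  shows "h_op i j = h_op j i"
proof -
  have "(\<Sum>k\<in>UNIV. \<Sum>l\<in>UNIV. xvar (Upair k l) * (sym_dvar i k * sym_dvar j l)) =
      (\<Sum>k\<in>UNIV. \<Sum>l\<in>UNIV. xvar (Upair k l) * (sym_dvar j k * sym_dvar i l))"
  proof (subst sum.swap, intro sum.cong refl)
    fix k l :: 'a
    have "Upair l k = Upair k l"
      by simp
    then show "xvar (Upair l k) * (sym_dvar i l * sym_dvar j k) = xvar (Upair k l) * (sym_dvar j k * sym_dvar i l)"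
      by (simp only: sym_dvar_mult_commute)
  qed
  then show ?thesis
    unfolding h_op_eq by (simp add: sym_dvar_commute[of j i] eq_commute[of j i])
qed

text \<open>\<partial>_ki either hits a coefficient t_kl produced by \<partial>_kj, which requires l
  = i and gives \<open>sym_dvar i j\<close> once for each k, whence the factor n in
  \<open>h_op\<close>; or it acts on the rest, and summing t_kl t_km over k gives y_lm.\<close>

lemma act_g'_op:
  fixes i j :: "'a::{finite,linorder}"
  shows "gram.act (g'_op i j) 1 = - gram.pull (h_op i j)"
proof -
  have *: "gram.act (dvar (k, i) * dvar (k, j)) 1 = gram.pull (sym_dvar i j) +
      (\<Sum>l\<in>UNIV. \<Sum>m\<in>UNIV. gram.sc (tvar k l * tvar k m) (gram.pull (sym_dvar i m * sym_dvar j l)))" for k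
  proof -
    have "gram.act (dvar (k, i) * dvar (k, j)) 1 = gram.tstep (k, i) (gram.tstep (k, j) (gram.pull 1))"
      using gram.act_dvar[of "(k, i)" "dvar (k, j)" 1] gram.act_dvar[of "(k, j)" 1 1] by simp
    also have "\<dots> = (\<Sum>l\<in>UNIV. gram.sc (of_bool (l = i)) (gram.pull (sym_dvar j l))) +
       (\<Sum>l\<in>UNIV. gram.sc (tvar k l) (gram.tstep (k, i) (gram.pull (sym_dvar j l))))"
      by (simp add: tstep_gram[of k j] gram.tstep_sum gram.tstep_sc rderiv_tvar eq_commute[of i] sum.distrib del: gram.pull_1)
    also have "(\<Sum>l\<in>UNIV. gram.sc (of_bool (l = i)) (gram.pull (sym_dvar j l))) =
       (\<Sum>l\<in>UNIV. if l = i then gram.pull (sym_dvar j l) else 0)"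
      by (intro sum.cong) auto
    also have "\<dots> = gram.pull (sym_dvar i j)"
      by (simp add: sym_dvar_commute)
    finally show ?thesis
      by (simp add: tstep_gram sum_distrib_left mult_single flip: mult.assoc)
  qed
  have "(\<Sum>k\<in>UNIV. \<Sum>l\<in>UNIV. \<Sum>m\<in>UNIV. gram.sc (tvar k l * tvar k m) (gram.pull (sym_dvar i m * sym_dvar j l))) =
      (\<Sum>m\<in>UNIV. \<Sum>l\<in>UNIV. \<Sum>k\<in>UNIV. gram.sc (tvar k l * tvar k m) (gram.pull (sym_dvar i m * sym_dvar j l)))"
    by (subst sum.swap, subst (2) sum.swap, subst sum.swap) simp
  also have "\<dots> = (\<Sum>m\<in>UNIV. \<Sum>l\<in>UNIV. gram.pull (xvar (Upair m l) * (sym_dvar i m * sym_dvar j l)))"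
  proof (intro sum.cong refl)
    fix m l :: 'a
    have sum: "gram.sc (sum f A) n = (\<Sum>x\<in>A. gram.sc (f x) n)" for f :: "'a \<Rightarrow> ('a \<times> 'a) ratfun" and A n
      by (induction A rule: infinite_finite_induct) (simp_all add: single_add distrib_right)
    have "rsubst gram_rat (Fract (mvar (Upair m l)) 1) = gram_rat (Upair m l)"
      by (simp add: rsubst_poly[OF gram.alg_indep_y] mpoly_eval_mvar[OF ring_hom_rconst])
    then show "(\<Sum>k\<in>UNIV. gram.sc (tvar k l * tvar k m) (gram.pull (sym_dvar i m * sym_dvar j l))) =
        gram.pull (xvar (Upair m l) * (sym_dvar i m * sym_dvar j l))"
      unfolding sum[symmetric] xvar_def gram.pull_rcoef by (simp add: gram_rat_Upair mult.commute)
  qed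
  finally have sum: "(\<Sum>k\<in>UNIV. gram.act (dvar (k, i) * dvar (k, j)) 1) = of_nat CARD('a) * gram.pull (sym_dvar i j) + \<dots>"
    by (simp add: * sum.distrib)
  have nat: "gram.pull (of_nat n * Q) = of_nat n * gram.pull Q" for n and Q :: "'a uprod ratweyl"
    by (induction n) (simp_all add: distrib_right gram.pull_add)
  have "gram.pull (of_bool (i = j)) = of_bool (i = j)"
    by simp
  moreover have "gram.act (of_bool (i = j)) 1 = of_bool (i = j)"
    by simp
  ultimately show ?thesis
    unfolding g'_op_def h_op_eq gram.act_diff gram.act_sum gram.pull_add gram.pull_diff gram.pull_sum sum nat
    by simp
qed

text \<open>B = Z T^(-1); multiplying the condition by T^(-t) on the left and T^(-1) on the right
  says that B is antisymmetric. Geometrically, tangent vectors to the fibres of T \<mapsto> T^t T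
  are infinitesimal rotations. Used over the rational functions and at single points.\<close>

lemma antisymmetric_factor:
  fixes Z T S :: "'a::field ^ 'n ^ 'n"
  assumes inv: "S ** T = mat 1" "T ** S = mat 1" and Z: "transpose Z ** T = - (transpose T ** Z)"
  obtains B :: "'a ^ 'n ^ 'n" where "Z = B ** T" "transpose B = - B"
proof
  let ?B = "Z ** S"
  show "Z = ?B ** T"
    by (simp add: inv flip: matrix_mul_assoc)
  have e1: "transpose S ** (transpose Z ** T) ** S = transpose S ** (- (transpose T ** Z)) ** S"
    by (simp add: Z)
  have e2: "transpose S ** (transpose Z ** T) ** S = transpose ?B"
    by (simp add: matrix_transpose_mul inv flip: matrix_mul_assoc)
  have e3: "transpose S ** (- (transpose T ** Z)) ** S = - ?B"
  proof -
    have neg: "X ** (- Y) = - (X ** Y)" "(- X) ** Y = - (X ** Y)" for X Y :: "'a ^ 'n ^ 'n"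
      by (simp_all add: vec_eq_iff matrix_matrix_mult_def sum_negf)
    have "transpose S ** transpose T = mat 1"
      by (simp add: inv flip: matrix_transpose_mul)
    then show ?thesis
      by (simp add: neg matrix_mul_assoc)
  qed
  show "transpose ?B = - ?B"
    using e1 unfolding e2 e3 .
qed

text \<open>As a matrix, a vertical field satisfies Z^t \<Theta> + \<Theta>^t Z = 0, hence Z = B
  \<Theta> with B antisymmetric; antisymmetrising in i and k gives 2z = \<Sum> B_ik P_ki.\<close>

lemma vertical_in_P_ideal:
  fixes z :: "'a::{finite,linorder} \<times> 'a \<Rightarrow> _"
  assumes z: "gram.vertical z"
  shows "field_op z \<in> left_span UNIV {P_op i j |i j. True}"
proof -
  let ?I = "left_span UNIV {P_op i j |i j :: 'a. True}"
  have I: "left_ideal ?I" by auto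
  define Z where "Z = (\<chi> i j. z (i, j))"
  have "transpose Z ** tmat = - (transpose tmat ** Z)"
  proof -
    have "(\<Sum>i\<in>UNIV. z (i, p) * tvar i q) + (\<Sum>i\<in>UNIV. tvar i p * z (i, q)) = 0" for p q
      using z unfolding gram.vertical_def
      by (auto dest!: spec[of _ "Upair p q"] simp: field_app_gram_rat sum.distrib mult.commute)
    then show ?thesis
      by (simp add: vec_eq_iff matrix_matrix_mult_def transpose_def Z_def tmat_def eq_neg_iff_add_eq_0)
  qed
  then obtain B where Z: "Z = B ** tmat" and anti: "transpose B = - B"
    using antisymmetric_factor[OF tinv_tmat] by blast
  have anti: "B $ k $ i = - (B $ i $ k)" for i k
    using arg_cong[OF anti, of "\<lambda>M. M $ i $ k"] by (simp add: transpose_def)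
  define R where "R k i = (\<Sum>j\<in>(UNIV :: 'a set). xvar (k, j) * dvar (i, j))" for k i :: 'a
  have P: "P_op k i = R k i - R i k" for k i
    by (simp add: P_op_def R_def sum_subtractf)
  let ?s = "\<Sum>i\<in>UNIV. \<Sum>k\<in>UNIV. rcoef (B $ i $ k) * R k i"
  have "field_op z = (\<Sum>i\<in>UNIV. \<Sum>j\<in>UNIV. rcoef (Z $ i $ j) * dvar (i, j))"
    by (simp add: field_op_def Z_def sum.cartesian_product)
  also have "\<dots> = (\<Sum>i\<in>UNIV. \<Sum>j\<in>UNIV. \<Sum>k\<in>UNIV. rcoef (B $ i $ k) * (xvar (k, j) * dvar (i, j)))"
    by (simp add: Z matrix_matrix_mult_def tmat_def tvar_def rcoef_sum sum_distrib_right xvar_def)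
  also have "\<dots> = ?s"
    unfolding R_def sum_distrib_left by (intro sum.cong refl sum.swap)
  finally have z_eq: "field_op z = ?s" .
  have "?s = (\<Sum>i\<in>UNIV. \<Sum>k\<in>UNIV. rcoef (B $ k $ i) * R i k)"
    by (rule sum.swap)
  also have "\<dots> = - (\<Sum>i\<in>UNIV. \<Sum>k\<in>UNIV. rcoef (B $ i $ k) * R i k)"
    by (subst anti) (simp add: rcoef_uminus sum_negf)
  finally have "?s + ?s = (\<Sum>i\<in>UNIV. \<Sum>k\<in>UNIV. rcoef (B $ i $ k) * P_op k i)"
    by (simp add: P right_diff_distrib sum_subtractf)
  also have "\<dots> \<in> ?I"
  proof (intro left_ideal_sum[OF I] left_ideal_mult[OF I])
    show "P_op k i \<in> ?I" for k i
      by (rule left_span_base) auto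
  qed
  finally have "rcoef (1 / 2) * (?s + ?s) \<in> ?I"
    by (rule left_ideal_mult[OF I])
  then show ?thesis
    unfolding half_mult z_eq .
qed

text \<open>\<open>P_op\<close> acts as 0 and \<open>g'_op\<close> as the negative of
  \<open>h_op\<close>. For \<open>g_op\<close> the matrix argument is applied to the left ideal of
  all P with \<open>act P 1\<close> in the extended K, which contains every
  \<open>g'_op\<close>.\<close>

theorem holonomic_rank_K:
  "holonomic_rank (ideal_K :: 'n::{finite,linorder} uprod ratweyl set) = holonomic_rank (ideal_J' :: ('n \<times> 'n) ratweyl set)"
proof -
  let ?L = "{h_op i j |i j :: 'n. i \<le> j}"
  let ?M = "{g_op i j |i j :: 'n. i \<le> j} \<union> {P_op i j |i j. i < j}"
  have K: "left_ideal (left_span UNIV ?L)" by auto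
  have rK: "left_span UNIV (ideal_K :: 'n uprod ratweyl set) = left_span UNIV ?L"
    unfolding ideal_K_def by (rule left_span_left_span) simp
  have J': "left_ideal (rJ' :: ('n \<times> 'n) ratweyl set)" by auto
  have mem: "P \<in> rJ'" if "P \<in> ideal_J'" for P :: "('n \<times> 'n) ratweyl"
    using ideal_J'_subset_rJ' that by blast
  have h: "h_op i j \<in> left_span UNIV ?L" for i j
  proof (rule left_span_base)
    show "h_op i j \<in> ?L"
    proof (cases i j rule: le_cases)
      case ge
      then show ?thesis
        using h_op_commute[of i j] by auto
    qed auto
  qed simp
  have g': "gram.act (g'_op i j) 1 \<in> gram.pull_mod (left_span UNIV ?L)" for i j
  proof -
    have "Poly_Mapping.single 0 (- 1) = (- 1 :: 'n uprod mindex \<Rightarrow>\<^sub>0 ('n \<times> 'n) ratfun)"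
      by (simp add: single_uminus)
    then show ?thesis
      using gram.pull_mod_sc[OF gram.pull_mod_pull[OF h[of i j]], of "- 1"] by (simp add: act_g'_op)
  qed
  have g: "gram.act (g_op i j) 1 \<in> gram.pull_mod (left_span UNIV ?L)" for i j
  proof -
    note I = left_idealD[OF gram.left_ideal_act_pull_mod[OF K]]
    have "g_op i j \<in> {P. gram.act P 1 \<in> gram.pull_mod (left_span UNIV ?L)}"
      by (rule g_op_in_g'_ideal) (use I g' in simp_all)
    then show ?thesis by simp
  qed
  have "holonomic_rank ?M = holonomic_rank ?L"
  proof (rule gram.holonomic_rank_pullback)
    have "left_span UNIV {P_op i j |i j :: 'n. True} \<subseteq> rJ'"
      using P_op_in_ideal_J' mem by (intro left_span_subset_left_ideal[OF J']) blast
    then show "gram.vert_ideal \<subseteq> left_span UNIV ?M"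
      unfolding gram.vert_ideal_def rJ'_eq[symmetric]
      using vertical_in_P_ideal by (intro left_span_subset_left_ideal[OF J']) blast
  next
    fix h assume "h \<in> ?L"
    then obtain i j where "h = h_op i j" by auto
    moreover have "g'_op i j \<in> rJ'"
      by (rule g'_op_in_g_ideal)
        (use mem g_op_in_ideal_J' left_idealD[OF J'] in blast)+
    ultimately show "\<exists>P\<in>left_span UNIV ?M. gram.act P 1 = gram.pull h"
      unfolding rJ'_eq[symmetric] using left_ideal_uminus[OF J']
      by (intro bexI[of _ "- g'_op i j"]) (auto simp: gram.act_uminus act_g'_op)
  next
    fix P assume "P \<in> ?M"
    then show "gram.act P 1 \<in> gram.pull_mod (left_span UNIV ?L)"
      using g by (auto simp: act_P_op gram.pull_mod.zero)
  qed
  then show ?thesis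
    unfolding holonomic_rank_def rK rJ'_eq by (rule sym)
qed

subsection \<open>Holomorphic functions of several variables\<close>

lemma bounded_linear_axis: "bounded_linear (axis v :: complex \<Rightarrow> complex ^ 'v::finite)"
  unfolding linear_conv_bounded_linear[symmetric]
  by (rule linearI) (auto simp: vec_eq_iff axis_def)

lemma sum_axis_nth: "(\<Sum>i\<in>UNIV. axis i (x $ i)) = (x :: 'a::comm_monoid_add ^ 'v::finite)"
  by (simp add: vec_eq_iff sum_component axis_def if_distrib[of "\<lambda>x. _"] cong: if_cong)

lemma norm_axis_complex: "norm (axis v z :: complex ^ 'v::finite) = norm z"
  by (simp add: norm_vec_def L2_set_def axis_def if_distrib[of "\<lambda>x. (norm x)\<^sup>2"] cong: if_cong)

lemma has_derivative_vecI:
  fixes f :: "'a::real_normed_vector \<Rightarrow> complex ^ 'v::finite"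
  assumes "\<And>i. ((\<lambda>x. f x $ i) has_derivative (\<lambda>h. f' h $ i)) F"
  shows "(f has_derivative f') F"
proof -
  have "((\<lambda>x. \<Sum>i\<in>UNIV. axis i (f x $ i)) has_derivative (\<lambda>h. \<Sum>i\<in>UNIV. axis i (f' h $ i))) F"
    by (intro has_derivative_sum bounded_linear.has_derivative[OF bounded_linear_axis] assms)
  then show ?thesis
    by (simp add: sum_axis_nth)
qed

lemma has_derivative_vec_nth [derivative_intros]:
  fixes f :: "'a::real_normed_vector \<Rightarrow> complex ^ 'v::finite"
  shows "(f has_derivative f') F \<Longrightarrow> ((\<lambda>x. f x $ i) has_derivative (\<lambda>h. f' h $ i)) F"
  by (rule bounded_linear.has_derivative[OF bounded_linear_vec_nth])

lemma cpderiv_eq: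
  assumes "(f has_derivative (\<lambda>h. \<Sum>v\<in>UNIV. a $ v * h $ v)) (at x)"
  shows "cpderiv v f x = a $ v" and "((\<lambda>z. f (x + axis v z)) has_field_derivative a $ v) (at 0)"
proof -
  have 1: "((\<lambda>z. x + axis v z) has_derivative axis v) (at 0)"
    by (auto intro!: derivative_eq_intros bounded_linear_imp_has_derivative bounded_linear_axis)
  have 2: "(f has_derivative (\<lambda>h. \<Sum>v\<in>UNIV. a $ v * h $ v)) (at (x + axis v 0))"
    using assms by (simp add: axis_def vec_eq_iff[symmetric] zero_vec_def[symmetric])
  have "((\<lambda>z. f (x + axis v z)) has_derivative (\<lambda>z. \<Sum>w\<in>UNIV. a $ w * axis v z $ w)) (at 0)"
    using has_derivative_compose[OF 1 2] by simp
  also have "(\<lambda>z. \<Sum>w\<in>UNIV. a $ w * axis v z $ w) = (\<lambda>z. a $ v * z)"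
    by (auto simp: axis_def if_distrib[of "\<lambda>x. _ * x"] cong: if_cong)
  finally show *: "((\<lambda>z. f (x + axis v z)) has_field_derivative a $ v) (at 0)"
    by (simp add: has_field_derivative_def)
  then show "cpderiv v f x = a $ v"
    unfolding cpderiv_def by (rule DERIV_imp_deriv)
qed

lemma mv_holomorphic_has_derivative:
  assumes "mv_holomorphic_on f U" "x \<in> U"
  shows "(f has_derivative (\<lambda>h. \<Sum>v\<in>UNIV. cpderiv v f x * h $ v)) (at x)"
proof -
  obtain a where a: "(f has_derivative (\<lambda>h. \<Sum>v\<in>UNIV. a $ v * h $ v)) (at x)"
    using assms unfolding mv_holomorphic_on_def by blast
  then show ?thesis
    using cpderiv_eq(1)[OF a] by simp
qed

lemma mv_holomorphic_onI:
  assumes "\<And>x. x \<in> U \<Longrightarrow> (f has_derivative (\<lambda>h. \<Sum>v\<in>UNIV. a x v * h $ v)) (at x)"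
  shows "mv_holomorphic_on f U"
  unfolding mv_holomorphic_on_def
proof
  fix x assume "x \<in> U"
  from assms[OF this] show "\<exists>a. (f has_derivative (\<lambda>h. \<Sum>v\<in>UNIV. a $ v * h $ v)) (at x)"
    by (intro exI[of _ "\<chi> v. a x v"]) simp
qed

lemma cpderiv_eqI:
  assumes "(f has_derivative (\<lambda>h. \<Sum>v\<in>UNIV. a v * h $ v)) (at x)"
  shows "cpderiv v f x = a v"
  using cpderiv_eq(1)[of f "\<chi> v. a v" x v] assms by simp

lemma mv_holomorphic_subset: "mv_holomorphic_on f U \<Longrightarrow> V \<subseteq> U \<Longrightarrow> mv_holomorphic_on f V"
  unfolding mv_holomorphic_on_def by blast

lemma mv_holomorphic_continuous: "mv_holomorphic_on f U \<Longrightarrow> continuous_on U f"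
  by (meson continuous_at_imp_continuous_on has_derivative_continuous mv_holomorphic_has_derivative)

lemma cpderiv_cong:
  assumes "open U" "x \<in> U" "\<And>x. x \<in> U \<Longrightarrow> f x = g x"
  shows "cpderiv v f x = cpderiv v g x"
  unfolding cpderiv_def
proof (rule deriv_cong_ev)
  have "open ((\<lambda>z. x + axis v z) -` U)"
    by (intro open_vimage assms continuous_intros bounded_linear.continuous_on[OF bounded_linear_axis])
  moreover have "x + axis v 0 \<in> U"
    using assms(2) by (simp add: axis_def zero_vec_def[symmetric])
  ultimately have "eventually (\<lambda>z. x + axis v z \<in> U) (nhds 0)"
    unfolding eventually_nhds by (intro exI[of _ "(\<lambda>z. x + axis v z) -` U"]) auto
  then show "\<forall>\<^sub>F z in nhds 0. f (x + axis v z) = g (x + axis v z)"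
    by eventually_elim (rule assms(3))
qed simp

lemma mv_holomorphic_cong:
  assumes "open U" "\<And>x. x \<in> U \<Longrightarrow> f x = g x" "mv_holomorphic_on f U"
  shows "mv_holomorphic_on g U"
  unfolding mv_holomorphic_on_def
proof
  fix x assume "x \<in> U"
  with assms(3) obtain a where "(f has_derivative (\<lambda>h. \<Sum>v\<in>UNIV. a $ v * h $ v)) (at x)"
    unfolding mv_holomorphic_on_def by blast
  then have "(g has_derivative (\<lambda>h. \<Sum>v\<in>UNIV. a $ v * h $ v)) (at x)"
    by (rule has_derivative_transform_within_open[OF _ assms(1) \<open>x \<in> U\<close> assms(2)])
  then show "\<exists>a. (g has_derivative (\<lambda>h. \<Sum>v\<in>UNIV. a $ v * h $ v)) (at x)" ..
qed

text \<open>Cauchy's formula in the single coordinate v. Written as an integral over a fixed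
  interval, it can be differentiated in the parameter x.\<close>

lemma cpderiv_Cauchy:
  assumes hol: "mv_holomorphic_on f U" and r: "0 < r" and sub: "\<And>z. norm z \<le> r \<Longrightarrow> x + axis v z \<in> U"
  shows "cpderiv v f x = integral {0..1} (\<lambda>t. f (x + axis v (of_real r * exp (2 * of_real pi * \<i> * of_real t))) /
    (of_real r * exp (2 * of_real pi * \<i> * of_real t)))"
proof -
  define g where "g z = f (x + axis v z)" for z
  have der: "(g has_field_derivative cpderiv v f (x + axis v z)) (at z)" if "norm z \<le> r" for z
  proof -
    have "((\<lambda>w. f (x + axis v z + axis v w)) has_field_derivative cpderiv v f (x + axis v z)) (at 0)"
      using cpderiv_eq(2)[of f "\<chi> u. cpderiv u f (x + axis v z)" "x + axis v z" v]
        mv_holomorphic_has_derivative[OF hol sub[OF that]] by simp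
    moreover have "axis v z + axis v w = axis v (z + w)" for w
      by (simp add: vec_eq_iff axis_def)
    ultimately have "((\<lambda>w. g (z + w)) has_field_derivative cpderiv v f (x + axis v z)) (at 0)"
      by (simp add: g_def add.assoc)
    then show ?thesis
      using DERIV_shift[of g _ 0 z] by (simp add: add.commute)
  qed
  have cont: "continuous_on (cball 0 r) g"
    by (intro continuous_at_imp_continuous_on ballI DERIV_isCont[OF der]) simp
  have "g holomorphic_on ball 0 r"
  proof (rule holomorphic_onI)
    fix z :: complex assume "z \<in> ball 0 r"
    then have "norm z \<le> r" by simp
    from has_field_derivative_at_within[OF der[OF this]]
    show "g field_differentiable at z within ball 0 r"
      unfolding field_differentiable_def by (rule exI)
  qed
  from Cauchy_has_contour_integral_higher_derivative_circlepath[OF cont this, of 0 1] r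
  have "((\<lambda>u. g u / u ^ 2) has_contour_integral (2 * pi * \<i>) * deriv g 0) (circlepath 0 r)"
    by (simp add: power2_eq_square)
  then have "((\<lambda>t. g (circlepath 0 r t) / circlepath 0 r t ^ 2 *
      vector_derivative (circlepath 0 r) (at t within {0..1})) has_integral (2 * pi * \<i>) * deriv g 0) {0..1}"
    unfolding has_contour_integral_def .
  then have "((\<lambda>t. (2 * pi * \<i>) * (g (of_real r * exp (2 * of_real pi * \<i> * of_real t)) / (of_real r * exp (2 * of_real pi * \<i> * of_real t))))
      has_integral (2 * pi * \<i>) * deriv g 0) {0..1}"
  proof (rule has_integral_eq[rotated])
    fix t :: real assume t: "t \<in> {0..1}"
    let ?w = "of_real r * exp (2 * of_real pi * \<i> * of_real t)"
    have w: "circlepath 0 r t = ?w"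
      by (simp add: circlepath)
    have d: "vector_derivative (circlepath 0 r) (at t within {0..1}) = 2 * pi * \<i> * ?w"
      using t vector_derivative_circlepath01[of t 0 r] by (simp add: mult.assoc)
    have "?w \<noteq> 0"
      using r by simp
    then have "g w / w ^ 2 * (c * w) = c * (g w / w)" if "w = ?w" for w c
      using that by (simp add: power2_eq_square)
    then show "g (circlepath 0 r t) / circlepath 0 r t ^ 2 *
        vector_derivative (circlepath 0 r) (at t within {0..1}) = (2 * pi * \<i>) * (g ?w / ?w)"
      unfolding d w by blast
  qed
  from has_integral_mult_right[OF this, of "1 / (2 * pi * \<i>)"]
  have "((\<lambda>t. g (of_real r * exp (2 * of_real pi * \<i> * of_real t)) / (of_real r * exp (2 * of_real pi * \<i> * of_real t)))
      has_integral deriv g 0) {0..1}"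
    by (simp add: field_simps)
  then show ?thesis
    unfolding cpderiv_def g_def by (simp add: integral_unique)
qed

lemma bounded_linear_nth_sum: "bounded_linear (\<lambda>h :: complex ^ 'v::finite. \<Sum>v\<in>UNIV. a v * h $ v)"
  by (intro bounded_linear_sum bounded_linear_const_mult bounded_linear_vec_nth)

text \<open>One radius serves for all x near x0, as parameter integrals require.\<close>

lemma axis_neighbourhood:
  assumes "open U" "x0 \<in> U"
  obtains r where "r > 0" "\<And>x z. x \<in> ball x0 r \<Longrightarrow> norm z \<le> r \<Longrightarrow> x + axis w z \<in> (U :: (complex ^ 'v::finite) set)"
proof -
  obtain e where e: "e > 0" "ball x0 e \<subseteq> U"
    using assms open_contains_ball by blast
  have "x + axis w z \<in> U" if "x \<in> ball x0 (e / 2)" "norm z \<le> e / 2" for x z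
  proof -
    have "dist x0 (x + axis w z) \<le> dist x0 x + norm (axis w z :: complex ^ 'v)"
      by (metis add_diff_cancel_left' dist_norm dist_triangle norm_minus_commute)
    then show ?thesis
      using e that unfolding norm_axis_complex by (auto simp: subset_eq)
  qed
  with e(1) show ?thesis
    by (intro that[of "e / 2"]) auto
qed

text \<open>Cauchy's integral depends continuously on x because f is continuous. The Leibniz rule in
  \<open>cpderiv_has_derivative\<close> asks for this continuity.\<close>

lemma continuous_on_cpderiv:
  assumes "open U" "mv_holomorphic_on f U"
  shows "continuous_on U (cpderiv w f)"
proof (rule continuous_at_imp_continuous_on, rule ballI)
  fix x0 assume "x0 \<in> U"
  then obtain r where r: "r > 0" and sub: "\<And>x z. x \<in> ball x0 r \<Longrightarrow> norm z \<le> r \<Longrightarrow> x + axis w z \<in> U"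
    using axis_neighbourhood[OF assms(1)] by metis
  define u where "u t = of_real r * exp (2 * of_real pi * \<i> * of_real t)" for t :: real
  have norm_u: "norm (u t) = r" for t
    using r by (simp add: u_def norm_mult)
  have u0: "u t \<noteq> 0" for t
    using norm_u[of t] r by auto
  have "continuous_on (ball x0 r \<times> cbox 0 1) (\<lambda>(x, t). f (x + axis w (u t)) / u t)"
    unfolding split_beta
    by (intro continuous_intros continuous_on_compose2[OF mv_holomorphic_continuous[OF assms(2)]]
        bounded_linear.continuous_on[OF bounded_linear_axis])
      (auto simp: u_def u0[unfolded u_def] intro!: continuous_intros sub norm_u[unfolded u_def, THEN eq_refl])
  then have "continuous_on (ball x0 r) (\<lambda>x. integral (cbox 0 1) (\<lambda>t. f (x + axis w (u t)) / u t))"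
    by (rule integral_continuous_on_param)
  then have "continuous_on (ball x0 r) (cpderiv w f)"
    by (rule continuous_on_eq)
      (use cpderiv_Cauchy[OF assms(2) r] sub in \<open>simp add: u_def\<close>)
  then show "isCont (cpderiv w f) x0"
    using r by (simp add: continuous_on_eq_continuous_at)
qed

text \<open>Differentiation under Cauchy's integral. The derivative is stated explicitly because its
  coefficients are again Cauchy integrals, which \<open>cpderiv_commute\<close> reads off.\<close>

lemma cpderiv_has_derivative:
  assumes U: "open U" and hol: "mv_holomorphic_on f U" and x0: "x0 \<in> U"
  obtains r where "r > 0" "\<And>z. norm z \<le> r \<Longrightarrow> x0 + axis w z \<in> U"
    "(cpderiv w f has_derivative (\<lambda>h. \<Sum>v\<in>UNIV. integral {0..1}
       (\<lambda>t. cpderiv v f (x0 + axis w (of_real r * exp (2 * of_real pi * \<i> * of_real t))) /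
         (of_real r * exp (2 * of_real pi * \<i> * of_real t))) * h $ v)) (at x0)"
proof -
  obtain r where r: "r > 0" and sub: "\<And>x z. x \<in> ball x0 r \<Longrightarrow> norm z \<le> r \<Longrightarrow> x + axis w z \<in> U"
    using axis_neighbourhood[OF U x0] by metis
  define u where "u t = of_real r * exp (2 * of_real pi * \<i> * of_real t)" for t :: real
  have norm_u: "norm (u t) = r" for t
    using r by (simp add: u_def norm_mult)
  have u0: "u t \<noteq> 0" for t
    using norm_u[of t] r by auto
  have cont_u: "continuous_on S (\<lambda>x. u (g x))" if "continuous_on S g" for S and g :: "'b::topological_space \<Rightarrow> real"
    unfolding u_def by (intro continuous_intros that)
  have cont: "continuous_on (ball x0 r \<times> cbox 0 1) (\<lambda>y. k (fst y + axis w (u (snd y))) / u (snd y))"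
    if "continuous_on U k" for k :: "complex ^ 'a \<Rightarrow> complex"
    by (intro continuous_intros continuous_on_compose2[OF that] cont_u
        bounded_linear.continuous_on[OF bounded_linear_axis])
      (auto simp: u0 intro!: sub norm_u[THEN eq_refl])
  \<comment> \<open>The derivative of the integrand as a bounded linear map, so that its joint
    continuity in x and t can be expressed.\<close>
  define B where "B x t = (\<Sum>v\<in>UNIV. blinfun_mult_right (cpderiv v f (x + axis w (u t)) / u t) o\<^sub>L Blinfun (\<lambda>h :: complex ^ 'a. h $ v))" for x t
  have B: "blinfun_apply (B x t) h = (\<Sum>v\<in>UNIV. cpderiv v f (x + axis w (u t)) / u t * h $ v)" for x t h
    by (simp add: B_def blinfun.sum_left bounded_linear_Blinfun_apply[OF bounded_linear_vec_nth])
  have contB: "continuous_on (ball x0 r \<times> cbox 0 1) (\<lambda>(x, t). B x t)"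
    unfolding split_beta B_def
    by (intro continuous_intros bounded_linear.continuous_on[OF bounded_linear_blinfun_mult_right]
        cont[OF continuous_on_cpderiv[OF U hol]])
  have "((\<lambda>x. integral (cbox 0 1) (\<lambda>t. f (x + axis w (u t)) / u t)) has_derivative
      integral (cbox 0 1) (B x0)) (at x0 within ball x0 r)"
  proof (rule leibniz_rule[OF _ _ contB])
    fix x t assume xt: "x \<in> ball x0 r" "t \<in> cbox 0 (1 :: real)"
    have "x + axis w (u t) \<in> U"
      using xt norm_u by (intro sub) auto
    then have 2: "(f has_derivative (\<lambda>h. \<Sum>v\<in>UNIV. cpderiv v f (x + axis w (u t)) * h $ v)) (at (x + axis w (u t)))"
      by (rule mv_holomorphic_has_derivative[OF hol])
    have 1: "((\<lambda>x. x + axis w (u t)) has_derivative (\<lambda>h. h)) (at x)"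
      by (auto intro!: derivative_eq_intros)
    have "((\<lambda>x. f (x + axis w (u t)) / u t) has_derivative (\<lambda>h. (\<Sum>v\<in>UNIV. cpderiv v f (x + axis w (u t)) * h $ v) / u t)) (at x)"
      by (rule has_derivative_divide'[OF has_derivative_compose[OF 1 2] has_derivative_const u0, THEN has_derivative_eq_rhs]) (simp add: u0 field_simps)
    then have "((\<lambda>x. f (x + axis w (u t)) / u t) has_derivative blinfun_apply (B x t)) (at x)"
      by (rule has_derivative_eq_rhs) (auto simp: B sum_divide_distrib)
    then show "((\<lambda>x. f (x + axis w (u t)) / u t) has_derivative blinfun_apply (B x t)) (at x within ball x0 r)"
      by (rule has_derivative_at_withinI)
  next
    fix x assume "x \<in> ball x0 r"
    then have "continuous_on (cbox 0 1) (\<lambda>t. f (x + axis w (u t)) / u t)"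
      by (intro continuous_on_compose2[OF cont[OF mv_holomorphic_continuous[OF hol]], of _ "\<lambda>t. (x, t)", simplified]
          continuous_intros) auto
    then show "(\<lambda>t. f (x + axis w (u t)) / u t) integrable_on cbox 0 1"
      by (rule integrable_continuous)
  qed (use r in auto)
  moreover have "at x0 within ball x0 r = at x0"
    using r by (intro at_within_open) auto
  ultimately have D: "((\<lambda>x. integral (cbox 0 1) (\<lambda>t. f (x + axis w (u t)) / u t)) has_derivative
      integral (cbox 0 1) (B x0)) (at x0)"
    by (simp only:)
  have "blinfun_apply (integral (cbox 0 1) (B x0)) h =
      (\<Sum>v\<in>UNIV. integral {0..1} (\<lambda>t. cpderiv v f (x0 + axis w (u t)) / u t) * h $ v)" for h
  proof -
    have ci: "continuous_on (cbox 0 1) (\<lambda>t. cpderiv v f (x0 + axis w (u t)) / u t)" for v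
      using r by (intro continuous_on_compose2[OF cont[OF continuous_on_cpderiv[OF U hol]], of _ "\<lambda>t. (x0, t)", simplified]
          continuous_intros) auto
    have "continuous_on (cbox 0 1) (B x0)"
      using r by (intro continuous_on_compose2[OF contB, of _ "\<lambda>t. (x0, t)", simplified] continuous_intros) auto
    then have "blinfun_apply (integral (cbox 0 1) (B x0)) h = integral (cbox 0 1) (\<lambda>t. blinfun_apply (B x0 t) h)"
      by (intro blinfun_apply_integral integrable_continuous)
    also have "\<dots> = (\<Sum>v\<in>UNIV. integral (cbox 0 1) (\<lambda>t. cpderiv v f (x0 + axis w (u t)) / u t * h $ v))"
      unfolding B
      by (intro integral_sum integrable_continuous continuous_intros ci) auto
    finally show ?thesis
      by (simp only: integral_mult_left cbox_interval)
  qed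
  then have "integral (cbox 0 1) (B x0) = Blinfun (\<lambda>h. \<Sum>v\<in>UNIV. integral {0..1} (\<lambda>t. cpderiv v f (x0 + axis w (u t)) / u t) * h $ v)"
    by (intro blinfun_eqI) (simp add: bounded_linear_Blinfun_apply bounded_linear_nth_sum)
  with D have "((\<lambda>x. integral (cbox 0 1) (\<lambda>t. f (x + axis w (u t)) / u t)) has_derivative
      (\<lambda>h. \<Sum>v\<in>UNIV. integral {0..1} (\<lambda>t. cpderiv v f (x0 + axis w (u t)) / u t) * h $ v)) (at x0)"
    by (simp add: bounded_linear_Blinfun_apply bounded_linear_nth_sum)
  then have "(cpderiv w f has_derivative
      (\<lambda>h. \<Sum>v\<in>UNIV. integral {0..1} (\<lambda>t. cpderiv v f (x0 + axis w (u t)) / u t) * h $ v)) (at x0)"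
  proof (rule has_derivative_transform_within_open[of _ _ _ _ "ball x0 r"])
    show "integral (cbox 0 1) (\<lambda>t. f (x + axis w (u t)) / u t) = cpderiv w f x" if "x \<in> ball x0 r" for x
      using cpderiv_Cauchy[OF hol r, of x w] sub[OF that] by (simp add: u_def)
  qed (use r in auto)
  with r sub[of x0] show ?thesis
    by (intro that[of r]) (auto simp: u_def)
qed

lemma mv_holomorphic_cpderiv:
  assumes "open U" "mv_holomorphic_on f U"
  shows "mv_holomorphic_on (cpderiv w f) U"
  unfolding mv_holomorphic_on_def
proof
  fix x assume "x \<in> U"
  have "\<exists>a. (cpderiv w f has_derivative (\<lambda>h. \<Sum>v\<in>UNIV. a v * h $ v)) (at x)"
    by (rule cpderiv_has_derivative[OF assms \<open>x \<in> U\<close>, of w]) (rule exI, assumption)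
  then obtain a where "(cpderiv w f has_derivative (\<lambda>h. \<Sum>v\<in>UNIV. a v * h $ v)) (at x)" ..
  then show "\<exists>a. (cpderiv w f has_derivative (\<lambda>h. \<Sum>v\<in>UNIV. a $ v * h $ v)) (at x)"
    by (intro exI[of _ "\<chi> v. a v"]) simp
qed

text \<open>The coefficient of h_v in the derivative of \<open>cpderiv w f\<close> is Cauchy's
  integral for the w-derivative of \<open>cpderiv v f\<close>.\<close>

lemma cpderiv_commute:
  assumes U: "open U" and hol: "mv_holomorphic_on f U" and x: "x \<in> U"
  shows "cpderiv v (cpderiv w f) x = cpderiv w (cpderiv v f) x"
proof -
  obtain r where r: "r > 0" "\<And>z. norm z \<le> r \<Longrightarrow> x + axis w z \<in> U"
    "(cpderiv w f has_derivative (\<lambda>h. \<Sum>v\<in>UNIV. integral {0..1}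
       (\<lambda>t. cpderiv v f (x + axis w (of_real r * exp (2 * of_real pi * \<i> * of_real t))) /
         (of_real r * exp (2 * of_real pi * \<i> * of_real t))) * h $ v)) (at x)"
    using cpderiv_has_derivative[OF assms] by blast
  show ?thesis
    unfolding cpderiv_eqI[OF r(3)]
    using cpderiv_Cauchy[OF mv_holomorphic_cpderiv[OF U hol] r(1,2), of v] by simp
qed

section \<open>Sums, products and polynomials as holomorphic functions\<close>

lemma mv_holomorphic_const [simp]: "mv_holomorphic_on (\<lambda>x. c) U"
  by (rule mv_holomorphic_onI[of _ _ "\<lambda>_ _. 0"]) simp

lemma cpderiv_const [simp]: "cpderiv v (\<lambda>x. c) x = 0"
  by (simp add: cpderiv_def)

lemma
  assumes "mv_holomorphic_on f U" "mv_holomorphic_on g U"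
  shows mv_holomorphic_add: "mv_holomorphic_on (\<lambda>x. f x + g x) U"
    and cpderiv_add: "x \<in> U \<Longrightarrow> cpderiv v (\<lambda>x. f x + g x) x = cpderiv v f x + cpderiv v g x"
    and mv_holomorphic_mult: "mv_holomorphic_on (\<lambda>x. f x * g x) U"
    and cpderiv_mult: "x \<in> U \<Longrightarrow> cpderiv v (\<lambda>x. f x * g x) x = f x * cpderiv v g x + cpderiv v f x * g x"
proof -
  have add: "((\<lambda>x. f x + g x) has_derivative (\<lambda>h. \<Sum>v\<in>UNIV. (cpderiv v f x + cpderiv v g x) * h $ v)) (at x)"
    if "x \<in> U" for x
    by (rule has_derivative_eq_rhs[OF has_derivative_add])
      (use assms[THEN mv_holomorphic_has_derivative, OF that] in \<open>auto simp: distrib_right sum.distrib\<close>)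
  show "mv_holomorphic_on (\<lambda>x. f x + g x) U"
    by (rule mv_holomorphic_onI[OF add])
  show "x \<in> U \<Longrightarrow> cpderiv v (\<lambda>x. f x + g x) x = cpderiv v f x + cpderiv v g x"
    by (rule cpderiv_eqI[OF add])
  have mult: "((\<lambda>x. f x * g x) has_derivative (\<lambda>h. \<Sum>v\<in>UNIV. (f x * cpderiv v g x + cpderiv v f x * g x) * h $ v)) (at x)"
    if "x \<in> U" for x
    by (rule has_derivative_eq_rhs[OF has_derivative_mult])
      (use assms[THEN mv_holomorphic_has_derivative, OF that] in
        \<open>auto simp: algebra_simps sum.distrib sum_distrib_left\<close>)
  show "mv_holomorphic_on (\<lambda>x. f x * g x) U"
    by (rule mv_holomorphic_onI[OF mult])
  show "x \<in> U \<Longrightarrow> cpderiv v (\<lambda>x. f x * g x) x = f x * cpderiv v g x + cpderiv v f x * g x"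
    by (rule cpderiv_eqI[OF mult])
qed

lemma
  assumes "\<And>i. i \<in> A \<Longrightarrow> mv_holomorphic_on (f i) U"
  shows mv_holomorphic_sum: "mv_holomorphic_on (\<lambda>x. \<Sum>i\<in>A. f i x) U"
    and cpderiv_sum: "x \<in> U \<Longrightarrow> cpderiv v (\<lambda>x. \<Sum>i\<in>A. f i x) x = (\<Sum>i\<in>A. cpderiv v (f i) x)"
proof -
  have "mv_holomorphic_on (\<lambda>x. \<Sum>i\<in>A. f i x) U \<and>
      (x \<in> U \<longrightarrow> cpderiv v (\<lambda>x. \<Sum>i\<in>A. f i x) x = (\<Sum>i\<in>A. cpderiv v (f i) x))"
    using assms
  proof (induction A rule: infinite_finite_induct)
    case (insert i A)
    then show ?case
      using mv_holomorphic_add[of "f i" U "\<lambda>x. \<Sum>i\<in>A. f i x"] cpderiv_add[of "f i" U "\<lambda>x. \<Sum>i\<in>A. f i x" x v]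
      by simp
  qed simp_all
  then show "mv_holomorphic_on (\<lambda>x. \<Sum>i\<in>A. f i x) U"
    "x \<in> U \<Longrightarrow> cpderiv v (\<lambda>x. \<Sum>i\<in>A. f i x) x = (\<Sum>i\<in>A. cpderiv v (f i) x)"
    by auto
qed

lemma has_derivative_nth: "((\<lambda>x. x $ v) has_derivative (\<lambda>h. \<Sum>w\<in>UNIV. of_bool (w = v) * h $ w)) (at (x :: complex ^ 'v::finite))"
proof -
  have "(\<Sum>w\<in>UNIV. of_bool (w = v) * h $ w) = h $ v" for h :: "complex ^ 'v"
    by (simp add: of_bool_def if_distrib[of "\<lambda>x. x * _"] cong: if_cong)
  then show ?thesis
    by (simp add: bounded_linear_imp_has_derivative bounded_linear_vec_nth)
qed

lemma mv_holomorphic_nth [simp]: "mv_holomorphic_on (\<lambda>x. x $ v) U"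
  by (rule mv_holomorphic_onI[OF has_derivative_nth])

lemma cpderiv_nth: "cpderiv w (\<lambda>x. x $ v) x = of_bool (w = v)"
  by (rule cpderiv_eqI[OF has_derivative_nth])

lemma ring_hom_id: "ring_hom (\<lambda>c. c)"
  by (simp add: ring_hom_def)

lemma mpeval_eq: "mpeval p x = mpoly_eval (\<lambda>c. c) (($) x) p"
  by (simp add: mpeval_def mpoly_eval_def)

lemmas mpeval_hom = ring_homD[OF ring_hom_mpoly_eval[OF ring_hom_id, of "($) x"], folded mpeval_eq]
  for x :: "complex ^ 'v::finite"

lemma
  fixes p :: "'v::finite mpoly"
  shows mv_holomorphic_mpeval [simp]: "mv_holomorphic_on (mpeval p) U"
    and cpderiv_mpeval: "cpderiv w (mpeval p) x = mpeval (mpderiv w p) x"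
proof -
  have "mv_holomorphic_on (mpeval p) UNIV \<and> cpderiv w (mpeval p) x = mpeval (mpderiv w p) x"
  proof (induction p rule: mpoly_induct)
    case (const c)
    have "mpeval (Poly_Mapping.single 0 c) = (\<lambda>x :: complex ^ 'v. c)"
      by (simp add: fun_eq_iff mpeval_eq mpoly_eval_const[OF ring_hom_id])
    then show ?case
      by (simp add: mpeval_hom)
  next
    case (var v p)
    have "mpeval (mvar v * p) = (\<lambda>x. x $ v * mpeval p x)"
      by (simp add: fun_eq_iff mpeval_eq mpoly_eval_mult[OF ring_hom_id] mpoly_eval_mvar[OF ring_hom_id])
    moreover have "mpeval (of_bool (w = v) * p) x = of_bool (w = v) * mpeval p x"
      by (simp add: mpeval_hom)
    ultimately show ?case
      using var mv_holomorphic_mult[of "\<lambda>x. x $ v" UNIV "mpeval p"] cpderiv_mult[of "\<lambda>x. x $ v" UNIV "mpeval p" x w]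
      by (simp add: mpderiv_mult mpderiv_mvar mpeval_hom cpderiv_nth mpeval_eq[of "mvar v"] mpoly_eval_mvar[OF ring_hom_id])
  next
    case (add p q)
    have "mpeval (p + q) = (\<lambda>x. mpeval p x + mpeval q x)"
      by (simp add: fun_eq_iff mpeval_hom)
    then show ?case
      using add mv_holomorphic_add[of "mpeval p" UNIV "mpeval q"] cpderiv_add[of "mpeval p" UNIV "mpeval q" x w]
      by (simp add: mpderiv_add mpeval_hom)
  qed
  then show "mv_holomorphic_on (mpeval p) U" "cpderiv w (mpeval p) x = mpeval (mpderiv w p) x"
    using mv_holomorphic_subset by auto
qed

subsection \<open>The action of the Weyl algebra on holomorphic functions\<close>

text \<open>
  Total, so that the partial derivatives commute on all functions, as \<open>mixed_unit\<close> requires.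
\<close>

definition hderiv :: "(complex ^ 'v::finite) set \<Rightarrow> 'v \<Rightarrow> (complex ^ 'v \<Rightarrow> complex) \<Rightarrow> complex ^ 'v \<Rightarrow> complex" where
  "hderiv U v f = (\<lambda>x. if mv_holomorphic_on f U \<and> x \<in> U then cpderiv v f x else 0)"

lemma hderiv_commute:
  assumes U: "open U"
  shows "hderiv U v (hderiv U w f) = hderiv U w (hderiv U v f)"
proof (cases "mv_holomorphic_on f U")
  case True
  have *: "hderiv U v (hderiv U w f) x = (if x \<in> U then cpderiv v (cpderiv w f) x else 0)" for v w x
  proof (cases "x \<in> U")
    case x: True
    have eq: "cpderiv w f x = hderiv U w f x" if "x \<in> U" for x
      using True that by (simp add: hderiv_def)
    have "mv_holomorphic_on (hderiv U w f) U"
      by (rule mv_holomorphic_cong[OF U eq mv_holomorphic_cpderiv[OF U True]])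
    moreover have "cpderiv v (cpderiv w f) x = cpderiv v (hderiv U w f) x"
      by (rule cpderiv_cong[OF U x eq])
    ultimately show ?thesis
      using x by (simp add: hderiv_def)
  qed (simp add: hderiv_def)
  show ?thesis
    using cpderiv_commute[OF U True] by (auto simp: *)
next
  case False
  then have *: "hderiv U v f = (\<lambda>x. 0)" for v
    by (simp add: hderiv_def)
  show ?thesis
    unfolding * by (simp add: hderiv_def cong: if_cong)
qed

context
  fixes U :: "(complex ^ 'v::finite) set" and f :: "complex ^ 'v \<Rightarrow> complex"
  assumes U: "open U" and hol: "mv_holomorphic_on f U"
begin

text \<open>Links the actual iterated derivatives to the commuting operators
  \<open>hderiv U\<close>; holomorphy has to be carried through the induction because
  \<open>hderiv U\<close> tests for it.\<close>

lemma mixed_cpderiv_hderiv: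
  "mv_holomorphic_on (mixed cpderiv m f) U \<and> (\<forall>x\<in>U. mixed cpderiv m f x = mixed (hderiv U) m f x)"
proof -
  have step: "mv_holomorphic_on (cpderiv v g) U \<and> (\<forall>x\<in>U. cpderiv v g x = hderiv U v g' x)"
    if "mv_holomorphic_on g U \<and> (\<forall>x\<in>U. g x = g' x)" for v g g'
  proof -
    have "mv_holomorphic_on g' U"
      using that by (intro mv_holomorphic_cong[OF U, of g g']) auto
    moreover have "cpderiv v g x = cpderiv v g' x" if "x \<in> U" for x
      using \<open>_ \<and> _\<close> by (intro cpderiv_cong[OF U that]) auto
    ultimately show ?thesis
      using that mv_holomorphic_cpderiv[OF U] by (auto simp: hderiv_def)
  qed
  have pow: "mv_holomorphic_on ((cpderiv v ^^ k) g) U \<and> (\<forall>x\<in>U. (cpderiv v ^^ k) g x = (hderiv U v ^^ k) g' x)"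
    if "mv_holomorphic_on g U \<and> (\<forall>x\<in>U. g x = g' x)" for v g g' k
  proof (induction k)
    case (Suc k)
    then show ?case
      using step[OF Suc.IH] by simp
  qed (use that in simp)
  have "mv_holomorphic_on (foldr (\<lambda>v. cpderiv v ^^ expo m v) vs f) U \<and>
      (\<forall>x\<in>U. foldr (\<lambda>v. cpderiv v ^^ expo m v) vs f x = foldr (\<lambda>v. hderiv U v ^^ expo m v) vs f x)" for vs
  proof (induction vs)
    case (Cons v vs)
    then show ?case
      using pow[OF Cons, of "expo m v" v] by simp
  qed (simp add: hol)
  then show ?thesis
    unfolding mixed_def by blast
qed

lemma mv_holomorphic_mixed: "mv_holomorphic_on (mixed cpderiv m f) U"
  using mixed_cpderiv_hderiv by blast

lemma mixed_cpderiv_unit: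
  assumes "x \<in> U"
  shows "mixed cpderiv (m + unit_index v) f x = cpderiv v (mixed cpderiv m f) x"
proof -
  have "mixed cpderiv (m + unit_index v) f x = hderiv U v (mixed (hderiv U) m f) x"
    using mixed_cpderiv_hderiv assms mixed_unit[of "hderiv U", OF hderiv_commute[OF U]] by auto
  also have "mv_holomorphic_on (mixed (hderiv U) m f) U"
    using mixed_cpderiv_hderiv by (intro mv_holomorphic_cong[OF U _ mv_holomorphic_mixed]) auto
  then have "hderiv U v (mixed (hderiv U) m f) x = cpderiv v (mixed (hderiv U) m f) x"
    using assms by (simp add: hderiv_def)
  also have "\<dots> = cpderiv v (mixed cpderiv m f) x"
    using mixed_cpderiv_hderiv by (intro cpderiv_cong[OF U assms]) auto
  finally show ?thesis .
qed

lemma diffop_apply_eq: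
  assumes "finite A" "Poly_Mapping.keys (dcoeffs P) \<subseteq> A"
    and "\<And>m. Poly_Mapping.lookup (dcoeffs P) m = Fract (p m) 1"
  shows "diffop_apply P f x = (\<Sum>m\<in>A. mpeval (p m) x * mixed cpderiv m f x)"
  unfolding diffop_apply_def assms(3) mpoly_of_Fract
proof (rule sum.mono_neutral_left[OF assms(1,2)], rule ballI)
  fix m assume "m \<in> A - Poly_Mapping.keys (dcoeffs P)"
  then have "Fract (p m) 1 = 0"
    using assms(3)[of m] by (simp add: in_keys_iff)
  then have "p m = 0"
    by (simp add: Zero_fract_def eq_fract)
  then show "mpeval (p m) x * mixed cpderiv m f x = 0"
    by (simp add: mpeval_hom)
qed

lemma diffop_apply_monom: "diffop_apply (pcoef p * dmon m) f x = mpeval p x * mixed cpderiv m f x"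
proof -
  have "diffop_apply (pcoef p * dmon m) f x =
      (\<Sum>k\<in>{m}. mpeval (if k = m then p else 0) x * mixed cpderiv k f x)"
    by (rule diffop_apply_eq) (auto simp: rcoef_dmon DiffOp_inverse lookup_single when_def Zero_fract_def split: if_splits)
  then show ?thesis
    by simp
qed

lemma diffop_apply_add:
  assumes "P \<in> weyl_algebra" "Q \<in> weyl_algebra"
  shows "diffop_apply (P + Q) f x = diffop_apply P f x + diffop_apply Q f x"
proof -
  obtain p where p: "\<And>m. Poly_Mapping.lookup (dcoeffs P) m = Fract (p m) 1"
    using weyl_algebra_expand[OF assms(1)] by metis
  obtain q where q: "\<And>m. Poly_Mapping.lookup (dcoeffs Q) m = Fract (q m) 1"
    using weyl_algebra_expand[OF assms(2)] by metis
  let ?A = "Poly_Mapping.keys (dcoeffs P) \<union> Poly_Mapping.keys (dcoeffs Q)"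
  have "diffop_apply (P + Q) f x = (\<Sum>m\<in>?A. mpeval (p m + q m) x * mixed cpderiv m f x)"
    by (rule diffop_apply_eq)
      (auto simp: plus_ratweyl.rep_eq lookup_add p q dest: keys_add[THEN subsetD])
  moreover have "diffop_apply P f x = (\<Sum>m\<in>?A. mpeval (p m) x * mixed cpderiv m f x)"
    by (rule diffop_apply_eq[OF _ _ p]) auto
  moreover have "diffop_apply Q f x = (\<Sum>m\<in>?A. mpeval (q m) x * mixed cpderiv m f x)"
    by (rule diffop_apply_eq[OF _ _ q]) auto
  ultimately show ?thesis
    by (simp add: mpeval_hom distrib_right sum.distrib)
qed

lemma weyl_algebra_monom_induct [consumes 1, case_names monom add]:
  assumes "P \<in> weyl_algebra" "\<And>p m. Q (pcoef p * dmon m)"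
    "\<And>P P'. P \<in> weyl_algebra \<Longrightarrow> P' \<in> weyl_algebra \<Longrightarrow> Q P \<Longrightarrow> Q P' \<Longrightarrow> Q (P + P')"
  shows "Q (P :: 'v ratweyl)"
proof -
  obtain c where c: "P = (\<Sum>m\<in>Poly_Mapping.keys (dcoeffs P). pcoef (c m) * dmon m)"
    using assms(1) by (rule weyl_algebra_expand)
  have mon: "pcoef p * dmon m \<in> weyl_algebra" for p and m :: "'v mindex"
    by (simp add: rcoef_dmon weyl_algebra_single)
  have "Q (\<Sum>m\<in>A. pcoef (c m) * dmon m)" if "finite A" for A
    using that
  proof (induction rule: finite_induct)
    case empty
    then show ?case
      using assms(2)[of 0 0] by (simp add: Zero_fract_def[symmetric])
  next
    case (insert m A)
    then show ?case
      using assms(2,3) mon by (simp add: weyl_algebra_sum)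
  qed
  then show ?thesis
    by (subst c) simp
qed

lemma mv_holomorphic_diffop_apply:
  "P \<in> weyl_algebra \<Longrightarrow> mv_holomorphic_on (diffop_apply P f) U"
proof (induction rule: weyl_algebra_monom_induct)
  case (monom p m)
  have "diffop_apply (pcoef p * dmon m) f = (\<lambda>x. mpeval p x * mixed cpderiv m f x)"
    by (simp add: fun_eq_iff diffop_apply_monom)
  then show ?case
    using mv_holomorphic_mult[OF mv_holomorphic_mpeval mv_holomorphic_mixed] by simp
next
  case (add P Q)
  have "diffop_apply (P + Q) f = (\<lambda>x. diffop_apply P f x + diffop_apply Q f x)"
    using add by (simp add: fun_eq_iff diffop_apply_add)
  then show ?case
    using mv_holomorphic_add[OF add.IH] by simp
qed

lemma diffop_apply_pcoef_mult:
  "P \<in> weyl_algebra \<Longrightarrow> diffop_apply (pcoef q * P) f x = mpeval q x * diffop_apply P f x"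
proof (induction rule: weyl_algebra_monom_induct)
  case (monom p m)
  have "diffop_apply (pcoef (q * p) * dmon m) f x = mpeval q x * diffop_apply (pcoef p * dmon m) f x"
    by (simp only: diffop_apply_monom mpeval_hom mult.assoc)
  then show ?case
    by simp
next
  case (add P Q)
  then show ?case
    by (simp add: distrib_left diffop_apply_add weyl_algebra_pcoef_mult)
qed

lemma diffop_apply_dvar_mult:
  assumes "x \<in> U"
  shows "P \<in> weyl_algebra \<Longrightarrow> diffop_apply (dvar v * P) f x = cpderiv v (diffop_apply P f) x"
proof (induction rule: weyl_algebra_monom_induct)
  case (monom p m)
  have mon: "pcoef p * dmon m \<in> weyl_algebra" for p and m :: "'v mindex"
    by (simp add: rcoef_dmon weyl_algebra_single)
  have "dvar v * (pcoef p * dmon m) = pcoef p * dmon (m + unit_index v) + pcoef (mpderiv v p) * dmon m"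
  proof -
    have "dvar v * (pcoef p * dmon m) = dvar v * pcoef p * dmon m"
      by (simp only: mult.assoc)
    then show ?thesis
      by (simp only: dvar_rcoef rderiv_poly distrib_right dmon_unit mult.assoc)
  qed
  then have "diffop_apply (dvar v * (pcoef p * dmon m)) f x =
      mpeval p x * cpderiv v (mixed cpderiv m f) x + mpeval (mpderiv v p) x * mixed cpderiv m f x"
    using assms by (simp only: diffop_apply_add[OF mon mon] diffop_apply_monom mixed_cpderiv_unit)
  also have "\<dots> = cpderiv v (\<lambda>x. mpeval p x * mixed cpderiv m f x) x"
    using cpderiv_mult[OF mv_holomorphic_mpeval mv_holomorphic_mixed assms] by (simp add: cpderiv_mpeval)
  finally show ?case
    by (simp only: diffop_apply_monom[abs_def])
next
  case (add P Q)
  have "diffop_apply (P + Q) f = (\<lambda>x. diffop_apply P f x + diffop_apply Q f x)"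
    using add by (simp add: fun_eq_iff diffop_apply_add)
  then show ?case
    using add cpderiv_add[OF mv_holomorphic_diffop_apply mv_holomorphic_diffop_apply assms]
    by (simp add: distrib_left diffop_apply_add weyl_algebra_dvar_mult)
qed

lemma diffop_apply_1: "diffop_apply 1 f x = f x"
  using diffop_apply_monom[of 1 0 x] by (simp add: One_fract_def[symmetric] mpeval_hom)

lemma diffop_apply_0: "diffop_apply 0 f x = 0"
  by (simp add: diffop_apply_def zero_ratweyl.rep_eq)

lemma diffop_apply_uminus:
  assumes "P \<in> weyl_algebra"
  shows "diffop_apply (- P) f x = - diffop_apply P f x"
  using diffop_apply_pcoef_mult[OF assms, of "- 1" x]
  by (simp add: mpeval_hom One_fract_def[symmetric] rcoef_uminus flip: minus_fract)

lemma diffop_apply_diff: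
  assumes "P \<in> weyl_algebra" "Q \<in> weyl_algebra"
  shows "diffop_apply (P - Q) f x = diffop_apply P f x - diffop_apply Q f x"
proof -
  have "- Q \<in> weyl_algebra"
    using weyl_algebra_pcoef_mult[OF assms(2), of "- 1"]
    by (simp add: One_fract_def[symmetric] rcoef_uminus flip: minus_fract)
  then show ?thesis
    using diffop_apply_add[of P "- Q" x] assms by (simp add: diffop_apply_uminus)
qed

lemma diffop_apply_sum:
  "(\<And>i. i \<in> A \<Longrightarrow> P i \<in> weyl_algebra) \<Longrightarrow> diffop_apply (sum P A) f x = (\<Sum>i\<in>A. diffop_apply (P i) f x)"
  by (induction A rule: infinite_finite_induct)
    (simp_all add: diffop_apply_0 diffop_apply_add weyl_algebra_sum)

lemma diffop_apply_xvar_mult: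
  "P \<in> weyl_algebra \<Longrightarrow> diffop_apply (xvar v * P) f x = x $ v * diffop_apply P f x"
  unfolding xvar_def
  by (simp add: diffop_apply_pcoef_mult mpeval_eq mpoly_eval_mvar[OF ring_hom_id])

text \<open>The Weyl algebra operators annihilating f on U are closed under left multiplication; for
  \<partial>_v this holds because a function vanishing on the open set U has vanishing derivatives
  there.\<close>

lemma solution_on_weyl_ideal:
  assumes S: "S \<subseteq> weyl_algebra"
  shows "solution_on (weyl_ideal S) U f \<longleftrightarrow> solution_on S U f"
proof
  assume "solution_on (weyl_ideal S) U f"
  then show "solution_on S U f"
    unfolding solution_on_def using left_span_base[OF weyl_algebra_1] by blast
next
  assume sol: "solution_on S U f"
  let ?A = "{P \<in> weyl_algebra. \<forall>x\<in>U. diffop_apply P f x = 0}"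
  have "a * s \<in> ?A" if "a \<in> weyl_algebra" "s \<in> S" for a s
    using that(1)
  proof (induction rule: weyl_algebra_induct)
    case one
    then show ?case
      using that(2) S sol by (auto simp: solution_on_def)
  next
    case (pcoef r P)
    then show ?case
      by (simp add: mult.assoc weyl_algebra_pcoef_mult diffop_apply_pcoef_mult)
  next
    case (dvar v P)
    have "cpderiv v (diffop_apply (P * s) f) x = 0" if "x \<in> U" for x
      using cpderiv_cong[OF U that, of "diffop_apply (P * s) f" "\<lambda>_. 0"] dvar by simp
    then show ?case
      using dvar by (simp add: mult.assoc weyl_algebra_dvar_mult diffop_apply_dvar_mult)
  next
    case (add P P')
    then show ?case
      by (simp add: distrib_right weyl_algebra_add diffop_apply_add)
  qed
  then have "P \<in> ?A" if "P \<in> weyl_ideal S" for P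
    using that by (rule_tac left_span_minimal[OF that]) (auto simp: diffop_apply_0 diffop_apply_add weyl_algebra_add)
  then show "solution_on (weyl_ideal S) U f"
    unfolding solution_on_def by blast
qed

end

text \<open>Differential operators are local, which lets f be replaced by a composite with the Gram
  map near a point.\<close>

lemma diffop_apply_cong:
  assumes U: "open U" and eq: "\<And>x. x \<in> U \<Longrightarrow> f x = g x" and x: "x \<in> U"
  shows "diffop_apply P f x = diffop_apply P g x"
proof -
  have pow: "\<forall>x\<in>U. (cpderiv v ^^ k) f x = (cpderiv v ^^ k) g x" if "\<forall>x\<in>U. f x = g x" for v k f g
  proof (induction k)
    case (Suc k)
    then show ?case
      using cpderiv_cong[OF U, of _ "(cpderiv v ^^ k) f" "(cpderiv v ^^ k) g"] by simp
  qed (use that in simp)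
  have "\<forall>x\<in>U. foldr (\<lambda>v. cpderiv v ^^ expo m v) vs f x = foldr (\<lambda>v. cpderiv v ^^ expo m v) vs g x" for m vs
  proof (induction vs)
    case (Cons v vs)
    then show ?case
      using pow[OF Cons, of "expo m v" v] by simp
  qed (simp add: eq)
  then show ?thesis
    using x by (simp add: diffop_apply_def mixed_def)
qed

lemma
  fixes F :: "complex ^ 'v::finite \<Rightarrow> complex ^ 'w::finite"
  assumes F: "\<And>u. mv_holomorphic_on (\<lambda>x. F x $ u) U" and phi: "mv_holomorphic_on \<phi> V" and sub: "F ` U \<subseteq> V"
  shows mv_holomorphic_compose: "mv_holomorphic_on (\<lambda>x. \<phi> (F x)) U"
    and cpderiv_compose: "x \<in> U \<Longrightarrow> cpderiv v (\<lambda>x. \<phi> (F x)) x =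
      (\<Sum>u\<in>UNIV. cpderiv u \<phi> (F x) * cpderiv v (\<lambda>x. F x $ u) x)"
proof -
  have D: "((\<lambda>x. \<phi> (F x)) has_derivative (\<lambda>h. \<Sum>v\<in>UNIV. (\<Sum>u\<in>UNIV. cpderiv u \<phi> (F x) * cpderiv v (\<lambda>x. F x $ u) x) * h $ v)) (at x)"
    if x: "x \<in> U" for x
  proof -
    have 1: "(F has_derivative (\<lambda>h. \<chi> u. \<Sum>v\<in>UNIV. cpderiv v (\<lambda>x. F x $ u) x * h $ v)) (at x)"
      by (rule has_derivative_vecI) (simp add: mv_holomorphic_has_derivative[OF F x])
    have 2: "(\<phi> has_derivative (\<lambda>h. \<Sum>u\<in>UNIV. cpderiv u \<phi> (F x) * h $ u)) (at (F x))"
      using x sub by (intro mv_holomorphic_has_derivative[OF phi]) auto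
    have "(\<Sum>u\<in>UNIV. cpderiv u \<phi> (F x) * (\<Sum>v\<in>UNIV. cpderiv v (\<lambda>x. F x $ u) x * h $ v)) =
      (\<Sum>v\<in>UNIV. (\<Sum>u\<in>UNIV. cpderiv u \<phi> (F x) * cpderiv v (\<lambda>x. F x $ u) x) * h $ v)" for h
      unfolding sum_distrib_left sum_distrib_right mult.assoc by (rule sum.swap)
    with has_derivative_compose[OF 1 2] show ?thesis
      by simp
  qed
  show "mv_holomorphic_on (\<lambda>x. \<phi> (F x)) U"
    by (rule mv_holomorphic_onI[OF D])
  show "x \<in> U \<Longrightarrow> cpderiv v (\<lambda>x. \<phi> (F x)) x = (\<Sum>u\<in>UNIV. cpderiv u \<phi> (F x) * cpderiv v (\<lambda>x. F x $ u) x)"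
    by (rule cpderiv_eqI[OF D])
qed

subsection \<open>Functions of the Gram matrix\<close>

lemma gram_Upair_sum: "gram X $ Upair p q = (\<Sum>k\<in>UNIV. X $ (k, p) * X $ (k, q))"
  by (simp add: gram_Upair matrix_matrix_mult_def transpose_def matrix_of_def)

lemma
  fixes i j p q :: "'a::{finite,linorder}" and u :: "'a uprod"
  shows mv_holomorphic_gram: "mv_holomorphic_on (\<lambda>X. gram X $ u) U"
    and cpderiv_gram: "cpderiv (i, j) (\<lambda>X. gram X $ Upair p q) X = of_bool (j = p) * X $ (i, q) + of_bool (j = q) * X $ (i, p)"
proof -
  have hol: "mv_holomorphic_on (\<lambda>X. X $ (k, p) * X $ (k, q)) U" for k p q :: 'a and U
    by (intro mv_holomorphic_mult mv_holomorphic_nth)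
  show "mv_holomorphic_on (\<lambda>X. gram X $ u) U"
    by (cases u) (simp add: gram_Upair_sum mv_holomorphic_sum[OF hol])
  have "cpderiv (i, j) (\<lambda>X. gram X $ Upair p q) X =
      (\<Sum>k\<in>UNIV. if k = i then of_bool (j = p) * X $ (k, q) + of_bool (j = q) * X $ (k, p) else 0)"
    unfolding gram_Upair_sum
      cpderiv_sum[of UNIV "\<lambda>k X. X $ (k, p) * X $ (k, q)" UNIV X "(i, j)", OF hol UNIV_I]
    by (intro sum.cong) (auto simp: cpderiv_mult[OF mv_holomorphic_nth mv_holomorphic_nth UNIV_I] cpderiv_nth)
  then show "cpderiv (i, j) (\<lambda>X. gram X $ Upair p q) X = of_bool (j = p) * X $ (i, q) + of_bool (j = q) * X $ (i, p)"
    by simp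
qed

definition sderiv :: "'n::finite \<Rightarrow> 'n \<Rightarrow> (complex ^ 'n uprod \<Rightarrow> complex) \<Rightarrow> complex ^ 'n uprod \<Rightarrow> complex" where
  "sderiv i j \<phi> y = (if i = j then 2 else 1) * cpderiv (Upair i j) \<phi> y"

lemma sderiv_commute: "sderiv i j \<phi> y = sderiv j i \<phi> y"
  unfolding sderiv_def Upair_swap[of i j] by simp

lemma mv_holomorphic_sderiv:
  assumes "open V" "mv_holomorphic_on \<phi> V"
  shows "mv_holomorphic_on (sderiv i j \<phi>) V"
  unfolding sderiv_def
  by (intro mv_holomorphic_mult mv_holomorphic_const mv_holomorphic_cpderiv assms)

lemma cpderiv_compose_gram:
  assumes phi: "mv_holomorphic_on \<phi> V" and X: "X \<in> U" and sub: "gram ` U \<subseteq> V"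
  shows "cpderiv (i, j) (\<lambda>X. \<phi> (gram X)) X = (\<Sum>l\<in>UNIV. X $ (i, l) * sderiv j l \<phi> (gram X))"
proof -
  have "cpderiv (i, j) (\<lambda>X. \<phi> (gram X)) X =
      (\<Sum>u\<in>UNIV. cpderiv u \<phi> (gram X) * cpderiv (i, j) (\<lambda>X. gram X $ u) X)"
    by (rule cpderiv_compose[OF mv_holomorphic_gram phi sub X])
  also have "\<dots> = (\<Sum>l\<in>UNIV. cpderiv (Upair j l) \<phi> (gram X) * cpderiv (i, j) (\<lambda>X. gram X $ Upair j l) X)"
  proof (rule sum_uprod)
    fix u assume "j \<notin> set_uprod u"
    then show "cpderiv u \<phi> (gram X) * cpderiv (i, j) (\<lambda>X. gram X $ u) X = 0"
      by (cases u) (auto simp: cpderiv_gram)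
  qed
  also have "\<dots> = (\<Sum>l\<in>UNIV. X $ (i, l) * sderiv j l \<phi> (gram X))"
    by (intro sum.cong) (auto simp: cpderiv_gram sderiv_def)
  finally show ?thesis .
qed

section \<open>The generators as operators on functions\<close>

lemma weyl_algebra_uminus: "P \<in> weyl_algebra \<Longrightarrow> - P \<in> weyl_algebra"
  using weyl_algebra_pcoef_mult[of P "- 1"]
  by (simp add: One_fract_def[symmetric] rcoef_uminus flip: minus_fract)

lemma weyl_algebra_diff: "P \<in> weyl_algebra \<Longrightarrow> Q \<in> weyl_algebra \<Longrightarrow> P - Q \<in> weyl_algebra"
  using weyl_algebra_add[of P "- Q"] weyl_algebra_uminus[of Q] by simp

lemma weyl_algebra_of_nat: "of_nat n \<in> weyl_algebra"
  by (induction n) (simp_all add: weyl_algebra_add)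

lemma weyl_algebra_of_bool: "of_bool b \<in> weyl_algebra"
  by (cases b) simp_all

lemma weyl_algebra_sym_dvar: "sym_dvar i j \<in> weyl_algebra"
  by (simp add: sym_dvar_def weyl_algebra_add)

lemma weyl_algebra_g_op: "g_op i j \<in> weyl_algebra"
  unfolding g_op_def
  by (intro weyl_algebra_diff weyl_algebra_of_bool weyl_algebra_sum weyl_algebra_mult weyl_algebra_dvar)

lemma weyl_algebra_g'_op: "g'_op i j \<in> weyl_algebra"
  unfolding g'_op_def
  by (intro weyl_algebra_diff weyl_algebra_of_bool weyl_algebra_sum weyl_algebra_mult weyl_algebra_dvar)

lemma weyl_algebra_P_op: "P_op i j \<in> weyl_algebra"
  unfolding P_op_def
  by (intro weyl_algebra_diff weyl_algebra_sum weyl_algebra_mult weyl_algebra_dvar weyl_algebra_xvar)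

lemma weyl_algebra_h_op: "h_op i j \<in> weyl_algebra"
  unfolding h_op_eq
  by (intro weyl_algebra_add weyl_algebra_diff weyl_algebra_of_bool weyl_algebra_of_nat weyl_algebra_sum
      weyl_algebra_mult weyl_algebra_sym_dvar weyl_algebra_xvar)

lemma diffop_apply_of_bool:
  "open U \<Longrightarrow> mv_holomorphic_on f U \<Longrightarrow> diffop_apply (of_bool b) f x = of_bool b * f x"
  by (cases b) (simp_all add: diffop_apply_1 diffop_apply_0)

lemma diffop_apply_P_op:
  assumes "open U" "mv_holomorphic_on f U" "X \<in> U"
  shows "diffop_apply (P_op i j) f X =
    (\<Sum>k\<in>UNIV. X $ (i, k) * cpderiv (j, k) f X - X $ (j, k) * cpderiv (i, k) f X)"
proof -
  note W = weyl_algebra_diff weyl_algebra_mult weyl_algebra_dvar weyl_algebra_xvar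
  show ?thesis
    using assms(1,2) unfolding P_op_def
    by (subst diffop_apply_sum[OF assms(1,2)])
      (auto intro!: W sum.cong simp: diffop_apply_diff[OF assms(1,2)] W diffop_apply_xvar_mult[OF assms(1,2)] diffop_apply_dvar)
qed

lemma diffop_apply_g'_op:
  assumes "open U" "mv_holomorphic_on f U" "X \<in> U"
  shows "diffop_apply (g'_op i j) f X =
    of_bool (i = j) * f X - (\<Sum>k\<in>UNIV. cpderiv (k, i) (cpderiv (k, j) f) X)"
proof -
  note W = weyl_algebra_sum weyl_algebra_of_bool weyl_algebra_mult weyl_algebra_dvar
  have "diffop_apply (dvar (k, j)) f = cpderiv (k, j) f" for k
    by (simp add: fun_eq_iff diffop_apply_dvar)
  then have "diffop_apply (dvar (k, i) * dvar (k, j)) f X = cpderiv (k, i) (cpderiv (k, j) f) X" for k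
    using diffop_apply_dvar_mult[OF assms weyl_algebra_dvar] by simp
  then show ?thesis
    unfolding g'_op_def
    by (simp add: diffop_apply_diff[OF assms(1,2)] W diffop_apply_of_bool[OF assms(1,2)]
        diffop_apply_sum[OF assms(1,2)])
qed

lemma diffop_apply_sym_dvar_mult:
  assumes "open V" "mv_holomorphic_on \<phi> V" "y \<in> V" "P \<in> weyl_algebra"
  shows "diffop_apply (sym_dvar i j * P) \<phi> y = sderiv i j (diffop_apply P \<phi>) y"
  by (simp add: sym_dvar_def sderiv_def distrib_right diffop_apply_add[OF assms(1,2)]
      weyl_algebra_dvar_mult assms(4) diffop_apply_dvar_mult[OF assms])

lemma diffop_apply_h_op:
  fixes i j :: "'n::{finite,linorder}"
  assumes "open V" "mv_holomorphic_on \<phi> V" "y \<in> V"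
  shows "diffop_apply (h_op i j) \<phi> y =
    of_nat CARD('n) * sderiv i j \<phi> y - of_bool (i = j) * \<phi> y +
    (\<Sum>k\<in>UNIV. \<Sum>l\<in>UNIV. y $ Upair k l * sderiv i k (sderiv j l \<phi>) y)"
proof -
  note W = weyl_algebra_sum weyl_algebra_of_bool weyl_algebra_mult weyl_algebra_add weyl_algebra_diff
    weyl_algebra_sym_dvar weyl_algebra_xvar weyl_algebra_of_nat
  have 1: "diffop_apply (sym_dvar i j) \<phi> z = sderiv i j \<phi> z" if "z \<in> V" for i j z
  proof -
    have "diffop_apply 1 \<phi> = \<phi>"
      using diffop_apply_1[OF assms(1,2)] by auto
    then show ?thesis
      using diffop_apply_sym_dvar_mult[OF assms(1,2) that weyl_algebra_1, of i j] by simp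
  qed
  have 2: "diffop_apply (sym_dvar i k * sym_dvar j l) \<phi> y = sderiv i k (sderiv j l \<phi>) y" for k l
  proof -
    have "cpderiv u (diffop_apply (sym_dvar j l) \<phi>) y = cpderiv u (sderiv j l \<phi>) y" for u
      by (rule cpderiv_cong[OF assms(1,3) 1])
    then show ?thesis
      using diffop_apply_sym_dvar_mult[OF assms weyl_algebra_sym_dvar, of i k j l]
      by (simp add: sderiv_def[of i k])
  qed
  have 3: "diffop_apply (of_nat n * P) \<phi> y = of_nat n * diffop_apply P \<phi> y" if "P \<in> weyl_algebra" for n P
    by (induction n) (simp_all add: distrib_right diffop_apply_0[OF assms(1,2)] diffop_apply_add[OF assms(1,2)] W that)
  show ?thesis
    unfolding h_op_eq
    by (simp add: diffop_apply_add[OF assms(1,2)] diffop_apply_diff[OF assms(1,2)]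
        diffop_apply_sum[OF assms(1,2)] diffop_apply_xvar_mult[OF assms(1,2)]
        diffop_apply_of_bool[OF assms(1,2)] W 1 2 3 assms(3))
qed

text \<open>The analytic counterpart of \<open>act_P_op\<close> and \<open>act_g'_op\<close>, with
  the same computation carried out on functions.\<close>

lemma diffop_apply_compose_gram:
  fixes U :: "(complex ^ ('n::{finite,linorder} \<times> 'n)) set"
  assumes U: "open U" and V: "open V" and phi: "mv_holomorphic_on \<phi> V" and sub: "gram ` U \<subseteq> V" and X: "X \<in> U"
  shows "diffop_apply (P_op i j) (\<lambda>X. \<phi> (gram X)) X = 0"
    and "diffop_apply (g'_op i j) (\<lambda>X. \<phi> (gram X)) X = - diffop_apply (h_op i j) \<phi> (gram X)"
proof -
  have hol: "mv_holomorphic_on (\<lambda>X. \<phi> (gram X)) U"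
    by (rule mv_holomorphic_compose[OF mv_holomorphic_gram phi sub])
  note chain = cpderiv_compose_gram[OF _ _ sub]
  have "(\<Sum>k\<in>UNIV. X $ (i, k) * cpderiv (j, k) (\<lambda>X. \<phi> (gram X)) X) =
      (\<Sum>k\<in>UNIV. \<Sum>l\<in>UNIV. X $ (i, k) * X $ (j, l) * sderiv k l \<phi> (gram X))" for i j
    by (simp add: chain[OF phi X] sum_distrib_left mult.assoc)
  moreover have "(\<Sum>k\<in>UNIV. \<Sum>l\<in>UNIV. X $ (i, k) * X $ (j, l) * sderiv k l \<phi> (gram X)) =
      (\<Sum>k\<in>UNIV. \<Sum>l\<in>UNIV. X $ (j, k) * X $ (i, l) * sderiv k l \<phi> (gram X))"
    by (subst sum.swap) (simp add: sderiv_commute mult.commute)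
  ultimately show "diffop_apply (P_op i j) (\<lambda>X. \<phi> (gram X)) X = 0"
    by (simp add: diffop_apply_P_op[OF U hol X] sum_subtractf)
  have second: "cpderiv (k, i) (cpderiv (k, j) (\<lambda>X. \<phi> (gram X))) X = sderiv i j \<phi> (gram X) +
      (\<Sum>l\<in>UNIV. \<Sum>m\<in>UNIV. X $ (k, l) * X $ (k, m) * sderiv i m (sderiv j l \<phi>) (gram X))" for k
  proof -
    have s: "mv_holomorphic_on (sderiv j l \<phi>) V" for l
      by (rule mv_holomorphic_sderiv[OF V phi])
    have hols: "mv_holomorphic_on (\<lambda>X. sderiv j l \<phi> (gram X)) U" for l
      by (rule mv_holomorphic_compose[OF mv_holomorphic_gram s sub])
    have holt: "mv_holomorphic_on (\<lambda>X. X $ (k, l) * sderiv j l \<phi> (gram X)) U" for l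
      by (intro mv_holomorphic_mult mv_holomorphic_nth hols)
    have "cpderiv (k, i) (cpderiv (k, j) (\<lambda>X. \<phi> (gram X))) X =
        cpderiv (k, i) (\<lambda>X. \<Sum>l\<in>UNIV. X $ (k, l) * sderiv j l \<phi> (gram X)) X"
      by (rule cpderiv_cong[OF U X chain[OF phi]])
    also have "\<dots> = (\<Sum>l\<in>UNIV. (if l = i then sderiv j l \<phi> (gram X) else 0) +
        X $ (k, l) * (\<Sum>m\<in>UNIV. X $ (k, m) * sderiv i m (sderiv j l \<phi>) (gram X)))"
      unfolding cpderiv_sum[OF holt X] cpderiv_mult[OF mv_holomorphic_nth hols X] chain[OF s X]
      by (intro sum.cong) (auto simp: cpderiv_nth)
    finally show ?thesis
      by (simp add: sum.distrib sderiv_commute[of j i] sum_distrib_left mult.assoc)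
  qed
  have "(\<Sum>k\<in>UNIV. \<Sum>l\<in>UNIV. \<Sum>m\<in>UNIV. X $ (k, l) * X $ (k, m) * sderiv i m (sderiv j l \<phi>) (gram X)) =
      (\<Sum>m\<in>UNIV. \<Sum>l\<in>UNIV. \<Sum>k\<in>UNIV. X $ (k, l) * X $ (k, m) * sderiv i m (sderiv j l \<phi>) (gram X))"
    by (subst sum.swap, subst (2) sum.swap, subst sum.swap) simp
  also have "\<dots> = (\<Sum>m\<in>UNIV. \<Sum>l\<in>UNIV. gram X $ Upair m l * sderiv i m (sderiv j l \<phi>) (gram X))"
    by (simp add: gram_Upair_sum sum_distrib_left mult.commute)
  finally have "(\<Sum>k\<in>UNIV. cpderiv (k, i) (cpderiv (k, j) (\<lambda>X. \<phi> (gram X))) X) =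
      of_nat CARD('n) * sderiv i j \<phi> (gram X) + \<dots>"
    by (simp add: second sum.distrib)
  moreover have "gram X \<in> V"
    using X sub by auto
  ultimately show "diffop_apply (g'_op i j) (\<lambda>X. \<phi> (gram X)) X = - diffop_apply (h_op i j) \<phi> (gram X)"
    by (simp add: diffop_apply_g'_op[OF U hol X] diffop_apply_h_op[OF V phi])
qed

text \<open>Trades \<open>g_op\<close> for \<open>g'_op\<close>, which the chain rule translates
  into \<open>h_op\<close>. The exchange takes place in ideals of the Weyl algebra itself, since the
  multipliers in the matrix identity are polynomials in the derivations.\<close>

lemma solution_on_ideal_J'_iff:
  fixes f :: "complex ^ ('n::{finite,linorder} \<times> 'n) \<Rightarrow> complex"
  assumes U: "open U" and hol: "mv_holomorphic_on f U"
  shows "solution_on ideal_J' U f \<longleftrightarrow>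
    (\<forall>X\<in>U. \<forall>i j. diffop_apply (g'_op i j) f X = 0 \<and> diffop_apply (P_op i j) f X = 0)"
proof (intro iffI ballI allI conjI)
  fix X and i j :: 'n assume sol: "solution_on ideal_J' U f" and X: "X \<in> U"
  have "g'_op i j \<in> ideal_J'"
  proof (rule g'_op_in_g_ideal)
    show "g_op i j \<in> ideal_J'" for i j :: 'n
      by (rule g_op_in_ideal_J')
  qed (auto simp: ideal_J'_def intro: left_span_0 weyl_ideal_add weyl_ideal_poly_in_dvar)
  then show "diffop_apply (g'_op i j) f X = 0"
    using sol X unfolding solution_on_def by blast
  show "diffop_apply (P_op i j) f X = 0"
    using sol X P_op_in_ideal_J'[of i j] unfolding solution_on_def by blast
next
  assume zero: "\<forall>X\<in>U. \<forall>i j. diffop_apply (g'_op i j) f X = 0 \<and> diffop_apply (P_op i j) f X = 0"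
  let ?G = "{g'_op i j |i j :: 'n. True}"
  have "solution_on (weyl_ideal ?G) U f"
    using zero by (subst solution_on_weyl_ideal[OF U hol]) (auto simp: solution_on_def weyl_algebra_g'_op)
  moreover have "g_op i j \<in> weyl_ideal ?G" for i j
  proof (rule g_op_in_g'_ideal)
    show "g'_op i j \<in> weyl_ideal ?G" for i j
      by (rule left_span_base[OF weyl_algebra_1]) auto
  qed (auto intro: left_span_0 weyl_ideal_add weyl_ideal_poly_in_dvar)
  ultimately have "diffop_apply (g_op i j) f X = 0" if "X \<in> U" for i j X
    using that unfolding solution_on_def by blast
  then show "solution_on ideal_J' U f"
    unfolding ideal_J'_def using zero
    by (subst solution_on_weyl_ideal[OF U hol])
      (auto simp: solution_on_def weyl_algebra_g_op weyl_algebra_P_op)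
qed

lemma solution_on_ideal_K_iff:
  assumes V: "open V" and hol: "mv_holomorphic_on \<phi> V"
  shows "solution_on ideal_K V \<phi> \<longleftrightarrow> (\<forall>y\<in>V. \<forall>i j. diffop_apply (h_op i j) \<phi> y = 0)"
proof -
  have "solution_on ideal_K V \<phi> \<longleftrightarrow> solution_on {h_op i j |i j. i \<le> j} V \<phi>"
    unfolding ideal_K_def by (rule solution_on_weyl_ideal[OF V hol]) (auto simp: weyl_algebra_h_op)
  also have "\<dots> \<longleftrightarrow> (\<forall>y\<in>V. \<forall>i j. i \<le> j \<longrightarrow> diffop_apply (h_op i j) \<phi> y = 0)"
    unfolding solution_on_def by blast
  also have "\<dots> \<longleftrightarrow> (\<forall>y\<in>V. \<forall>i j. diffop_apply (h_op i j) \<phi> y = 0)"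
    using h_op_commute by (metis le_cases)
  finally show ?thesis .
qed

lemma solution_compose_gram:
  fixes U :: "(complex ^ ('n::{finite,linorder} \<times> 'n)) set"
  assumes U: "open U" and V: "open V" and sub: "gram ` U \<subseteq> V" and phi: "mv_holomorphic_on \<phi> V"
    and sol: "solution_on ideal_K V \<phi>"
  shows "mv_holomorphic_on (\<lambda>X. \<phi> (gram X)) U" "solution_on ideal_J' U (\<lambda>X. \<phi> (gram X))"
proof -
  show hol: "mv_holomorphic_on (\<lambda>X. \<phi> (gram X)) U"
    by (rule mv_holomorphic_compose[OF mv_holomorphic_gram phi sub])
  have "\<forall>y\<in>V. \<forall>i j. diffop_apply (h_op i j) \<phi> y = 0"
    using sol unfolding solution_on_ideal_K_iff[OF V phi] .
  then show "solution_on ideal_J' U (\<lambda>X. \<phi> (gram X))"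
    unfolding solution_on_ideal_J'_iff[OF U hol]
    using diffop_apply_compose_gram[OF U V phi sub] sub by auto
qed

text \<open>The inverse function theorem yields real derivatives; complex homogeneity turns them
  into complex ones, with the values on the unit vectors as coefficients.\<close>

lemma mv_holomorphic_complex_linear:
  assumes D: "\<And>x. x \<in> U \<Longrightarrow> (f has_derivative D x) (at x)"
    and cl: "\<And>x c h. x \<in> U \<Longrightarrow> D x (c *s h) = c * D x h"
  shows "mv_holomorphic_on f U"
proof (rule mv_holomorphic_onI)
  fix x assume x: "x \<in> U"
  have "linear (D x)"
    using D[OF x] by (rule has_derivative_linear)
  then have sum: "D x (\<Sum>v\<in>UNIV. h $ v *s axis v 1) = (\<Sum>v\<in>UNIV. D x (h $ v *s axis v 1))" for h
    by (rule linear_sum)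
  have *: "D x h = (\<Sum>v\<in>UNIV. D x (axis v 1) * h $ v)" for h
    using sum[of h] unfolding basis_expansion cl[OF x] by (simp only: mult.commute)
  from D[OF x] show "(f has_derivative (\<lambda>h. \<Sum>v\<in>UNIV. D x (axis v 1) * h $ v)) (at x)"
    by (rule has_derivative_eq_rhs) (rule ext, rule *)
qed

subsection \<open>Local solutions are functions of the Gram matrix\<close>

text \<open>
  The map \<open>slice T\<close> sends \<open>X\<close> to $X^{\mathrm t}X + T^{\mathrm t}X - X^{\mathrm t}T$, whose symmetric part is the Gram
  matrix. Its derivative at \<open>T\<close> is $H \mapsto 2T^{\mathrm t}H$, so it is a local chart whose fibres over the
  symmetric part are the fibres of \<open>gram\<close>.
\<close>

definition slice :: "complex ^ ('n::finite \<times> 'n) \<Rightarrow> complex ^ ('n \<times> 'n) \<Rightarrow> complex ^ ('n \<times> 'n)" where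
  "slice T X = (\<chi> p. \<Sum>k\<in>UNIV. X $ (k, fst p) * X $ (k, snd p) +
     T $ (k, fst p) * X $ (k, snd p) - X $ (k, fst p) * T $ (k, snd p))"

definition slice_deriv ::
  "complex ^ ('n::finite \<times> 'n) \<Rightarrow> complex ^ ('n \<times> 'n) \<Rightarrow> complex ^ ('n \<times> 'n) \<Rightarrow> complex ^ ('n \<times> 'n)" where
  "slice_deriv T X H = (\<chi> p. \<Sum>k\<in>UNIV. H $ (k, fst p) * X $ (k, snd p) + X $ (k, fst p) * H $ (k, snd p) +
     T $ (k, fst p) * H $ (k, snd p) - H $ (k, fst p) * T $ (k, snd p))"

definition swap_mat :: "complex ^ ('n::finite \<times> 'n) \<Rightarrow> complex ^ ('n \<times> 'n)" where
  "swap_mat M = (\<chi> p. M $ prod.swap p)"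

definition sym_of :: "complex ^ 'n::finite uprod \<Rightarrow> complex ^ ('n \<times> 'n)" where
  "sym_of y = (\<chi> p. y $ Upair (fst p) (snd p))"

lemma bounded_linear_slice_deriv: "bounded_linear (slice_deriv T X)"
  unfolding linear_conv_bounded_linear[symmetric]
  by (rule linearI)
    (simp_all add: slice_deriv_def vec_eq_iff algebra_simps sum.distrib sum_subtractf scaleR_sum_right)

lemma slice_deriv_scale: "slice_deriv T X (c *s H) = c *s slice_deriv T X H"
  by (simp add: slice_deriv_def vec_eq_iff sum_distrib_left algebra_simps)

lemma slice_has_derivative: "(slice T has_derivative slice_deriv T X) (at X)"
proof (rule has_derivative_vecI)
  fix p
  show "((\<lambda>X. slice T X $ p) has_derivative (\<lambda>h. slice_deriv T X h $ p)) (at X)"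
    unfolding slice_def slice_deriv_def vec_lambda_beta
    by (intro has_derivative_sum) (auto intro!: derivative_eq_intros simp: algebra_simps)
qed

lemma continuous_on_slice_deriv: "continuous_on S (\<lambda>X. Blinfun (slice_deriv T X))"
proof (rule continuous_on_blinfun_componentwise)
  fix i :: "complex ^ ('a \<times> 'a)"
  show "continuous_on S (\<lambda>X. blinfun_apply (Blinfun (slice_deriv T X)) i)"
    unfolding bounded_linear_Blinfun_apply[OF bounded_linear_slice_deriv] slice_deriv_def
    by (intro continuous_intros)
qed

text \<open>At X = T the terms with H^t T cancel, leaving H \<mapsto> 2 T^t H, with inverse M
  \<mapsto> T^(-t) M / 2.\<close>

lemma slice_deriv_inverse:
  assumes "det (matrix_of T) \<noteq> 0"
  obtains h where "bounded_linear h" "\<And>H. h (slice_deriv T T H) = H"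
proof -
  define S where "S = matrix_inv (matrix_of T)"
  have "invertible (matrix_of T)"
    using assms by (simp add: invertible_det_nz)
  then have S: "matrix_of T ** S = mat 1"
    unfolding S_def matrix_inv_def invertible_def by (metis (mono_tags, lifting) someI_ex)
  define h where "h M = (\<chi> p. 1 / 2 * (\<Sum>i\<in>UNIV. S $ i $ fst p * M $ (i, snd p)))" for M :: "complex ^ ('a \<times> 'a)"
  have "linear h"
    by (rule linearI)
      (simp_all add: h_def vec_eq_iff algebra_simps sum.distrib scaleR_sum_right)
  then have "bounded_linear h"
    by (simp add: linear_conv_bounded_linear)
  moreover have "h (slice_deriv T T H) = H" for H
  proof -
    have "h (slice_deriv T T H) $ (k, j) = H $ (k, j)" for k j
    proof -
      have "h (slice_deriv T T H) $ (k, j) = (\<Sum>i\<in>UNIV. \<Sum>l\<in>UNIV. S $ i $ k * (T $ (l, i) * H $ (l, j)))"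
        unfolding h_def slice_deriv_def vec_lambda_beta fst_conv snd_conv
        by (simp add: sum_distrib_left algebra_simps)
      also have "\<dots> = (\<Sum>l\<in>UNIV. (matrix_of T ** S) $ l $ k * H $ (l, j))"
        unfolding matrix_matrix_mult_def vec_lambda_beta matrix_of_def sum_distrib_right
        by (subst sum.swap) (simp add: mult_ac)
      also have "\<dots> = H $ (k, j)"
        unfolding S by (simp add: mat_def if_distrib[of "\<lambda>x. x * _"] cong: if_cong)
      finally show ?thesis .
    qed
    then show ?thesis
      by (auto simp: vec_eq_iff)
  qed
  ultimately show ?thesis
    by (rule that)
qed

text \<open>Since transposition also fixes \<open>slice T T\<close>, it maps balls around that point
  to themselves.\<close>

lemma dist_swap_mat: "dist (swap_mat M) (swap_mat N) = dist M N"
proof -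
  have "(\<Sum>p\<in>UNIV. (norm ((M - N) $ prod.swap p))\<^sup>2) = (\<Sum>p\<in>UNIV. (norm ((M - N) $ p))\<^sup>2)"
    by (rule sum.reindex_bij_betw) (rule bij_swap)
  then show ?thesis
    by (simp add: dist_norm norm_vec_def L2_set_def swap_mat_def)
qed

lemma slice_plus_swap: "slice T X + swap_mat (slice T X) = 2 *\<^sub>R sym_of (gram X)"
  by (auto simp: vec_eq_iff slice_def swap_mat_def sym_of_def gram_Upair_sum scaleR_conv_of_real
      sum_distrib_left sum.distrib[symmetric] algebra_simps simp del: sum.distrib intro!: sum.cong)

lemma swap_slice_self: "swap_mat (slice T T) = slice T T"
  by (simp add: vec_eq_iff slice_def swap_mat_def mult.commute)

lemma swap_sym_of: "swap_mat (sym_of y) = sym_of y"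
  by (auto simp: vec_eq_iff sym_of_def swap_mat_def intro!: arg_cong[of _ _ "($) y"])

lemma inj_sym_of: "sym_of y = sym_of z \<Longrightarrow> y = z"
  unfolding vec_eq_iff
proof
  fix u assume "\<forall>i. sym_of y $ i = sym_of z $ i"
  then show "y $ u = z $ u"
    by (cases u) (auto simp: sym_of_def)
qed

text \<open>A vector H tangent to the fibre is B X with B antisymmetric, whereas the equations for d
  make \<Sum>_j X_kj d_ij symmetric in i and k; such a pairing vanishes.\<close>

lemma derivative_along_fibre:
  fixes X H :: "complex ^ ('n::finite \<times> 'n)" and d :: "'n \<times> 'n \<Rightarrow> complex"
  assumes X: "det (matrix_of X) \<noteq> 0"
    and H: "\<And>i j. (\<Sum>k\<in>UNIV. H $ (k, i) * X $ (k, j) + X $ (k, i) * H $ (k, j)) = 0"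
    and d: "\<And>i j. (\<Sum>k\<in>UNIV. X $ (i, k) * d (j, k)) = (\<Sum>k\<in>UNIV. X $ (j, k) * d (i, k))"
  shows "(\<Sum>p\<in>UNIV. d p * H $ p) = 0"
proof -
  have "invertible (matrix_of X)"
    using X by (simp add: invertible_det_nz)
  then obtain S where S: "S ** matrix_of X = mat 1" "matrix_of X ** S = mat 1"
    unfolding invertible_def by blast
  have "transpose (matrix_of H) ** matrix_of X = - (transpose (matrix_of X) ** matrix_of H)"
    using H by (simp add: vec_eq_iff matrix_matrix_mult_def transpose_def matrix_of_def
        eq_neg_iff_add_eq_0 sum.distrib)
  then obtain B where B: "matrix_of H = B ** matrix_of X" and anti: "transpose B = - B"
    using antisymmetric_factor[OF S] by blast
  have anti: "B $ k $ i = - (B $ i $ k)" for i k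
    using arg_cong[OF anti, of "\<lambda>M. M $ i $ k"] by (simp add: transpose_def)
  let ?s = "\<Sum>i\<in>UNIV. \<Sum>k\<in>UNIV. B $ i $ k * (\<Sum>j\<in>UNIV. X $ (k, j) * d (i, j))"
  have *: "H $ (i, j) = (\<Sum>k\<in>UNIV. B $ i $ k * X $ (k, j))" for i j
  proof -
    have "matrix_of H $ i $ j = (B ** matrix_of X) $ i $ j"
      by (simp only: B)
    then show ?thesis
      by (simp add: matrix_matrix_mult_def matrix_of_def)
  qed
  have "(\<Sum>p\<in>UNIV. d p * H $ p) = (\<Sum>i\<in>UNIV. \<Sum>j\<in>UNIV. d (i, j) * H $ (i, j))"
    by (simp add: sum.cartesian_product)
  also have "\<dots> = (\<Sum>i\<in>UNIV. \<Sum>j\<in>UNIV. \<Sum>k\<in>UNIV. B $ i $ k * (X $ (k, j) * d (i, j)))"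
    by (simp add: * sum_distrib_left mult_ac)
  also have "\<dots> = ?s"
    unfolding sum_distrib_left by (intro sum.cong refl sum.swap)
  finally have eq: "(\<Sum>p\<in>UNIV. d p * H $ p) = ?s" .
  have "?s = (\<Sum>i\<in>UNIV. \<Sum>k\<in>UNIV. B $ k $ i * (\<Sum>j\<in>UNIV. X $ (i, j) * d (k, j)))"
    by (rule sum.swap)
  also have "\<dots> = - ?s"
    by (subst anti, subst d) (simp add: sum_negf)
  finally show ?thesis
    unfolding eq by simp
qed

theorem local_function_of_gram:
  fixes f :: "complex ^ ('n::{finite,linorder} \<times> 'n) \<Rightarrow> complex"
  assumes U: "open U" and inv: "\<forall>X\<in>U. det (matrix_of X) \<noteq> 0" and hol: "mv_holomorphic_on f U"
    and sol: "solution_on ideal_J' U f" and T: "T \<in> U"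
  shows "\<exists>r>0. ball T r \<subseteq> U \<and>
    (\<exists>V \<phi>. open V \<and> gram ` ball T r \<subseteq> V \<and> mv_holomorphic_on \<phi> V \<and>
      solution_on ideal_K V \<phi> \<and> (\<forall>X\<in>ball T r. f X = \<phi> (gram X)))"
proof -
  \<comment> \<open>The inverse function theorem asks for a left inverse of the derivative at T,
    which det(T) \<noteq> 0 provides.\<close>
  obtain h where h: "bounded_linear h" "\<And>H. h (slice_deriv T T H) = H"
    using slice_deriv_inverse inv T by blast
  note app = bounded_linear_Blinfun_apply[OF bounded_linear_slice_deriv]
  have "Blinfun h o\<^sub>L Blinfun (slice_deriv T T) = id_blinfun"
    by (rule blinfun_eqI) (simp add: app bounded_linear_Blinfun_apply[OF h(1)] h(2))
  then obtain U' V' g g' where U': "open U'" "U' \<subseteq> U" "T \<in> U'" and V': "open V'" "slice T T \<in> V'"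
    and homeo: "homeomorphism U' V' (slice T) g"
    and g: "\<And>y. y \<in> V' \<Longrightarrow> (g has_derivative (g' y)) (at y)"
    and g': "\<And>y. y \<in> V' \<Longrightarrow> g' y = inv (slice_deriv T (g y))"
    and bij: "\<And>y. y \<in> V' \<Longrightarrow> bij (slice_deriv T (g y))"
    using inverse_function_theorem[OF U _ continuous_on_slice_deriv T, of "slice T" T "Blinfun h"]
      slice_has_derivative unfolding app by blast
  have gs: "g (slice T X) = X" "slice T X \<in> V'" if "X \<in> U'" for X
    using homeo that by (auto simp: homeomorphism_def)
  have sg: "slice T (g y) = y" "g y \<in> U'" if "y \<in> V'" for y
    using homeo that by (auto simp: homeomorphism_def)
  have g'_inv: "slice_deriv T (g y) (g' y H) = H" if "y \<in> V'" for y H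
    using bij[OF that] by (simp add: g'[OF that] bij_is_surj surj_f_inv_f)
  obtain e where e: "e > 0" and ball: "ball (slice T T) e \<subseteq> V'"
    using V' open_contains_ball by blast
  let ?N = "ball (slice T T) e"
  have swap_N: "swap_mat M \<in> ?N" if "M \<in> ?N" for M
    using that dist_swap_mat[of "slice T T" M] by (simp add: swap_slice_self)
  have const: "f (g M) = f (g ((1 / 2) *\<^sub>R (M + swap_mat M)))" if M: "M \<in> ?N" for M
  proof -
    \<comment> \<open>The segment from M^t to M: its symmetric part is constant, and its midpoint is
      that symmetric part.\<close>
    define c where "c t = swap_mat M + t *\<^sub>R (M - swap_mat M)" for t :: real
    have c: "c t \<in> ?N" if "t \<in> {0..1}" for t
    proof -
      have "c t = (1 - t) *\<^sub>R swap_mat M + t *\<^sub>R M"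
        by (simp add: c_def algebra_simps)
      also have "\<dots> \<in> ?N"
        using that by (intro convexD[OF convex_ball swap_N[OF M] M]) auto
      finally show ?thesis .
    qed
    have "((\<lambda>t. f (g (c t))) has_derivative (\<lambda>_. 0)) (at t within {0..1})" if t: "t \<in> {0..1}" for t
    proof -
      have ct: "c t \<in> V'"
        using c[OF t] ball by auto
      then have X: "g (c t) \<in> U"
        using sg(2) U'(2) by auto
      let ?X = "g (c t)" and ?H = "g' (c t) (M - swap_mat M)"
      have 1: "(c has_derivative (\<lambda>s. s *\<^sub>R (M - swap_mat M))) (at t)"
        unfolding c_def by (auto intro!: derivative_eq_intros)
      have "((\<lambda>t. f (g (c t))) has_derivative (\<lambda>s. \<Sum>p\<in>UNIV. cpderiv p f ?X * g' (c t) (s *\<^sub>R (M - swap_mat M)) $ p)) (at t)"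
        by (rule has_derivative_compose[OF has_derivative_compose[OF 1 g[OF ct]] mv_holomorphic_has_derivative[OF hol X]])
      moreover have "g' (c t) (s *\<^sub>R (M - swap_mat M)) = s *\<^sub>R ?H" for s
        using g[OF ct] by (simp add: has_derivative_linear linear_scale)
      \<comment> \<open>The velocity M - M^t is antisymmetric, so \<open>?H\<close> is tangent to
        the fibre of the Gram map through \<open>?X\<close>.\<close>
      moreover have "(\<Sum>p\<in>UNIV. cpderiv p f ?X * ?H $ p) = 0"
      proof (rule derivative_along_fibre)
        show "det (matrix_of ?X) \<noteq> 0"
          using inv X by auto
        show "(\<Sum>k\<in>UNIV. ?X $ (i, k) * cpderiv (j, k) f ?X) = (\<Sum>k\<in>UNIV. ?X $ (j, k) * cpderiv (i, k) f ?X)" for i j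
          using sol X unfolding solution_on_ideal_J'_iff[OF U hol]
          by (auto simp: diffop_apply_P_op[OF U hol X] sum_subtractf)
        fix i j
        have "slice_deriv T ?X ?H $ (i, j) + slice_deriv T ?X ?H $ (j, i) = 0"
          unfolding g'_inv[OF ct] by (simp add: swap_mat_def)
        moreover have "slice_deriv T ?X ?H $ (i, j) + slice_deriv T ?X ?H $ (j, i) =
            2 * (\<Sum>k\<in>UNIV. ?H $ (k, i) * ?X $ (k, j) + ?X $ (k, i) * ?H $ (k, j))"
          unfolding slice_deriv_def vec_lambda_beta fst_conv snd_conv sum_distrib_left sum.distrib[symmetric]
          by (intro sum.cong) (simp_all add: algebra_simps)
        ultimately show "(\<Sum>k\<in>UNIV. ?H $ (k, i) * ?X $ (k, j) + ?X $ (k, i) * ?H $ (k, j)) = 0"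
          by simp
      qed
      ultimately have "((\<lambda>t. f (g (c t))) has_derivative (\<lambda>s. 0)) (at t)"
        by (simp add: mult_scaleR_right flip: scaleR_sum_right)
      then show ?thesis
        by (rule has_derivative_at_withinI)
    qed
    then have "f (g (c 1)) = f (g (c (1 / 2)))"
      by (intro has_derivative_zero_unique[of "{0..1}" "\<lambda>t. f (g (c t))"]) auto
    moreover have "c (1 / 2) = (1 / 2) *\<^sub>R (M + swap_mat M)"
    proof -
      have "(1 / 2) *\<^sub>R (M + X) - (1 / 2) *\<^sub>R (M - X) = X" for X
        by (simp add: scaleR_right_distrib scaleR_right_diff_distrib flip: scaleR_left_distrib)
      then show ?thesis
        unfolding c_def diff_eq_eq ..
    qed
    ultimately show ?thesis
      by (simp add: c_def)
  qed
  \<comment> \<open>y is read as a symmetric matrix, that is, a point of the chart with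
    antisymmetric part 0; applying g to it selects one point over y.\<close>
  define V where "V = sym_of -` ?N"
  define \<phi> where "\<phi> y = f (g (sym_of y))" for y
  have open_V: "open V"
    unfolding V_def sym_of_def by (intro open_vimage open_ball continuous_intros)
  have fphi: "f X = \<phi> (gram X)" "gram X \<in> V" if X: "X \<in> U'" "slice T X \<in> ?N" for X
  proof -
    have eq: "(1 / 2) *\<^sub>R (slice T X + swap_mat (slice T X)) = sym_of (gram X)"
      by (simp add: slice_plus_swap)
    then show "f X = \<phi> (gram X)"
      using const[OF X(2)] by (simp add: gs(1)[OF X(1)] \<phi>_def)
    have "(1 / 2) *\<^sub>R slice T X + (1 / 2) *\<^sub>R swap_mat (slice T X) \<in> ?N"
      by (intro convexD[OF convex_ball X(2) swap_N[OF X(2)]]) auto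
    then show "gram X \<in> V"
      using eq by (simp add: V_def scaleR_right_distrib)
  qed
  \<comment> \<open>The derivative of g inverts the complex-linear \<open>slice_deriv\<close>, hence
    is complex-homogeneous.\<close>
  have hol_g: "mv_holomorphic_on (\<lambda>y. g y $ p) V'" for p
  proof (rule mv_holomorphic_complex_linear[of _ _ "\<lambda>y h. g' y h $ p"])
    fix y assume y: "y \<in> V'"
    show "((\<lambda>y. g y $ p) has_derivative (\<lambda>h. g' y h $ p)) (at y)"
      by (rule has_derivative_vec_nth[OF g[OF y]])
    fix c H
    have "slice_deriv T (g y) (g' y (c *s H)) = slice_deriv T (g y) (c *s g' y H)"
      by (simp add: slice_deriv_scale g'_inv[OF y])
    then have "g' y (c *s H) = c *s g' y H"
      using bij_is_inj[OF bij[OF y]] by (simp add: inj_eq)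
    then show "g' y (c *s H) $ p = c * g' y H $ p"
      by simp
  qed
  have hol_phi: "mv_holomorphic_on \<phi> V"
  proof -
    have fg: "mv_holomorphic_on (\<lambda>M. f (g M)) V'"
      using sg(2) U'(2) by (intro mv_holomorphic_compose[OF hol_g hol]) auto
    have sym: "mv_holomorphic_on (\<lambda>y. sym_of y $ p) V" for p
      by (simp add: sym_of_def)
    have "sym_of ` V \<subseteq> V'"
      using ball by (auto simp: V_def)
    with sym fg show ?thesis
      unfolding \<phi>_def by (rule mv_holomorphic_compose)
  qed
  \<comment> \<open>Every y in V is the Gram matrix of a point of W, which the ball chosen inside W
    need not provide; so the equations for \<phi> are derived on W.\<close>
  define W where "W = U' \<inter> slice T -` ?N"
  have "open W"
    unfolding W_def slice_def by (intro open_Int U'(1) open_vimage open_ball continuous_intros)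
  moreover have "T \<in> W"
    using e by (simp add: W_def U'(3))
  ultimately obtain r where r: "r > 0" "ball T r \<subseteq> W"
    using open_contains_ball by blast
  have W_gram: "gram ` W \<subseteq> V" and W_eq: "\<And>X. X \<in> W \<Longrightarrow> f X = \<phi> (gram X)" and W_U: "W \<subseteq> U"
    using fphi U'(2) by (auto simp: W_def)
  have "solution_on ideal_K V \<phi>"
    unfolding solution_on_ideal_K_iff[OF open_V hol_phi]
  proof (intro ballI allI)
    fix y i j assume y: "y \<in> V"
    define X where "X = g (sym_of y)"
    have s: "sym_of y \<in> V'"
      using y ball by (auto simp: V_def)
    have X: "X \<in> W"
      using y sg[OF s] by (simp add: W_def X_def V_def)
    have "2 *\<^sub>R sym_of (gram X) = 2 *\<^sub>R sym_of y"
      unfolding slice_plus_swap[of T, symmetric] X_def sg(1)[OF s] swap_sym_of by (simp add: scaleR_2)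
    then have gX: "gram X = y"
      by (intro inj_sym_of) simp
    have "diffop_apply (g'_op i j) f X = diffop_apply (g'_op i j) (\<lambda>X. \<phi> (gram X)) X"
      by (rule diffop_apply_cong[OF \<open>open W\<close> W_eq X])
    also have "\<dots> = - diffop_apply (h_op i j) \<phi> y"
      using diffop_apply_compose_gram(2)[OF \<open>open W\<close> open_V hol_phi W_gram X] by (simp add: gX)
    also have "diffop_apply (g'_op i j) f X = 0"
      using sol X W_U unfolding solution_on_ideal_J'_iff[OF U hol] by blast
    finally show "diffop_apply (h_op i j) \<phi> y = 0"
      by simp
  qed
  then show ?thesis
    using r W_gram W_eq W_U open_V hol_phi
    by (intro exI[of _ r] exI[of _ V] exI[of _ \<phi>] conjI) blast+
qed

text \<open>The description is local and away from det = 0 for a reason visible at n = 1: e^t solves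
  J', but is a function of t^2 only near points t \<noteq> 0, with \<phi> a branch of
  exp(sqrt(y)).\<close>

theorem theorem3p4:
  shows
    "(\<forall>U (f :: complex ^ ('n::{finite,linorder} \<times> 'n) \<Rightarrow> complex).
        open U \<and> (\<forall>\<Theta>\<in>U. det (matrix_of \<Theta>) \<noteq> 0) \<and> mv_holomorphic_on f U \<longrightarrow>
        (solution_on ideal_J' U f \<longleftrightarrow>
          (\<forall>\<Theta>\<in>U. \<exists>r>0. ball \<Theta> r \<subseteq> U \<and>
            (\<exists>V \<phi>. open V \<and> gram ` ball \<Theta> r \<subseteq> V \<and> mv_holomorphic_on \<phi> V \<and>
              solution_on ideal_K V \<phi> \<and> (\<forall>X\<in>ball \<Theta> r. f X = \<phi> (gram X)))))) \<and>
     (\<forall>(U :: (complex ^ ('n \<times> 'n)) set) V \<phi>.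
        open U \<and> open V \<and> gram ` U \<subseteq> V \<and> mv_holomorphic_on \<phi> V \<and> solution_on ideal_K V \<phi> \<longrightarrow>
        mv_holomorphic_on (\<lambda>X. \<phi> (gram X)) U \<and> solution_on ideal_J' U (\<lambda>X. \<phi> (gram X))) \<and>
     holonomic_rank (ideal_K :: 'n uprod ratweyl set) =
       2 * holonomic_rank (ideal_J :: ('n \<times> 'n) ratweyl set)"
proof (intro conjI allI impI iffI ballI; (elim conjE)?)
  fix U :: "(complex ^ ('n \<times> 'n)) set" and f \<Theta>
  assume "open U" "\<forall>\<Theta>\<in>U. det (matrix_of \<Theta>) \<noteq> 0" "mv_holomorphic_on f U" "solution_on ideal_J' U f" "\<Theta> \<in> U"
  then show "\<exists>r>0. ball \<Theta> r \<subseteq> U \<and>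
      (\<exists>V \<phi>. open V \<and> gram ` ball \<Theta> r \<subseteq> V \<and> mv_holomorphic_on \<phi> V \<and>
        solution_on ideal_K V \<phi> \<and> (\<forall>X\<in>ball \<Theta> r. f X = \<phi> (gram X)))"
    by (rule local_function_of_gram)
next
  fix U :: "(complex ^ ('n \<times> 'n)) set" and f
  assume local: "\<forall>\<Theta>\<in>U. \<exists>r>0. ball \<Theta> r \<subseteq> U \<and>
      (\<exists>V \<phi>. open V \<and> gram ` ball \<Theta> r \<subseteq> V \<and> mv_holomorphic_on \<phi> V \<and>
        solution_on ideal_K V \<phi> \<and> (\<forall>X\<in>ball \<Theta> r. f X = \<phi> (gram X)))"
  show "solution_on ideal_J' U f"
    unfolding solution_on_def
  proof (intro ballI)
    fix P :: "('n \<times> 'n) ratweyl" and \<Theta>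
    assume P: "P \<in> ideal_J'" and "\<Theta> \<in> U"
    with local obtain r V \<phi> where r: "r > 0" and V: "open V" "gram ` ball \<Theta> r \<subseteq> V" "mv_holomorphic_on \<phi> V"
      "solution_on ideal_K V \<phi>" and eq: "\<And>X. X \<in> ball \<Theta> r \<Longrightarrow> f X = \<phi> (gram X)"
      by metis
    have \<Theta>: "\<Theta> \<in> ball \<Theta> r"
      using r by simp
    have "diffop_apply P f \<Theta> = diffop_apply P (\<lambda>X. \<phi> (gram X)) \<Theta>"
      by (rule diffop_apply_cong[OF open_ball eq \<Theta>])
    also have "\<dots> = 0"
      using solution_compose_gram(2)[OF open_ball V] P \<Theta> unfolding solution_on_def by blast
    finally show "diffop_apply P f \<Theta> = 0" .
  qed
next
  fix U :: "(complex ^ ('n \<times> 'n)) set" and V \<phi>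
  assume "open U" "open V" "gram ` U \<subseteq> V" "mv_holomorphic_on \<phi> V" "solution_on ideal_K V \<phi>"
  then show "mv_holomorphic_on (\<lambda>X. \<phi> (gram X)) U" "solution_on ideal_J' U (\<lambda>X. \<phi> (gram X))"
    by (rule solution_compose_gram)+
next
  show "holonomic_rank (ideal_K :: 'n uprod ratweyl set) = 2 * holonomic_rank (ideal_J :: ('n \<times> 'n) ratweyl set)"
    by (simp only: holonomic_rank_K holonomic_rank_J')
qed

end
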